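(* Let $R(n)$ be a rational function all of whose poles belong to $\{-\tfrac12,-1,-\tfrac32,-2,\dots\}\cup\{\tfrac12,\tfrac32,\tfrac52,\dots\}$. Then each of the five sums $$\sum_{n=0}^{\infty} R(n)\left(\frac{\binom{2n}{n}}{4^n}\right)^{k}\quad (k=0,1,-1,-2),\qquad \pi\sum_{n=0}^{\infty} R(n)\left(\frac{\binom{2n}{n}}{4^n}\right)^{2},$$ whenever convergent, is expressible via level 4 MZVs.
   Context: Colored multiple zeta values (CMZVs) of level $N'$: for positive integers $s_1,\dots,s_d$ and $N'$-th roots of unity $\epsilon_1,\dots,\epsilon_d$ with $(s_1,\epsilon_1)\neq(1,1)$, $\mathrm{Li}_{s_1,\dots,s_d}(\epsilon_1,\dots,\epsilon_d)=\sum_{n_1>n_2>\cdots>n_d>0}\prod_{j=1}^d \frac{\epsilon_j^{n_j}}{n_j^{s_j}}$ (the empty one is $1$). A number is "expressible via level $N'$ MZVs" if it is a finite linear combination of CMZVs of level $N'$, with coefficients in the field generated over $\mathbb Q(e^{2\pi i/N'})$ by the coefficients of $R$. *)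

theory Defs
  imports
    "HOL-Analysis.Analysis"
    "HOL-Computational_Algebra.Computational_Algebra"
    "HOL-Computational_Algebra.Field_as_Ring"
begin

text \<open>
  A rational function is an element of the fraction field of the polynomial ring.
  \<^const>\<open>quot_of_fract\<close> yields its reduced fraction: coprime numerator and denominator, with
  monic denominator. Hence the poles are exactly the roots of the denominator, and the
  coefficients below do not depend on a common factor.
\<close>

definition rf_num :: "complex poly fract \<Rightarrow> complex poly" where
  "rf_num R = fst (quot_of_fract R)"

definition rf_den :: "complex poly fract \<Rightarrow> complex poly" where
  "rf_den R = snd (quot_of_fract R)"

definition rf_eval :: "complex poly fract \<Rightarrow> complex \<Rightarrow> complex" where
  "rf_eval R z = poly (rf_num R) z / poly (rf_den R) z"

definition rf_poles :: "complex poly fract \<Rightarrow> complex set" where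
  "rf_poles R = {z. poly (rf_den R) z = 0}"

definition rf_coeffs :: "complex poly fract \<Rightarrow> complex set" where
  "rf_coeffs R = set (coeffs (rf_num R)) \<union> set (coeffs (rf_den R))"

definition is_subfield :: "complex set \<Rightarrow> bool" where
  "is_subfield K \<longleftrightarrow> 0 \<in> K \<and> 1 \<in> K \<and>
     (\<forall>x\<in>K. \<forall>y\<in>K. x + y \<in> K \<and> x * y \<in> K) \<and>
     (\<forall>x\<in>K. - x \<in> K \<and> inverse x \<in> K)"

text \<open>
  The rationals lie in every subfield of the complex numbers, so this is the field generated by
  \<open>S\<close> over the \<open>N\<close>-th cyclotomic field.
\<close>

definition cyclotomic_adjoin :: "nat \<Rightarrow> complex set \<Rightarrow> complex set" where
  "cyclotomic_adjoin N S = is_subfield hull (insert (exp (2 * of_real pi * \<i> / of_nat N)) S)"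

text \<open>
  The series need not converge absolutely if its first exponent is 1; it is summed by letting the
  bound \<open>M\<close> on the largest index \<open>n\<^sub>1\<close> tend to infinity. Lists are indexed from 0.
\<close>

definition Li_trunc :: "nat list \<Rightarrow> complex list \<Rightarrow> nat \<Rightarrow> complex" where
  "Li_trunc s \<epsilon> M =
     (\<Sum>n \<in> {n. length n = length s \<and> sorted_wrt (>) n \<and> set n \<subseteq> {1..M}}.
        \<Prod>j<length s. (\<epsilon> ! j) ^ (n ! j) / of_nat (n ! j) ^ (s ! j))"

definition Li :: "nat list \<Rightarrow> complex list \<Rightarrow> complex" where
  "Li s \<epsilon> = lim (Li_trunc s \<epsilon>)"

definition CMZV :: "nat \<Rightarrow> complex set" where
  "CMZV N = {Li s \<epsilon> | s \<epsilon>. length s = length \<epsilon> \<and> (\<forall>k\<in>set s. k > 0) \<and> (\<forall>e\<in>set \<epsilon>. e ^ N = 1) \<and>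
     (s \<noteq> [] \<longrightarrow> (hd s, hd \<epsilon>) \<noteq> (1, 1))}"

definition expressible_via_MZVs :: "nat \<Rightarrow> complex poly fract \<Rightarrow> complex \<Rightarrow> bool" where
  "expressible_via_MZVs N R x \<longleftrightarrow>
     (\<exists>A c. finite A \<and> A \<subseteq> CMZV N \<and> (\<forall>a\<in>A. c a \<in> cyclotomic_adjoin N (rf_coeffs R)) \<and>
        x = (\<Sum>a\<in>A. c a * a))"

definition central_binomial_ratio :: "nat \<Rightarrow> complex" where
  "central_binomial_ratio n = of_nat ((2 * n) choose n) / 4 ^ n"

end

theory Submission
  imports Defs "HOL-Real_Asymp.Real_Asymp"
begin

text \<open>
  Let \<open>c\<^sub>n = binomial(2n, n) / 4\<^sup>n\<close>. With \<open>u = sin \<theta>\<close> and \<open>t = tan(\<theta>/2)\<close>, the series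
  \<open>\<Sum> c\<^sub>n\<^sup>\<plusminus>\<^sup>1 u\<^sup>m / m\<^sup>s\<close> over \<open>m = 2n\<close> or \<open>m = 2n + 1\<close> become iterated integrals in \<open>t\<close> of the forms
  \<open>dt/t\<close>, \<open>dt/(1 + t\<^sup>2)\<close> and \<open>t dt/(1 + t\<^sup>2)\<close>, because \<open>du/u = dt/t - 2t dt/(1 + t\<^sup>2)\<close> and
  \<open>d\<theta> = 2 dt/(1 + t\<^sup>2)\<close>. These are multiple polylogarithms with letters \<open>0, i, -i\<close>, and their limits at
  \<open>t = 1\<close> are level 4 values. A second factor \<open>c\<^sub>n\<^sup>\<plusminus>\<^sup>1\<close> is a Wallis integral, which costs one more
  integration. A general \<open>R\<close> is split into partial fractions; telescoping sums \<open>\<Sum> (q(n+1) c\<^sub>n\<^sub>+\<^sub>1\<^sup>k - q(n) c\<^sub>n\<^sup>k)\<close>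
  move all poles to \<open>0\<close> and \<open>-1/2\<close>. Some divergent part remains, of the form \<open>p(n)/(n + 1/2)\<^sup>j\<close> with
  a polynomial \<open>p\<close>, and convergence of the given series forces \<open>p = 0\<close>.
\<close>

section \<open>Truncated polylogarithms\<close>

text \<open>The span of level 4 values is treated only as a vector space over \<open>K\<close>: no
  step multiplies two such values. Hence the factor \<open>pi\<close> before the square, since the
  Wallis integral of an even power is \<open>pi / 2 * c\<^sub>n\<close>, and hence the care about
  boundary values of telescoping sums. Those that do not vanish come from Wallis' product: a
  multiple of \<open>pi\<close> for exponent -2, and \<open>pi * (1 / pi)\<close> for exponent 2.
  The form dt/(1 - t), which would produce divergent values at t = 1, never occurs, as the
  half-angle forms have poles only at 0, i and -i. So all functions have finite limits at 1, and
  Abel's theorem identifies them with values of series that may converge only conditionally.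
  Telescoping moves a pole by one but multiplies by a power of
  \<open>c\<^sub>n\<^sub>+\<^sub>1 / c\<^sub>n = (n + 1/2) / (n + 1)\<close> or of a shifted
  inverse, which brings in new poles. For positive exponents the poles at -1 and 1/2 then depend on
  each other; special telescoping sequences settle the pole at -1 and break this circle.\<close>

lemma Abel_limit:
  fixes a :: "nat \<Rightarrow> complex"
  assumes "summable a"
  shows "((\<lambda>x::real. \<Sum>n. a n * of_real x ^ n) \<longlongrightarrow> suminf a) (at_left 1)"
proof -
  define A where "A = suminf a"
  define r where "r n = (\<Sum>k<Suc n. a k) - A" for n
  have r0: "r \<longlonglongrightarrow> 0"
    unfolding r_def A_def using LIMSEQ_Suc[OF summable_LIMSEQ[OF assms]] by (simp add: LIM_zero)
  obtain C where C: "\<And>n. norm (r n) \<le> C"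
    using r0 by (meson Bseq_def convergentI convergent_imp_Bseq)
  \<comment> \<open>Multiplying by the geometric series turns coefficients into partial sums, so the
    difference quotient at 1 is the power series of the remainders \<open>r\<close>.\<close>
  have eq: "(\<lambda>n. r n * of_real x ^ n) sums (((\<Sum>n. a n * of_real x ^ n) - A) / (1 - of_real x))"
    if x: "0 < x" "x < 1" for x :: real
  proof -
    have nx: "norm (complex_of_real x) < 1" using x by simp
    have sa: "summable (\<lambda>n. norm (a n * of_real x ^ n))"
      using powser_insidea[of a 1 "of_real x"] assms nx by simp
    have sg: "summable (\<lambda>n. norm (complex_of_real x ^ n))"
      using x by (simp add: norm_power)
    have "(\<lambda>n. (\<Sum>i\<le>n. (a i * of_real x ^ i) * of_real x ^ (n - i))) sums
            ((\<Sum>n. a n * of_real x ^ n) * (\<Sum>n. of_real x ^ n))"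
      by (rule Cauchy_product_sums[OF sa sg])
    moreover have "(\<Sum>i\<le>n. (a i * of_real x ^ i) * complex_of_real x ^ (n - i)) =
        (\<Sum>k<Suc n. a k) * of_real x ^ n" for n
      unfolding lessThan_Suc_atMost sum_distrib_right
      by (rule sum.cong) (auto simp: mult.assoc simp flip: power_add)
    ultimately have "(\<lambda>n. (\<Sum>k<Suc n. a k) * of_real x ^ n) sums
            ((\<Sum>n. a n * of_real x ^ n) / (1 - of_real x))"
      by (simp only: suminf_geometric[OF nx] times_divide_eq_right mult_1_right)
    from sums_diff[OF this sums_mult[OF geometric_sums[OF nx], of A]]
    have "(\<lambda>n. (\<Sum>k<Suc n. a k) * of_real x ^ n - A * of_real x ^ n) sums
            ((\<Sum>n. a n * of_real x ^ n) / (1 - of_real x) - A * (1 / (1 - of_real x)))" .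
    then show ?thesis by (simp only: r_def left_diff_distrib diff_divide_distrib times_divide_eq_right mult_1_right)
  qed
  show ?thesis
    unfolding A_def[symmetric]
  proof (rule tendstoI)
    fix e :: real assume e: "e > 0"
    from r0 e obtain N where N: "\<And>n. n \<ge> N \<Longrightarrow> norm (r n) < e / 2"
      unfolding LIMSEQ_iff by (metis diff_zero half_gt_zero)
    have "((\<lambda>x::real. (1 - x) * (\<Sum>n<N. C)) \<longlongrightarrow> (1 - 1) * (\<Sum>n<N. C)) (at_left 1)"
      by (intro tendsto_intros)
    then have "\<forall>\<^sub>F x::real in at_left 1. (1 - x) * (\<Sum>n<N. C) < e / 2"
      by (rule order_tendstoD) (use e in auto)
    moreover have "\<forall>\<^sub>F x::real in at_left 1. 0 < x \<and> x < 1"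
      by (auto simp: eventually_at_left_field intro!: exI[of _ 0])
    ultimately show "\<forall>\<^sub>F x in at_left 1. dist (\<Sum>n. a n * of_real x ^ n) A < e"
    proof eventually_elim
      case (elim x)
      then have x: "0 < x" "x < 1" by auto
      have sg: "summable (\<lambda>n. x ^ n)" using x by simp
      \<comment> \<open>The finitely many remainders below \<open>N\<close> contribute a bounded
        amount, which the factor \<open>1 - x\<close> kills; the others contribute at most
        \<open>e / 2\<close> after multiplication by it.\<close>
      have bd: "norm (r n * of_real x ^ n) \<le> (if n < N then C else 0) + e / 2 * x ^ n" for n
      proof (cases "n < N")
        case True
        have "norm (r n) * x ^ n \<le> C * 1"
          using C[of n] x by (intro mult_mono) (auto simp: power_le_one intro: order_trans[OF norm_ge_zero])
        then show ?thesis using True e x by (simp add: norm_mult norm_power add_increasing2)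
      next
        case False
        then show ?thesis using N[of n] e x by (simp add: norm_mult norm_power)
      qed
      have nx: "norm x < 1" using x by simp
      have s1: "(\<lambda>n. (if n < N then C else 0) + e / 2 * x ^ n) sums ((\<Sum>n<N. C) + e / 2 * (1 / (1 - x)))"
        using sums_add[OF sums_If_finite_set[of "{..<N}" "\<lambda>_. C"] sums_mult[OF geometric_sums[OF nx], of "e/2"]]
        by (simp only: finite_lessThan lessThan_iff simp_thms)
      have "norm (\<Sum>n. r n * of_real x ^ n) \<le> (\<Sum>n. (if n < N then C else 0) + e / 2 * x ^ n)"
        by (rule norm_suminf_le[OF bd sums_summable[OF s1]])
      also have "\<dots> = (\<Sum>n<N. C) + e / 2 * (1 / (1 - x))"
        by (rule sums_unique[OF s1, symmetric])
      finally have "norm (\<Sum>n. r n * of_real x ^ n) \<le> (\<Sum>n<N. C) + e / 2 * (1 / (1 - x))" .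
      then have "norm (((\<Sum>n. a n * of_real x ^ n) - A) / (1 - of_real x)) \<le> (\<Sum>n<N. C) + e / 2 * (1 / (1 - x))"
        using sums_unique[OF eq[OF x]] by simp
      moreover have "norm (1 - complex_of_real x) = 1 - x"
        using x by (metis abs_of_pos diff_gt_0_iff_gt norm_of_real of_real_1 of_real_diff)
      ultimately have "norm ((\<Sum>n. a n * of_real x ^ n) - A) \<le> ((\<Sum>n<N. C) + e / 2 * (1 / (1 - x))) * (1 - x)"
        using x by (simp only: norm_divide pos_divide_le_eq)
      also have "\<dots> = (1 - x) * (\<Sum>n<N. C) + e / 2"
        using x by (simp only: distrib_right mult.assoc) simp
      finally have "norm ((\<Sum>n. a n * of_real x ^ n) - A) \<le> (1 - x) * (\<Sum>n<N. C) + e / 2" .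
      then show ?case using elim by (simp add: dist_norm)
    qed
  qed
qed

text \<open>Summation by parts. Bounded variation replaces the usual monotonicity of
  \<open>d\<close>, because the weights in the application, inner sums divided by the index, are
  complex.\<close>

lemma Dirichlet_test:
  fixes b d :: "nat \<Rightarrow> complex"
  assumes b: "\<And>n. norm (\<Sum>k<n. b k) \<le> C"
    and d0: "d \<longlonglongrightarrow> 0"
    and d: "summable (\<lambda>n. norm (d (Suc n) - d n))"
  shows "summable (\<lambda>n. b n * d n)"
proof -
  define B where "B n = (\<Sum>k<n. b k)" for n
  have parts: "(\<Sum>k<n. b k * d k) = B n * d n - (\<Sum>k<n. B (Suc k) * (d (Suc k) - d k))" for n
    by (induction n) (auto simp: B_def algebra_simps)
  have C: "C \<ge> 0" using b[of 0] by simp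
  have "summable (\<lambda>k. B (Suc k) * (d (Suc k) - d k))"
    by (rule summable_comparison_test'[where g = "\<lambda>n. C * norm (d (Suc n) - d n)" and N = 0])
       (use b in \<open>auto simp: B_def norm_mult simp del: sum.lessThan_Suc intro!: summable_mult d mult_right_mono\<close>)
  moreover have "(\<lambda>n. B n * d n) \<longlonglongrightarrow> 0"
  proof (rule tendsto_norm_zero_cancel, rule tendsto_sandwich[OF _ _ tendsto_const])
    show "(\<lambda>n. C * norm (d n)) \<longlonglongrightarrow> 0"
      using tendsto_mult_right_zero[OF tendsto_norm_zero[OF d0]] by blast
    show "\<forall>\<^sub>F n in sequentially. norm (B n * d n) \<le> C * norm (d n)"
      using b by (intro always_eventually allI) (auto simp: B_def norm_mult intro!: mult_right_mono)
  qed auto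
  ultimately have "(\<lambda>n. \<Sum>k<n. b k * d k) \<longlonglongrightarrow> 0 - (\<Sum>k. B (Suc k) * (d (Suc k) - d k))"
    unfolding parts by (intro tendsto_diff summable_LIMSEQ)
  then show ?thesis by (auto simp: summable_def sums_def)
qed

text \<open>The coefficient of \<open>t ^ n\<close> in a multiple polylogarithm, i.e. the part of
  the nested sum with largest index \<open>n\<close>. The empty word is concentrated at index 0, so
  that the sum over \<open>m < n\<close> below the last letter is 1 for positive
  \<open>n\<close>.\<close>

fun liq :: "nat list \<Rightarrow> complex list \<Rightarrow> nat \<Rightarrow> complex" where
  "liq (s # ss) (e # es) n = (if n = 0 then 0 else e ^ n / of_nat n ^ s * (\<Sum>m<n. liq ss es m))"
| "liq _ _ n = (if n = 0 then 1 else 0)"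

lemma Li_trunc_Cons:
  "Li_trunc (s # ss) (e # es) M = (\<Sum>n\<in>{1..M}. e ^ n / of_nat n ^ s * Li_trunc ss es (n - 1))"
proof -
  define X where "X ss M = {n. length n = length (ss :: nat list) \<and> sorted_wrt (>) n \<and> set n \<subseteq> {1..M}}"
    for ss and M :: nat
  define f where "f ss es n = (\<Prod>j<length ss. (es ! j) ^ (n ! j) / of_nat (n ! j) ^ (ss ! j))"
    for ss and es :: "complex list" and n :: "nat list"
  have L: "Li_trunc ss es M = sum (f ss es) (X ss M)" for ss es M
    by (simp add: Li_trunc_def X_def f_def)
  have fin: "finite (X ss M)" for ss M
    by (rule finite_subset[OF _ finite_lists_length_eq[of "{1..M}" "length ss"]]) (auto simp: X_def)
  have img: "X (s # ss) M = (\<lambda>(n, ns). n # ns) ` (SIGMA n:{1..M}. X ss (n - 1))"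
  proof (intro equalityI subsetI)
    fix x assume "x \<in> X (s # ss) M"
    then show "x \<in> (\<lambda>(n, ns). n # ns) ` (SIGMA n:{1..M}. X ss (n - 1))"
      by (cases x) (force simp: X_def image_iff)+
  next
    fix x assume "x \<in> (\<lambda>(n, ns). n # ns) ` (SIGMA n:{1..M}. X ss (n - 1))"
    then show "x \<in> X (s # ss) M" by (force simp: X_def)
  qed
  have "Li_trunc (s # ss) (e # es) M = (\<Sum>(n, ns)\<in>(SIGMA n:{1..M}. X ss (n - 1)). f (s # ss) (e # es) (n # ns))"
    unfolding L img by (subst sum.reindex) (auto simp: inj_on_def case_prod_unfold)
  also have "\<dots> = (\<Sum>n\<in>{1..M}. \<Sum>ns\<in>X ss (n - 1). f (s # ss) (e # es) (n # ns))"
    by (rule sum.Sigma[symmetric]) (auto simp: fin)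
  also have "\<dots> = (\<Sum>n\<in>{1..M}. e ^ n / of_nat n ^ s * Li_trunc ss es (n - 1))"
    unfolding L sum_distrib_left
    by (intro sum.cong refl) (simp add: f_def prod.lessThan_Suc_shift del: prod.lessThan_Suc)
  finally show ?thesis .
qed

lemma Li_trunc_eq_sum_liq:
  "length s = length e \<Longrightarrow> Li_trunc s e M = (\<Sum>n<Suc M. liq s e n)"
proof (induction s e arbitrary: M rule: list_induct2)
  case Nil
  have "{n. n = [] \<and> sorted_wrt (>) n \<and> set n \<subseteq> {1..M}} = {[] :: nat list}" by auto
  then show ?case by (simp add: Li_trunc_def)
next
  case (Cons s ss e es)
  have "(\<Sum>n<Suc M. liq (s # ss) (e # es) n) = (\<Sum>n\<in>{1..M}. liq (s # ss) (e # es) n)"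
    by (rule sum.mono_neutral_right) auto
  also have "\<dots> = Li_trunc (s # ss) (e # es) M"
    unfolding Li_trunc_Cons by (intro sum.cong refl) (auto simp: Cons.IH simp del: sum.lessThan_Suc)
  finally show ?case by simp
qed

text \<open>Compare with the telescoping sum of \<open>2 * (sqrt n - sqrt (n - 1))\<close>.\<close>

lemma sum_inverse_sqrt_le: "(\<Sum>n\<in>{1..M}. 1 / sqrt (real n)) \<le> 2 * sqrt (real M)"
proof (induction M)
  case (Suc M)
  have "1 \<le> 2 * sqrt (Suc M) * (sqrt (Suc M) - sqrt M)"
  proof -
    have "1 = (sqrt (Suc M) + sqrt M) * (sqrt (Suc M) - sqrt M)"
      by (simp add: algebra_simps)
    also have "\<dots> \<le> (2 * sqrt (Suc M)) * (sqrt (Suc M) - sqrt M)"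
      by (intro mult_right_mono) auto
    finally show ?thesis .
  qed
  then have "1 / sqrt (Suc M) \<le> 2 * (sqrt (Suc M) - sqrt M)"
    by (simp add: divide_le_eq field_simps)
  with Suc show ?case by simp
qed auto

definition li_word :: "nat list \<Rightarrow> complex list \<Rightarrow> bool" where
  "li_word s e \<longleftrightarrow> length s = length e \<and> (\<forall>k\<in>set s. k > 0) \<and> (\<forall>x\<in>set e. x ^ 4 = 1)"

lemma li_word_Nil [simp]: "li_word [] []"
  and li_word_Cons [simp]: "li_word (s # ss) (e # es) \<longleftrightarrow> s > 0 \<and> e ^ 4 = 1 \<and> li_word ss es"
  by (auto simp: li_word_def)

lemma norm_eq_1_if_root: "(e::complex) ^ 4 = 1 \<Longrightarrow> norm e = 1"
  by (metis norm_ge_zero norm_one norm_power power_eq_1_iff zero_neq_numeral)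

lemma li_word_induct [consumes 1, case_names Nil Cons]:
  assumes "li_word s e" "P [] []"
    "\<And>s ss e es. s > 0 \<Longrightarrow> e ^ 4 = 1 \<Longrightarrow> li_word ss es \<Longrightarrow> P ss es \<Longrightarrow> P (s # ss) (e # es)"
  shows "P s e"
proof -
  have "length s = length e" using assms by (simp add: li_word_def)
  then show ?thesis using assms(1)
    by (induction s e rule: list_induct2) (auto intro: assms)
qed

lemma li_word_cases [consumes 1, case_names Nil Cons]:
  assumes "li_word s e"
  obtains "s = []" "e = []"
  | s' ss e' es where "s = s' # ss" "e = e' # es" "s' > 0" "e' ^ 4 = 1" "li_word ss es"
  using assms by (cases s; cases e) (auto simp: li_word_def)

lemma norm_liq_Cons_le:
  assumes "e ^ 4 = 1" "norm (\<Sum>m<n. liq ss es m) \<le> B"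
  shows "norm (liq (s # ss) (e # es) n) \<le> B / real n ^ s"
proof (cases "n = 0")
  case False
  then show ?thesis
    using assms by (simp add: norm_mult norm_divide norm_power norm_eq_1_if_root divide_right_mono)
qed (use order_trans[OF norm_ge_zero assms(2)] in \<open>auto intro: divide_nonneg_nonneg\<close>)

text \<open>The true growth is at most a power of a logarithm. The cruder square root is chosen
  because it reproduces itself: dividing by the index and summing again only doubles the
  constant.\<close>

lemma liq_partial_sum_bound:
  assumes "li_word s e"
  shows "\<exists>C\<ge>0. \<forall>n. norm (\<Sum>m<n. liq s e m) \<le> C * sqrt (real n)"
  using assms
proof (induction rule: li_word_induct)
  case Nil
  have "norm (\<Sum>m<n. liq [] [] m) \<le> 1 * sqrt (real n)" for n
    by (cases n) (auto simp: sum.lessThan_Suc_shift simp del: sum.lessThan_Suc)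
  then show ?case by (metis zero_le_one)
next
  case (Cons s ss e es)
  then obtain C where C: "C \<ge> 0" "\<And>n. norm (\<Sum>m<n. liq ss es m) \<le> C * sqrt (real n)" by auto
  have "norm (\<Sum>m<n. liq (s # ss) (e # es) m) \<le> (2 * C) * sqrt (real n)" for n
  proof -
    have b: "norm (liq (s # ss) (e # es) m) \<le> C * (1 / sqrt m)" for m
    proof -
      have "norm (liq (s # ss) (e # es) m) \<le> C * sqrt m / real m ^ s"
        by (rule norm_liq_Cons_le) (use Cons C in auto)
      also have "\<dots> \<le> C * sqrt m / real m"
        using C Cons by (cases "m = 0") (auto intro!: divide_left_mono self_le_power)
      also have "\<dots> = C * (1 / sqrt m)"
        by (cases "m = 0") (simp_all add: field_simps)
      finally show ?thesis .
    qed
    have "norm (\<Sum>m<n. liq (s # ss) (e # es) m) \<le> (\<Sum>m<n. C * (1 / sqrt m))"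
      by (rule sum_norm_le) (rule b)
    also have "\<dots> \<le> (\<Sum>m\<in>{0..n}. C * (1 / sqrt m))"
      by (rule sum_mono2) (use C in auto)
    also have "\<dots> = (\<Sum>m\<in>{1..n}. C * (1 / sqrt m))"
      by (rule sum.mono_neutral_right) auto
    also have "\<dots> \<le> C * (2 * sqrt n)"
      unfolding sum_distrib_left[symmetric] using C sum_inverse_sqrt_le[of n] by (intro mult_left_mono)
    finally show ?thesis by simp
  qed
  with C show ?case by (intro exI[of _ "2 * C"]) auto
qed

lemma liq_bound:
  assumes "li_word s e"
  shows "\<exists>C\<ge>0. \<forall>n\<ge>1. norm (liq s e n) \<le> C * (sqrt (real n) / real n)"
  using assms
proof (cases rule: li_word_cases)
  case Nil
  then show ?thesis by (intro exI[of _ 0]) auto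
next
  case (Cons s' ss e' es)
  then obtain C where C: "C \<ge> 0" "\<And>n. norm (\<Sum>m<n. liq ss es m) \<le> C * sqrt (real n)"
    using liq_partial_sum_bound[of ss es] by auto
  have "norm (liq s e n) \<le> C * (sqrt n / n)" if "n \<ge> 1" for n
  proof -
    have "norm (liq s e n) \<le> C * sqrt n / real n ^ s'"
      unfolding Cons by (rule norm_liq_Cons_le) (use Cons C in auto)
    also have "\<dots> \<le> C * sqrt n / real n"
      using C Cons that by (intro divide_left_mono self_le_power) auto
    finally show ?thesis by simp
  qed
  with C show ?thesis by blast
qed

lemma bounded_powers_sum_root_of_unity:
  assumes "(e::complex) ^ 4 = 1" "e \<noteq> 1"
  shows "norm (\<Sum>k<n. e ^ k) \<le> 2 / norm (e - 1)"
proof -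
  have "norm (e ^ n - 1) \<le> 2"
    using norm_triangle_ineq4[of "e ^ n" 1] by (simp add: norm_power norm_eq_1_if_root assms)
  then show ?thesis using assms by (simp add: geometric_sum norm_divide divide_right_mono)
qed

lemma summable_sqrt_div: "summable (\<lambda>n. sqrt (real n) / real n ^ 2)"
proof -
  have "summable (\<lambda>n. real n powr (-3/2))" by (subst summable_real_powr_iff) auto
  moreover have "sqrt (real n) / real n ^ 2 = real n powr (-3/2)" for n
  proof (cases "n = 0")
    case False
    then have "sqrt (real n) / real n ^ 2 = real n powr (1/2) / real n powr 2"
      by (simp add: powr_half_sqrt)
    also have "\<dots> = real n powr (1/2 - 2)" by (simp only: powr_diff)
    finally show ?thesis by simp
  qed auto
  ultimately show ?thesis by simp
qed

text \<open>With first exponent at least 2 the square root bound leaves the majorant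
  \<open>n powr (-3/2)\<close>. With first exponent 1 convergence comes from the oscillation of
  \<open>e ^ n\<close>, and this is where (1, 1) has to be excluded.\<close>

lemma summable_liq:
  assumes "li_word (s # ss) (e # es)" "(s, e) \<noteq> (1, 1)"
  shows "summable (liq (s # ss) (e # es))"
proof -
  obtain C where C: "C \<ge> 0" "\<And>n. norm (\<Sum>m<n. liq ss es m) \<le> C * sqrt (real n)"
    using liq_partial_sum_bound[of ss es] assms by auto
  show ?thesis
  proof (cases "s = 1")
    case False
    then have s: "s \<ge> 2" using assms by auto
    show ?thesis
    proof (rule summable_comparison_test'[where N = 1])
      show "summable (\<lambda>n. C * (sqrt (real n) / real n ^ 2))"
        by (intro summable_mult summable_sqrt_div)
      fix n :: nat assume n: "n \<ge> 1"
      have "norm (liq (s # ss) (e # es) n) \<le> C * sqrt n / real n ^ s"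
        by (rule norm_liq_Cons_le) (use assms C in auto)
      also have "\<dots> \<le> C * sqrt n / real n ^ 2"
        using C s n by (intro divide_left_mono power_increasing) auto
      finally show "norm (liq (s # ss) (e # es) n) \<le> C * (sqrt (real n) / real n ^ 2)" by simp
    qed
  next
    case True
    with assms have e: "e \<noteq> 1" "e ^ 4 = 1" by auto
    obtain C' where C': "C' \<ge> 0" "\<And>n. n \<ge> 1 \<Longrightarrow> norm (liq ss es n) \<le> C' * (sqrt n / n)"
      using liq_bound[of ss es] assms by auto
    define S where "S n = (\<Sum>m<n. liq ss es m)" for n
    define d where "d n = S n / of_nat n" for n
    have S: "norm (S n) \<le> C * sqrt n" for n using C by (simp add: S_def)
    have dn: "norm (d n) \<le> C * (sqrt n / n)" for n
      using S[of n] by (simp add: d_def norm_divide divide_right_mono)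
    have "(\<lambda>n. C * (sqrt (real n) / real n)) \<longlonglongrightarrow> 0" by real_asymp
    then have d0: "d \<longlonglongrightarrow> 0"
      using dn by (intro Lim_null_comparison[of d "\<lambda>n. C * (sqrt (real n) / real n)"]) auto
    have "summable (\<lambda>n. norm (d (Suc n) - d n))"
    proof (rule summable_comparison_test'[where N = 1])
      show "summable (\<lambda>n. (C + C') * (sqrt (real n) / real n ^ 2))"
        by (intro summable_mult summable_sqrt_div)
      fix n :: nat assume n: "n \<ge> 1"
      \<comment> \<open>The increment of a mean is the new term minus the old mean, divided by
        \<open>n + 1\<close>. Both are of order \<open>1 / sqrt n\<close>, so the variation is
        summable.\<close>
      have "d (Suc n) - d n = (liq ss es n - d n) / of_nat (Suc n)"
        using n by (simp add: d_def S_def field_simps del: of_nat_Suc) (simp add: algebra_simps)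
      then have "norm (d (Suc n) - d n) \<le> (norm (liq ss es n) + norm (d n)) / Suc n"
        by (simp add: norm_divide divide_right_mono norm_triangle_ineq4 del: of_nat_Suc)
      also have "\<dots> \<le> (C' * (sqrt n / n) + C * (sqrt n / n)) / n"
        using n C C' by (intro frac_le add_mono C' dn) auto
      also have "\<dots> = (C + C') * (sqrt n / real n ^ 2)" by (simp add: power2_eq_square add_divide_distrib distrib_right)
      finally show "norm (norm (d (Suc n) - d n)) \<le> (C + C') * (sqrt n / real n ^ 2)" by simp
    qed
    from Dirichlet_test[OF bounded_powers_sum_root_of_unity[OF e(2,1)] d0 this]
    have "summable (\<lambda>n. e ^ n * d n)" .
    moreover have "e ^ n * d n = liq (s # ss) (e # es) n" for n
      using True by (simp add: d_def S_def)
    ultimately have "liq (s # ss) (e # es) = (\<lambda>n. e ^ n * d n)" by (intro ext) simp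
    then show ?thesis using \<open>summable (\<lambda>n. e ^ n * d n)\<close> by simp
  qed
qed

section \<open>One-variable multiple polylogarithms\<close>

lemma powser_has_vector_derivative:
  fixes q :: "nat \<Rightarrow> complex"
  assumes "summable q" "\<bar>t\<bar> < 1"
  shows "((\<lambda>t. \<Sum>n. q n * of_real t ^ n) has_vector_derivative (\<Sum>n. diffs q n * of_real t ^ n)) (at t)"
proof -
  have "((\<lambda>z. \<Sum>n. q n * z ^ n) has_field_derivative (\<Sum>n. diffs q n * of_real t ^ n)) (at (of_real t))"
    by (rule termdiffs_strong[where K = 1]) (use assms in auto)
  then show ?thesis by (rule has_vector_derivative_real_field)
qed

lemma powser_continuous_on:
  fixes q :: "nat \<Rightarrow> complex"
  assumes "summable q"
  shows "continuous_on {0..<1} (\<lambda>t. \<Sum>n. q n * of_real t ^ n)"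
  by (intro continuous_at_imp_continuous_on ballI
        has_vector_derivative_continuous[OF powser_has_vector_derivative[OF assms]]) auto

lemma diffs_sums:
  fixes q :: "nat \<Rightarrow> complex"
  assumes "summable q" "norm z < 1"
  shows "(\<lambda>n. diffs q n * z ^ n) sums (\<Sum>n. diffs q n * z ^ n)"
proof -
  have "summable (\<lambda>n. diffs q n * z ^ n)"
    by (rule termdiff_converges[where K = 1])
       (use assms powser_inside[of q 1] in auto)
  then show ?thesis by (rule summable_sums)
qed

text \<open>The coefficient form of \<open>\<integral> f(t) dt/(a - t)\<close>.\<close>

lemma powser_deriv_over_linear:
  fixes q b :: "nat \<Rightarrow> complex"
  assumes b: "summable b" and a: "norm a = 1" and t: "0 \<le> t" "t < 1"
    and rec: "\<And>n. b n = (if n = 0 then 0 else inverse a ^ n / of_nat n * (\<Sum>m<n. a ^ m * q m))"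
  shows "(\<Sum>n. diffs b n * of_real t ^ n) = (\<Sum>n. q n * of_real t ^ n) * (1 / (a - of_real t))"
proof -
  define z where "z = complex_of_real t"
  define D where "D = (\<Sum>n. diffs b n * z ^ n)"
  have a0: "a \<noteq> 0" using a by auto
  have z: "norm z < 1" using t by (simp add: z_def)
  have D: "(\<lambda>n. diffs b n * z ^ n) sums D"
    unfolding D_def by (rule diffs_sums[OF b z])
  have "(\<lambda>n. (if n = 0 then 0 else diffs b (n - 1)) * z ^ n) sums (z * D)"
    using sums_mult[OF D, of z] sums_Suc_iff[of "\<lambda>n. (if n = 0 then 0 else diffs b (n - 1)) * z ^ n" "z * D"]
    by (simp add: mult_ac)
  from sums_diff[OF sums_mult[OF D, of a] this]
  have "(\<lambda>n. a * (diffs b n * z ^ n) - (if n = 0 then 0 else diffs b (n - 1)) * z ^ n) sums ((a - z) * D)"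
    by (simp add: left_diff_distrib)
  moreover have "a * (diffs b n * z ^ n) - (if n = 0 then 0 else diffs b (n - 1)) * z ^ n = q n * z ^ n" for n
  proof -
    have db: "diffs b n = inverse a ^ Suc n * (\<Sum>m<Suc n. a ^ m * q m)" for n
      by (simp add: diffs_def rec del: of_nat_Suc sum.lessThan_Suc)
    have "a * diffs b n - (if n = 0 then 0 else diffs b (n - 1)) = q n"
      using a0 by (cases n) (simp_all add: db field_simps)
    then show ?thesis by (metis left_diff_distrib mult.assoc)
  qed
  ultimately have "(\<lambda>n. q n * z ^ n) sums ((a - z) * D)" by simp
  moreover have "a - z \<noteq> 0" using a z by auto
  ultimately show ?thesis by (simp add: sums_iff D_def z_def)
qed

section \<open>The span of the level 4 values over a field containing i\<close>

locale subfield_with_i =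
  fixes K :: "complex set"
  assumes subfield: "is_subfield K" and i_in_K [simp]: "\<i> \<in> K"
begin

lemma K_simps [simp]: "0 \<in> K" "1 \<in> K"
  and K_add [intro]: "x \<in> K \<Longrightarrow> y \<in> K \<Longrightarrow> x + y \<in> K"
  and K_mult [intro]: "x \<in> K \<Longrightarrow> y \<in> K \<Longrightarrow> x * y \<in> K"
  and K_minus [intro]: "x \<in> K \<Longrightarrow> - x \<in> K"
  and K_inverse [intro]: "x \<in> K \<Longrightarrow> inverse x \<in> K"
  using subfield by (auto simp: is_subfield_def)

lemma K_diff [intro]: "x \<in> K \<Longrightarrow> y \<in> K \<Longrightarrow> x - y \<in> K"
  using K_add[of x "- y"] by auto

lemma K_divide [intro]: "x \<in> K \<Longrightarrow> y \<in> K \<Longrightarrow> x / y \<in> K"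
  by (auto simp: divide_inverse)

lemma K_of_nat [simp]: "of_nat n \<in> K"
  by (induction n) auto

lemma K_numeral [simp]: "numeral n \<in> K"
  using K_of_nat[of "numeral n"] by simp

lemma K_power [intro]: "x \<in> K \<Longrightarrow> x ^ n \<in> K"
  by (induction n) auto

lemma K_powi [intro]: "x \<in> K \<Longrightarrow> x powi n \<in> K"
  by (auto simp: power_int_def)

definition mzv_span :: "complex set" where
  "mzv_span = {\<Sum>a\<in>A. c a * a | A c. finite A \<and> A \<subseteq> CMZV 4 \<and> (\<forall>a\<in>A. c a \<in> K)}"

lemma mzv_span_scale [intro]:
  assumes "k \<in> K" "x \<in> mzv_span"
  shows "k * x \<in> mzv_span"
proof -
  from assms(2) obtain A c where A: "x = (\<Sum>a\<in>A. c a * a)" "finite A" "A \<subseteq> CMZV 4" "\<forall>a\<in>A. c a \<in> K"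
    by (auto simp: mzv_span_def)
  then have "k * x = (\<Sum>a\<in>A. (k * c a) * a)" by (simp add: sum_distrib_left mult.assoc)
  with A assms(1) show ?thesis unfolding mzv_span_def
    by (intro CollectI exI[of _ A] exI[of _ "\<lambda>a. k * c a"]) auto
qed

lemma mzv_span_add [intro]:
  assumes "x \<in> mzv_span" "y \<in> mzv_span"
  shows "x + y \<in> mzv_span"
proof -
  obtain A c B d where A: "x = (\<Sum>a\<in>A. c a * a)" "finite A" "A \<subseteq> CMZV 4" "\<forall>a\<in>A. c a \<in> K"
    and B: "y = (\<Sum>a\<in>B. d a * a)" "finite B" "B \<subseteq> CMZV 4" "\<forall>a\<in>B. d a \<in> K"
    using assms by (auto simp: mzv_span_def)
  define f where "f a = (if a \<in> A then c a else 0) + (if a \<in> B then d a else 0)" for a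
  have "x = (\<Sum>a\<in>A \<union> B. (if a \<in> A then c a else 0) * a)"
    unfolding A(1) by (rule sum.mono_neutral_cong_left) (use A B in auto)
  moreover have "y = (\<Sum>a\<in>A \<union> B. (if a \<in> B then d a else 0) * a)"
    unfolding B(1) by (rule sum.mono_neutral_cong_left) (use A B in auto)
  ultimately have "x + y = (\<Sum>a\<in>A \<union> B. f a * a)"
    by (simp add: f_def distrib_right sum.distrib)
  then show ?thesis unfolding mzv_span_def
    using A B by (intro CollectI exI[of _ "A \<union> B"] exI[of _ f]) (auto simp: f_def)
qed

lemma CMZV_in_span: "x \<in> CMZV 4 \<Longrightarrow> x \<in> mzv_span"
  unfolding mzv_span_def by (intro CollectI exI[of _ "{x}"] exI[of _ "\<lambda>_. 1"]) auto

lemma Li_Nil: "Li [] [] = 1"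
proof -
  have "Li_trunc [] [] = (\<lambda>_. 1)"
    by (intro ext) (simp add: Li_trunc_eq_sum_liq sum.lessThan_Suc_shift del: sum.lessThan_Suc)
  then show ?thesis by (simp add: Li_def)
qed

lemma K_in_span [intro]: "x \<in> K \<Longrightarrow> x \<in> mzv_span"
proof -
  have "1 \<in> CMZV 4" unfolding CMZV_def by (intro CollectI exI[of _ "[]"]) (simp add: Li_Nil)
  then show "x \<in> K \<Longrightarrow> x \<in> mzv_span"
    using mzv_span_scale[of x 1] CMZV_in_span by simp
qed

lemma mzv_span_minus [intro]: "x \<in> mzv_span \<Longrightarrow> - x \<in> mzv_span"
  using mzv_span_scale[OF K_minus[OF K_simps(2)], of x] by simp

lemma mzv_span_diff [intro]: "x \<in> mzv_span \<Longrightarrow> y \<in> mzv_span \<Longrightarrow> x - y \<in> mzv_span"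
  using mzv_span_add[of x "- y"] by auto

lemma mzv_span_scale' [intro]: "k \<in> K \<Longrightarrow> x \<in> mzv_span \<Longrightarrow> x * k \<in> mzv_span"
  using mzv_span_scale[of k x] by (simp add: mult.commute)

lemma mzv_span_divide [intro]: "k \<in> K \<Longrightarrow> x \<in> mzv_span \<Longrightarrow> x / k \<in> mzv_span"
  by (auto simp: divide_inverse)

lemma suminf_liq_in_span:
  assumes "li_word (s # ss) (e # es)" "(s, e) \<noteq> (1, 1)"
  shows "suminf (liq (s # ss) (e # es)) \<in> mzv_span"
proof -
  have len: "length (s # ss) = length (e # es)" using assms by (simp add: li_word_def)
  have "Li_trunc (s # ss) (e # es) \<longlonglongrightarrow> suminf (liq (s # ss) (e # es))"
    using LIMSEQ_Suc[OF summable_LIMSEQ[OF summable_liq[OF assms]]] unfolding Li_trunc_eq_sum_liq[OF len] .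
  then have "Li (s # ss) (e # es) = suminf (liq (s # ss) (e # es))"
    unfolding Li_def by (rule limI)
  moreover have "Li (s # ss) (e # es) \<in> CMZV 4"
    unfolding CMZV_def using assms by (intro CollectI exI[of _ "s # ss"] exI[of _ "e # es"]) (auto simp: li_word_def)
  ultimately show ?thesis using CMZV_in_span by simp
qed

text \<open>Constants are left out on purpose: every member vanishes at 0, which makes division by t
  harmless and lets a member be recognised from its derivative. Words starting with (1, 1) are left
  out because their functions may diverge at t = 1.\<close>

inductive polylog_fun :: "(real \<Rightarrow> complex) \<Rightarrow> bool" where
  word: "li_word (s # ss) (e # es) \<Longrightarrow> (s, e) \<noteq> (1, 1) \<Longrightarrow>
    polylog_fun (\<lambda>t. \<Sum>n. liq (s # ss) (e # es) n * of_real t ^ n)"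
| add: "polylog_fun f \<Longrightarrow> polylog_fun g \<Longrightarrow> polylog_fun (\<lambda>t. f t + g t)"
| scale: "k \<in> K \<Longrightarrow> polylog_fun f \<Longrightarrow> polylog_fun (\<lambda>t. k * f t)"
| eq_on: "polylog_fun f \<Longrightarrow> (\<And>t. 0 \<le> t \<Longrightarrow> t < 1 \<Longrightarrow> g t = f t) \<Longrightarrow> polylog_fun g"

lemma polylog_fun_limit:
  "polylog_fun f \<Longrightarrow> \<exists>L\<in>mzv_span. (f \<longlongrightarrow> L) (at_left 1)"
proof (induction rule: polylog_fun.induct)
  case (word s ss e es)
  then show ?case using Abel_limit[OF summable_liq] suminf_liq_in_span by blast
next
  case (eq_on f g)
  then obtain L where L: "L \<in> mzv_span" "(f \<longlongrightarrow> L) (at_left 1)" by auto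
  have "\<forall>\<^sub>F t in at_left 1. f t = g t"
    unfolding eventually_at_left_field using eq_on(2) by (intro exI[of _ 0]) simp
  with L show ?case using tendsto_cong by blast
next
  case (add f g)
  then show ?case by (metis mzv_span_add tendsto_add)
next
  case (scale k f)
  then show ?case by (metis mzv_span_scale tendsto_mult_left)
qed

lemma polylog_fun_limit_in_span:
  assumes "polylog_fun f" "(f \<longlongrightarrow> L) (at_left 1)"
  shows "L \<in> mzv_span"
  using polylog_fun_limit[OF assms(1)] assms(2) tendsto_unique[of "at_left (1::real)"] by auto

lemma polylog_fun_continuous: "polylog_fun f \<Longrightarrow> continuous_on {0..<1} f"
proof (induction rule: polylog_fun.induct)
  case (word s ss e es)
  then show ?case by (intro powser_continuous_on summable_liq)
next
  case (eq_on f g)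
  then show ?case using continuous_on_cong[of "{0..<1}" "{0..<1}" g f] by simp
qed (auto intro: continuous_intros)

lemma polylog_fun_0: "polylog_fun f \<Longrightarrow> f 0 = 0"
proof (induction rule: polylog_fun.induct)
  case (word s ss e es)
  then show ?case using powser_zero[of "liq (s # ss) (e # es)"] by simp
qed auto

section \<open>Integration of polylogarithms against one-forms\<close>

definition has_polylog_primitive :: "(real \<Rightarrow> complex) \<Rightarrow> bool" where
  "has_polylog_primitive f \<longleftrightarrow>
     (\<exists>g. polylog_fun g \<and> (\<forall>t\<in>{0<..<1}. (g has_vector_derivative f t) (at t)))"

definition polylog_kernel :: "(real \<Rightarrow> complex) \<Rightarrow> bool" where
  "polylog_kernel w \<longleftrightarrow> (\<forall>f. polylog_fun f \<longrightarrow> has_polylog_primitive (\<lambda>t. f t * w t))"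

lemma primitive_add:
  assumes "has_polylog_primitive f" "has_polylog_primitive g"
  shows "has_polylog_primitive (\<lambda>t. f t + g t)"
proof -
  obtain F G where "polylog_fun F" "\<forall>t\<in>{0<..<1}. (F has_vector_derivative f t) (at t)"
    "polylog_fun G" "\<forall>t\<in>{0<..<1}. (G has_vector_derivative g t) (at t)"
    using assms by (auto simp: has_polylog_primitive_def)
  then show ?thesis unfolding has_polylog_primitive_def
    by (intro exI[of _ "\<lambda>t. F t + G t"]) (auto intro: polylog_fun.add has_vector_derivative_add)
qed

lemma primitive_scale:
  assumes "has_polylog_primitive f" "k \<in> K"
  shows "has_polylog_primitive (\<lambda>t. k * f t)"
proof -
  obtain F where "polylog_fun F" "\<forall>t\<in>{0<..<1}. (F has_vector_derivative f t) (at t)"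
    using assms by (auto simp: has_polylog_primitive_def)
  then show ?thesis unfolding has_polylog_primitive_def
    using assms(2) by (intro exI[of _ "\<lambda>t. k * F t"]) (auto intro: polylog_fun.scale has_vector_derivative_mult_right)
qed

lemma primitive_cong:
  "has_polylog_primitive f \<Longrightarrow> (\<And>t. 0 < t \<Longrightarrow> t < 1 \<Longrightarrow> g t = f t) \<Longrightarrow> has_polylog_primitive g"
  unfolding has_polylog_primitive_def by auto

text \<open>The way to place a concrete function in the class: it and the known primitive share a
  derivative and both vanish at 0.\<close>

lemma polylog_funI:
  assumes "has_polylog_primitive f" "continuous_on {0..<1} G" "G 0 = 0"
    and G: "\<And>t. 0 < t \<Longrightarrow> t < 1 \<Longrightarrow> (G has_vector_derivative f t) (at t)"
  shows "polylog_fun G"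
proof -
  obtain g where g: "polylog_fun g" "\<forall>t\<in>{0<..<1}. (g has_vector_derivative f t) (at t)"
    using assms(1) by (auto simp: has_polylog_primitive_def)
  show ?thesis
  proof (rule polylog_fun.eq_on[OF g(1)])
    fix t :: real assume t: "0 \<le> t" "t < 1"
    \<comment> \<open>Only interior differentiability is available, since kernels such as 1/t are
      singular at 0; continuity takes care of the end points.\<close>
    have "((\<lambda>x. f x - f x) has_integral ((G t - g t) - (G 0 - g 0))) {0..t}"
    proof (rule fundamental_theorem_of_calculus_interior[OF t(1)])
      show "continuous_on {0..t} (\<lambda>x. G x - g x)"
        by (intro continuous_intros continuous_on_subset[OF assms(2)] continuous_on_subset[OF polylog_fun_continuous[OF g(1)]])
           (use t in auto)
      show "((\<lambda>x. G x - g x) has_vector_derivative f x - f x) (at x)" if "x \<in> {0<..<t}" for x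
        using that t g(2) G by (intro has_vector_derivative_diff) auto
    qed
    then have "((\<lambda>x. 0) has_integral (G t - g t)) {0..t}"
      using polylog_fun_0[OF g(1)] assms(3) by simp
    then show "G t = g t" using has_integral_0_eq by fastforce
  qed
qed

lemma polylog_kernel_induct:
  assumes "\<And>s ss e es. li_word (s # ss) (e # es) \<Longrightarrow> (s, e) \<noteq> (1, 1) \<Longrightarrow>
    has_polylog_primitive (\<lambda>t. (\<Sum>n. liq (s # ss) (e # es) n * of_real t ^ n) * w t)"
  shows "polylog_kernel w"
proof -
  have "has_polylog_primitive (\<lambda>t. f t * w t)" if "polylog_fun f" for f
    using that
  proof (induction rule: polylog_fun.induct)
    case (add f g)
    from primitive_add[OF add(3,4)] show ?case by (simp add: distrib_right)
  next
    case (scale k f)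
    from primitive_scale[OF scale(3,1)] show ?case by (simp add: mult.assoc)
  next
    case (eq_on f g)
    then show ?case by (auto intro: primitive_cong)
  qed (rule assms)
  then show ?thesis by (simp add: polylog_kernel_def)
qed

text \<open>Integration against dt/t divides the coefficient of \<open>t ^ n\<close> by
  \<open>n\<close>, which raises the first exponent of the word by one.\<close>

lemma polylog_kernel_0: "polylog_kernel (\<lambda>t. 1 / of_real t)"
proof (rule polylog_kernel_induct)
  fix s ss e es assume w: "li_word (s # ss) (e # es)" "(s, e) \<noteq> (1, 1)"
  let ?q = "liq (s # ss) (e # es)" and ?b = "liq (Suc s # ss) (e # es)"
  have wb: "li_word (Suc s # ss) (e # es)" "(Suc s, e) \<noteq> (1, 1)" using w by auto
  note b = summable_liq[OF wb]
  have "(\<Sum>n. diffs ?b n * of_real t ^ n) = (\<Sum>n. ?q n * of_real t ^ n) * (1 / of_real t)"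
    if t: "t \<in> {0<..<1}" for t :: real
  proof -
    have "(\<lambda>n. diffs ?b n * of_real t ^ n) sums (\<Sum>n. diffs ?b n * of_real t ^ n)"
      by (rule diffs_sums[OF b]) (use t in auto)
    from sums_mult[OF this, of "of_real t"]
    have "(\<lambda>n. ?q (Suc n) * of_real t ^ Suc n) sums (of_real t * (\<Sum>n. diffs ?b n * of_real t ^ n))"
      by (simp add: diffs_def mult_ac del: of_nat_Suc sum.lessThan_Suc)
    then have "(\<lambda>n. ?q n * of_real t ^ n) sums (of_real t * (\<Sum>n. diffs ?b n * of_real t ^ n))"
      by (subst (asm) sums_Suc_iff) simp
    then show ?thesis using t by (simp add: sums_iff)
  qed
  then have "((\<lambda>t. \<Sum>n. ?b n * of_real t ^ n) has_vector_derivative (\<Sum>n. ?q n * of_real t ^ n) * (1 / of_real t)) (at t)"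
    if "t \<in> {0<..<1}" for t
    using powser_has_vector_derivative[OF b, of t] that by auto
  then show "has_polylog_primitive (\<lambda>t. (\<Sum>n. ?q n * of_real t ^ n) * (1 / of_real t))"
    unfolding has_polylog_primitive_def using polylog_fun.word[OF wb] by blast
qed

text \<open>Integration against this form prepends the letter \<open>(1, inverse a)\<close>. The
  inner index m must acquire a compensating factor \<open>a ^ m\<close>, so the former first root of
  unity is multiplied by \<open>a\<close>; this is \<open>e'\<close>. The condition
  \<open>a \<noteq> 1\<close> keeps the new word convergent.\<close>

lemma primitive_over_linear:
  assumes a: "a ^ 4 = 1" "a \<noteq> 1" and w: "li_word s e"
  shows "has_polylog_primitive (\<lambda>t. (\<Sum>n. liq s e n * of_real t ^ n) * (1 / (a - of_real t)))"
proof -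
  define e' where "e' = (case e of [] \<Rightarrow> [] | x # xs \<Rightarrow> (a * x) # xs)"
  have a0: "a \<noteq> 0" using a by auto
  have e': "liq s e' n = a ^ n * liq s e n" for n
    using w by (cases rule: li_word_cases) (auto simp: e'_def power_mult_distrib)
  have w': "li_word s e'"
    using w by (cases rule: li_word_cases) (auto simp: e'_def power_mult_distrib a)
  let ?b = "liq (1 # s) (inverse a # e')"
  have wb: "li_word (1 # s) (inverse a # e')" "(1, inverse a) \<noteq> (1::nat, 1)"
    using w' a by (auto simp: power_inverse)
  note b = summable_liq[OF wb]
  have na: "norm a = 1" by (rule norm_eq_1_if_root[OF a(1)])
  have "(\<Sum>n. diffs ?b n * of_real t ^ n) = (\<Sum>n. liq s e n * of_real t ^ n) * (1 / (a - of_real t))"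
    if t: "t \<in> {0<..<1}" for t :: real
    by (rule powser_deriv_over_linear[OF b na]) (use t in \<open>auto simp: e'\<close>)
  then have "((\<lambda>t. \<Sum>n. ?b n * of_real t ^ n) has_vector_derivative (\<Sum>n. liq s e n * of_real t ^ n) * (1 / (a - of_real t))) (at t)"
    if "t \<in> {0<..<1}" for t
    using powser_has_vector_derivative[OF b, of t] that by auto
  then show ?thesis
    unfolding has_polylog_primitive_def using polylog_fun.word[OF wb] by blast
qed

lemma polylog_kernel_linear: "a ^ 4 = 1 \<Longrightarrow> a \<noteq> 1 \<Longrightarrow> polylog_kernel (\<lambda>t. 1 / (a - of_real t))"
  by (rule polylog_kernel_induct) (rule primitive_over_linear)

text \<open>The case of the empty word: the constant 1 is outside the class, but its integral
  against the form is inside.\<close>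

lemma primitive_linear:
  assumes "a ^ 4 = 1" "a \<noteq> 1"
  shows "has_polylog_primitive (\<lambda>t. 1 / (a - of_real t))"
proof -
  have "(\<Sum>n. liq [] [] n * of_real t ^ n) = 1" for t :: real
  proof -
    have "(\<lambda>n. liq [] [] n * of_real t ^ n) = (\<lambda>n. if n = 0 then 1 else 0)" by auto
    then show ?thesis using sums_single[of 0 "\<lambda>_. 1 :: complex"] by (simp add: sums_iff)
  qed
  then show ?thesis using primitive_over_linear[OF assms li_word_Nil] by simp
qed

lemma polylog_kernel_add:
  assumes "polylog_kernel v" "polylog_kernel w"
  shows "polylog_kernel (\<lambda>t. v t + w t)"
  using assms primitive_add unfolding polylog_kernel_def distrib_left by blast

lemma polylog_kernel_scale:
  assumes "polylog_kernel w" "k \<in> K"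
  shows "polylog_kernel (\<lambda>t. k * w t)"
  using assms primitive_scale unfolding polylog_kernel_def mult.left_commute[of _ k] by blast

end

text \<open>The poles i and -i are fourth roots of unity different from 1. This is the source of
  level 4, and the coefficients are the reason for having i in the field.\<close>

lemma arctan_kernel_partial_fractions:
  "2 / (1 + (complex_of_real t)\<^sup>2) = \<i> * (1 / (\<i> - of_real t)) + (- \<i>) * (1 / (- \<i> - of_real t))"
  and log_kernel_partial_fractions:
  "2 * complex_of_real t / (1 + (of_real t)\<^sup>2) = (-1) * (1 / (\<i> - of_real t)) + (-1) * (1 / (- \<i> - of_real t))"
proof -
  have nz: "\<i> - complex_of_real t \<noteq> 0" "- \<i> - complex_of_real t \<noteq> 0"
    by (auto simp: complex_eq_iff)
  have p: "(\<i> - of_real t) * (- \<i> - of_real t) = 1 + (complex_of_real t)\<^sup>2"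
    by (simp add: algebra_simps power2_eq_square)
  show "2 / (1 + (complex_of_real t)\<^sup>2) = \<i> * (1 / (\<i> - of_real t)) + (- \<i>) * (1 / (- \<i> - of_real t))"
    unfolding p[symmetric] using nz by (simp add: field_simps)
  show "2 * complex_of_real t / (1 + (of_real t)\<^sup>2) = (-1) * (1 / (\<i> - of_real t)) + (-1) * (1 / (- \<i> - of_real t))"
    unfolding p[symmetric] using nz by (simp add: field_simps)
qed

context subfield_with_i
begin

lemma i_roots: "\<i> ^ 4 = 1" "\<i> \<noteq> 1" "(- \<i>) ^ 4 = 1" "- \<i> \<noteq> 1"
  by (auto simp: complex_eq_iff numeral_eq_Suc)

lemma polylog_kernel_arctan: "polylog_kernel (\<lambda>t. 2 / (1 + (of_real t)\<^sup>2))"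
  unfolding arctan_kernel_partial_fractions
  by (intro polylog_kernel_add polylog_kernel_scale polylog_kernel_linear i_roots) auto

lemma polylog_kernel_log: "polylog_kernel (\<lambda>t. 2 * of_real t / (1 + (of_real t)\<^sup>2))"
  unfolding log_kernel_partial_fractions
  by (intro polylog_kernel_add polylog_kernel_scale polylog_kernel_linear i_roots) auto

lemma primitive_arctan: "has_polylog_primitive (\<lambda>t. 2 / (1 + (of_real t)\<^sup>2))"
  unfolding arctan_kernel_partial_fractions
  by (intro primitive_add primitive_scale primitive_linear i_roots) auto

lemma primitive_log: "has_polylog_primitive (\<lambda>t. 2 * of_real t / (1 + (of_real t)\<^sup>2))"
  unfolding log_kernel_partial_fractions
  by (intro primitive_add primitive_scale primitive_linear i_roots) auto

end

section \<open>Central binomial coefficients and the half-angle substitution\<close>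

definition cbr :: "nat \<Rightarrow> real" where
  "cbr n = real ((2 * n) choose n) / 4 ^ n"

lemma central_binomial_ratio_eq: "central_binomial_ratio n = of_real (cbr n)"
  by (simp add: central_binomial_ratio_def cbr_def)

lemma cbr_0 [simp]: "cbr 0 = 1"
  by (simp add: cbr_def)

lemma cbr_Suc: "cbr (Suc n) = cbr n * (2 * real n + 1) / (2 * real n + 2)"
proof -
  have 1: "Suc n * ((2 * Suc n) choose Suc n) = 2 * Suc n * (Suc (2 * n) choose n)"
    using Suc_times_binomial_eq[of "Suc (2 * n)" n] by (simp add: mult.commute)
  have 2: "Suc n * (Suc (2 * n) choose Suc n) = Suc (2 * n) * ((2 * n) choose n)"
    using Suc_times_binomial_eq[of "2 * n" n] by (simp add: mult.commute)
  have 3: "Suc (2 * n) choose Suc n = Suc (2 * n) choose n"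
    using binomial_symmetric[of n "Suc (2 * n)"] by simp
  define A B where "A = real ((2 * Suc n) choose Suc n)" and "B = real ((2 * n) choose n)"
  have "Suc n * ((2 * Suc n) choose Suc n) = 2 * (Suc n * (Suc (2 * n) choose n))"
    using 1 by (simp only: mult.assoc)
  also have "\<dots> = 2 * (Suc (2 * n) * ((2 * n) choose n))"
    by (simp only: 2[unfolded 3])
  finally have "real (Suc n) * A = 2 * (real (Suc (2 * n)) * B)"
    unfolding A_def B_def by (metis of_nat_mult of_nat_numeral)
  then have A: "A = 2 * (2 * real n + 1) * B / (real n + 1)"
    by (simp add: field_simps)
  have C: "cbr (Suc n) = A / (4 * 4 ^ n)" "cbr n = B / 4 ^ n"
    by (simp_all add: cbr_def A_def B_def)
  show ?thesis unfolding C A by (simp add: divide_simps) (simp add: algebra_simps)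
qed

lemma cbr_pos: "cbr n > 0"
  by (simp add: cbr_def zero_less_binomial)

lemma cbr_nz [simp]: "cbr n \<noteq> 0"
  using cbr_pos[of n] by simp

text \<open>The left side is 1 at \<open>n = 0\<close> and decreases, because
  \<open>(2 * n + 1) * (2 * n + 3) < (2 * n + 2)\<^sup>2\<close>.\<close>

lemma cbr_sq_upper: "(2 * real n + 1) * (cbr n)\<^sup>2 \<le> 1"
proof (induction n)
  case (Suc n)
  have "(2 * real (Suc n) + 1) * (cbr (Suc n))\<^sup>2 =
      ((2 * real n + 1) * (cbr n)\<^sup>2) * ((2 * real n + 3) * (2 * real n + 1) / (2 * real n + 2)\<^sup>2)"
    by (simp add: cbr_Suc power2_eq_square field_simps)
  also have "\<dots> \<le> 1 * 1"
    by (intro mult_mono Suc) (auto simp: power2_eq_square divide_le_eq_1 add_pos_nonneg algebra_simps)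
  finally show ?case by simp
qed auto

text \<open>With the constant 4 the product increases from 1, though barely:
  \<open>(4 * n + 5) * (2 * n + 1)\<^sup>2\<close> exceeds
  \<open>(4 * n + 1) * (2 * n + 2)\<^sup>2\<close> by exactly 1.\<close>

lemma cbr_sq_lower: "1 \<le> (4 * real n + 1) * (cbr n)\<^sup>2"
proof (induction n)
  case (Suc n)
  have "(4 * real (Suc n) + 1) * (cbr (Suc n))\<^sup>2 =
      ((4 * real n + 1) * (cbr n)\<^sup>2) * ((4 * real n + 5) * (2 * real n + 1)\<^sup>2 / ((4 * real n + 1) * (2 * real n + 2)\<^sup>2))"
    by (simp add: cbr_Suc power2_eq_square divide_simps)
  moreover have "1 * 1 \<le> ((4 * real n + 1) * (cbr n)\<^sup>2) * ((4 * real n + 5) * (2 * real n + 1)\<^sup>2 / ((4 * real n + 1) * (2 * real n + 2)\<^sup>2))"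
    by (intro mult_mono Suc) (auto simp: power2_eq_square le_divide_eq_1 add_pos_nonneg algebra_simps)
  ultimately show ?case by simp
qed auto

lemma cbr_upper: "cbr n \<le> 1 / sqrt (2 * real n + 1)"
proof -
  have "(cbr n)\<^sup>2 \<le> 1 / (2 * real n + 1)"
    using cbr_sq_upper[of n] by (simp add: field_simps)
  then show ?thesis
    using real_le_rsqrt by (fastforce simp: real_sqrt_divide)
qed

lemma inverse_cbr_upper: "1 / cbr n \<le> sqrt (4 * real n + 1)"
proof -
  have "(1 / cbr n)\<^sup>2 \<le> 4 * real n + 1"
    using cbr_sq_lower[of n] cbr_pos[of n] by (simp add: power_divide divide_le_eq)
  then show ?thesis by (rule real_le_rsqrt)
qed

text \<open>In terms of \<open>t = tan(\<theta>/2)\<close>: \<open>sin2 t = sin \<theta>\<close>, \<open>cos2 t = cos \<theta>\<close> and \<open>dang t = d\<theta>/dt\<close>.\<close>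

definition sin2 :: "real \<Rightarrow> real" where "sin2 t = 2 * t / (1 + t\<^sup>2)"
definition cos2 :: "real \<Rightarrow> real" where "cos2 t = (1 - t\<^sup>2) / (1 + t\<^sup>2)"
definition dang :: "real \<Rightarrow> real" where "dang t = 2 / (1 + t\<^sup>2)"

lemma one_plus_sq_pos: "1 + (t::real)\<^sup>2 > 0"
  using zero_le_power2[of t] by linarith

lemma sin2_deriv: "(sin2 has_real_derivative cos2 t * dang t) (at t)"
  unfolding sin2_def cos2_def dang_def using one_plus_sq_pos[of t]
  by (auto intro!: derivative_eq_intros simp: divide_simps) (simp add: algebra_simps power2_eq_square)

lemma cos2_deriv: "(cos2 has_real_derivative - sin2 t * dang t) (at t)"
  unfolding sin2_def cos2_def dang_def using one_plus_sq_pos[of t]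
  by (auto intro!: derivative_eq_intros simp: divide_simps) (simp add: algebra_simps power2_eq_square)

lemma cos2_sq: "(cos2 t)\<^sup>2 = 1 - (sin2 t)\<^sup>2"
proof -
  have "(1 + t\<^sup>2)\<^sup>2 = (2 * t)\<^sup>2 + (1 - t\<^sup>2)\<^sup>2" by (simp add: power2_eq_square algebra_simps)
  then have "(sin2 t)\<^sup>2 + (cos2 t)\<^sup>2 = (1 + t\<^sup>2)\<^sup>2 / (1 + t\<^sup>2)\<^sup>2"
    by (simp only: cos2_def sin2_def power_divide add_divide_distrib[symmetric])
  then show ?thesis using one_plus_sq_pos[of t] by simp
qed

lemma sin2_0 [simp]: "sin2 0 = 0" and sin2_1 [simp]: "sin2 1 = 1"
  and cos2_0 [simp]: "cos2 0 = 1" and cos2_1 [simp]: "cos2 1 = 0"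
  by (simp_all add: sin2_def cos2_def)

lemma sin2_ge0: "t \<ge> 0 \<Longrightarrow> sin2 t \<ge> 0"
  using one_plus_sq_pos[of t] by (auto simp: sin2_def)

lemma sin2_pos: "t > 0 \<Longrightarrow> sin2 t > 0"
  using one_plus_sq_pos[of t] by (auto simp: sin2_def)

lemma sin2_le1: "sin2 t \<le> 1"
proof -
  have "0 \<le> (1 - t)\<^sup>2" by simp
  then show ?thesis using one_plus_sq_pos[of t] by (simp add: sin2_def divide_le_eq power2_eq_square algebra_simps)
qed

lemma sin2_lt1: "t < 1 \<Longrightarrow> sin2 t < 1"
proof -
  assume "t < 1"
  then have "0 < (1 - t)\<^sup>2" by simp
  then show ?thesis using one_plus_sq_pos[of t] by (simp add: sin2_def divide_less_eq power2_eq_square algebra_simps)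
qed

lemma abs_sin2_lt1: "0 \<le> t \<Longrightarrow> t < 1 \<Longrightarrow> \<bar>sin2 t\<bar> < 1"
  using sin2_ge0 sin2_lt1 by simp

lemma dang_over_sin2: "t > 0 \<Longrightarrow> dang t / sin2 t = 1 / t"
  using one_plus_sq_pos[of t] by (simp add: dang_def sin2_def divide_simps)

lemma continuous_sin2 [continuous_intros]: "continuous_on S sin2"
  using sin2_deriv by (meson DERIV_isCont continuous_at_imp_continuous_on)

lemma continuous_cos2 [continuous_intros]: "continuous_on S cos2"
  using cos2_deriv by (meson DERIV_isCont continuous_at_imp_continuous_on)

lemma continuous_dang [continuous_intros]: "continuous_on S dang"
  unfolding dang_def[abs_def] using one_plus_sq_pos
  by (intro continuous_intros) (auto simp: less_le)

lemma of_real_dang: "complex_of_real (dang t) = 2 / (1 + (of_real t)\<^sup>2)"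
  by (simp add: dang_def)

section \<open>Power series evaluated at the sine\<close>

definition ps :: "(nat \<Rightarrow> complex) \<Rightarrow> real \<Rightarrow> complex" where
  "ps b x = (\<Sum>m. b m * of_real x ^ m)"

text \<open>Only convergence in the open unit disc matters. Linear growth leaves room for
  \<open>1 / cbr n\<close>, which grows like a square root, and survives division by powers of the
  index.\<close>

definition lin_bounded :: "(nat \<Rightarrow> complex) \<Rightarrow> bool" where
  "lin_bounded b \<longleftrightarrow> (\<exists>C. \<forall>m. norm (b m) \<le> C * (real m + 1))"

lemma summable_lin_bounded:
  assumes "lin_bounded b" "norm z < 1"
  shows "summable (\<lambda>m. b m * z ^ m)"
proof -
  obtain C where C: "\<And>m. norm (b m) \<le> C * (real m + 1)" using assms by (auto simp: lin_bounded_def)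
  have "summable (\<lambda>m. diffs (\<lambda>_. 1) m * norm z ^ m)"
    by (rule termdiff_converges[where K = 1]) (use assms in \<open>auto intro: summable_geometric\<close>)
  then have s: "summable (\<lambda>m. C * ((real m + 1) * norm z ^ m))"
    by (intro summable_mult) (simp add: diffs_def add.commute)
  show ?thesis
  proof (rule summable_comparison_test'[OF s])
    fix m
    show "norm (b m * z ^ m) \<le> C * ((real m + 1) * norm z ^ m)"
      using mult_right_mono[OF C[of m], of "norm z ^ m"] by (simp add: norm_mult norm_power mult.assoc)
  qed
qed

lemma ps_sums:
  assumes "lin_bounded b" "\<bar>x\<bar> < 1"
  shows "(\<lambda>m. b m * of_real x ^ m) sums ps b x"
  unfolding ps_def by (rule summable_sums[OF summable_lin_bounded]) (use assms in auto)

lemma ps_diffs_sums: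
  assumes "lin_bounded b" "\<bar>x\<bar> < 1"
  shows "(\<lambda>m. diffs b m * of_real x ^ m) sums ps (diffs b) x"
  unfolding ps_def
proof (rule summable_sums, rule termdiff_converges[where K = 1])
  show "summable (\<lambda>n. b n * y ^ n)" if "norm y < 1" for y :: complex
    using summable_lin_bounded[OF assms(1) that] .
qed (use assms in auto)

lemma ps_sin2_deriv:
  assumes "lin_bounded b" "0 \<le> t" "t < 1"
  shows "((\<lambda>t. ps b (sin2 t)) has_vector_derivative ps (diffs b) (sin2 t) * of_real (cos2 t * dang t)) (at t)"
proof -
  have 1: "((\<lambda>z. \<Sum>m. b m * z ^ m) has_field_derivative ps (diffs b) (sin2 t)) (at (of_real (sin2 t)))"
    unfolding ps_def
    by (rule termdiffs_strong'[where K = 1])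
       (use abs_sin2_lt1[OF assms(2,3)] in \<open>auto intro: summable_lin_bounded[OF assms(1)]\<close>)
  have 2: "((\<lambda>t. complex_of_real (sin2 t)) has_vector_derivative of_real (cos2 t * dang t)) (at t)"
    using sin2_deriv[of t] by (intro has_vector_derivative_of_real) (simp add: has_real_derivative_iff_has_vector_derivative)
  show ?thesis
    using field_vector_diff_chain_at[OF 2 1] by (simp add: o_def ps_def mult.commute)
qed

lemma ps_sin2_continuous: "lin_bounded b \<Longrightarrow> continuous_on {0..<1} (\<lambda>t. ps b (sin2 t))"
  by (intro continuous_at_imp_continuous_on ballI has_vector_derivative_continuous[OF ps_sin2_deriv]) auto

lemma ps_0: "ps b 0 = b 0"
  using powser_zero[of b] by (simp add: ps_def)

lemma ps_shift:
  assumes "lin_bounded b" "\<bar>x\<bar> < 1"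
  shows "ps (\<lambda>m. if m = 0 then 0 else b (m - 1)) x = of_real x * ps b x"
  using sums_mult[OF ps_sums[OF assms], of "of_real x"]
    sums_Suc_iff[of "\<lambda>m. (if m = 0 then 0 else b (m - 1)) * of_real x ^ m" "of_real x * ps b x"]
  by (simp add: mult_ac ps_def sums_iff)

lemma lin_bounded_div:
  assumes "lin_bounded b"
  shows "lin_bounded (\<lambda>m. b m / of_nat m ^ s)"
proof -
  obtain C where C: "\<And>m. norm (b m) \<le> C * (real m + 1)" using assms by (auto simp: lin_bounded_def)
  have "norm (b m / of_nat m ^ s) \<le> C * (real m + 1)" for m
  proof -
    have "norm (b m / of_nat m ^ s) \<le> norm (b m)"
    proof (cases "m = 0")
      case False
      then have "norm (b m) / real m ^ s \<le> norm (b m) / 1" by (intro divide_left_mono) auto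
      then show ?thesis by (simp add: norm_divide norm_power)
    qed (cases s; simp)
    with C[of m] show ?thesis by linarith
  qed
  then show ?thesis by (auto simp: lin_bounded_def)
qed

text \<open>Dividing by the index is integration against du/u, and
  \<open>dang t / sin2 t = 1 / t\<close> turns du/u into \<open>cos2 t / t\<close> dt.\<close>

lemma ps_div_deriv:
  assumes "lin_bounded b" "b 0 = 0" "0 < t" "t < 1"
  shows "((\<lambda>t. ps (\<lambda>m. b m / of_nat m) (sin2 t)) has_vector_derivative
           ps b (sin2 t) * of_real (cos2 t / t)) (at t)"
proof -
  let ?b = "\<lambda>m. b m / of_nat m"
  have lb: "lin_bounded ?b" using lin_bounded_div[OF assms(1), of 1] by simp
  have x: "\<bar>sin2 t\<bar> < 1" using assms by (intro abs_sin2_lt1) auto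
  have "(\<lambda>m. of_real (sin2 t) * (diffs ?b m * of_real (sin2 t) ^ m)) sums (of_real (sin2 t) * ps (diffs ?b) (sin2 t))"
    by (intro sums_mult ps_diffs_sums lb x)
  then have "(\<lambda>m. b (Suc m) * of_real (sin2 t) ^ Suc m) sums (of_real (sin2 t) * ps (diffs ?b) (sin2 t))"
    by (simp add: diffs_def mult_ac del: of_nat_Suc)
  then have "(\<lambda>m. b m * of_real (sin2 t) ^ m) sums (of_real (sin2 t) * ps (diffs ?b) (sin2 t))"
    by (subst (asm) sums_Suc_iff) (simp add: assms)
  then have "ps b (sin2 t) = of_real (sin2 t) * ps (diffs ?b) (sin2 t)"
    by (simp add: ps_def sums_iff)
  moreover have "sin2 t \<noteq> 0" using sin2_pos[of t] assms by simp
  ultimately have "ps (diffs ?b) (sin2 t) * of_real (cos2 t * dang t) = ps b (sin2 t) * of_real (cos2 t * (dang t / sin2 t))"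
    by simp
  then show ?thesis using ps_sin2_deriv[OF lb, of t] assms by (simp add: dang_over_sin2)
qed

text \<open>The substitution \<open>u = sin \<theta>\<close>, \<open>t = tan(\<theta>/2)\<close> rationalises both \<open>\<Sum> c\<^sub>n u\<^sup>2\<^sup>n = 1/cos \<theta>\<close> and
  \<open>\<Sum> u\<^sup>2\<^sup>n\<^sup>+\<^sup>1/((2n+1)c\<^sub>n) = \<theta>/cos \<theta>\<close>: their coefficients obey one recurrence.\<close>

lemma cos2_ps_deriv:
  assumes lb: "lin_bounded f" and rec: "\<And>m. of_nat (m + 2) * f (m + 2) = of_nat (m + 1) * f m"
    and t: "0 \<le> t" "t < 1"
  shows "((\<lambda>t. of_real (cos2 t) * ps f (sin2 t)) has_vector_derivative f 1 * of_real (dang t)) (at t)"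
proof -
  define x where "x = complex_of_real (sin2 t)"
  define F D where "F = ps f (sin2 t)" and "D = ps (diffs f) (sin2 t)"
  have x1: "\<bar>sin2 t\<bar> < 1" using t by (intro abs_sin2_lt1)
  have D: "(\<lambda>m. diffs f m * x ^ m) sums D" unfolding D_def x_def by (rule ps_diffs_sums[OF lb x1])
  have F: "(\<lambda>m. f m * x ^ m) sums F" unfolding F_def x_def by (rule ps_sums[OF lb x1])
  have "(\<lambda>m. diffs f (Suc m) * x ^ Suc m) sums (D - f 1)"
    using sums_Suc_iff[of "\<lambda>m. diffs f m * x ^ m" "D - f 1"] D by (simp add: diffs_def)
  moreover have "(\<lambda>m. of_nat m * f m * x ^ Suc m) sums (x\<^sup>2 * D)"
    using sums_Suc_iff[of "\<lambda>m. of_nat m * f m * x ^ Suc m" "x\<^sup>2 * D"] sums_mult[OF D, of "x\<^sup>2"]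
    by (simp add: diffs_def power2_eq_square mult_ac)
  moreover have "(\<lambda>m. f m * x ^ Suc m) sums (x * F)"
    using sums_mult[OF F, of x] by (simp add: mult_ac)
  ultimately have "(\<lambda>m. diffs f (Suc m) * x ^ Suc m - of_nat m * f m * x ^ Suc m - f m * x ^ Suc m) sums
      (D - f 1 - x\<^sup>2 * D - x * F)"
    by (intro sums_diff)
  moreover have "diffs f (Suc m) * x ^ Suc m - of_nat m * f m * x ^ Suc m - f m * x ^ Suc m = 0" for m
  proof -
    have "diffs f (Suc m) - of_nat m * f m - f m = 0"
      using rec[of m] by (simp add: diffs_def algebra_simps)
    then have "(diffs f (Suc m) - of_nat m * f m - f m) * x ^ Suc m = 0" by simp
    then show ?thesis by (simp add: left_diff_distrib)
  qed
  \<comment> \<open>The recurrence in differential form. For x = sin theta it says that cos theta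
    times the series has theta-derivative \<open>f 1\<close>: this is 0 for the secant and 1 for
    theta over cosine.\<close>
  ultimately have ode: "(1 - x\<^sup>2) * D - x * F = f 1" by (simp add: sums_iff algebra_simps)
  have c: "((\<lambda>t. complex_of_real (cos2 t)) has_vector_derivative of_real (- sin2 t * dang t)) (at t)"
    using cos2_deriv[of t] by (intro has_vector_derivative_of_real) (simp add: has_real_derivative_iff_has_vector_derivative)
  have "((\<lambda>t. of_real (cos2 t) * ps f (sin2 t)) has_vector_derivative
      of_real (cos2 t) * (D * of_real (cos2 t * dang t)) + of_real (- sin2 t * dang t) * F) (at t)"
    using has_vector_derivative_mult[OF c ps_sin2_deriv[OF lb t]] by (simp add: D_def F_def)
  moreover have "of_real (cos2 t) * (D * of_real (cos2 t * dang t)) + of_real (- sin2 t * dang t) * F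
      = (of_real ((cos2 t)\<^sup>2) * D - x * F) * of_real (dang t)"
    by (simp add: x_def algebra_simps power2_eq_square)
  moreover have "complex_of_real ((cos2 t)\<^sup>2) = 1 - x\<^sup>2" by (simp add: cos2_sq x_def)
  ultimately show ?thesis using ode by simp
qed

section \<open>Generating functions in the half-angle variable\<close>

definition odd_part :: "(nat \<Rightarrow> real) \<Rightarrow> nat \<Rightarrow> complex" where
  "odd_part a m = (if odd m then of_real (a (m div 2)) else 0)"

text \<open>Index 0 is dropped because the coefficients are going to be divided by the index and the
  class of functions contains no constants.\<close>

definition even_part :: "(nat \<Rightarrow> real) \<Rightarrow> nat \<Rightarrow> complex" where
  "even_part a m = (if even m \<and> m > 0 then of_real (a (m div 2)) else 0)"

abbreviation icbr :: "nat \<Rightarrow> real" where "icbr \<equiv> \<lambda>n. 1 / cbr n"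

lemma parts_0 [simp]: "odd_part a 0 = 0" "even_part a 0 = 0"
  by (simp_all add: odd_part_def even_part_def)

lemma norm_parts_cbr:
  assumes "m \<ge> 1"
  shows "norm (odd_part cbr m) \<le> 1 / sqrt m" "norm (even_part cbr m) \<le> 1 / sqrt m"
proof -
  have *: "cbr n \<le> 1 / sqrt m" if "real m \<le> 2 * real n + 1" for n
    using that assms by (intro order_trans[OF cbr_upper] divide_left_mono) auto
  show "norm (odd_part cbr m) \<le> 1 / sqrt m"
    using *[of "m div 2"] cbr_pos[of "m div 2"] by (auto simp: odd_part_def elim!: oddE)
  show "norm (even_part cbr m) \<le> 1 / sqrt m"
    using *[of "m div 2"] cbr_pos[of "m div 2"] by (auto simp: even_part_def elim!: evenE)
qed

lemma norm_parts_icbr: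
  assumes "m \<ge> 1"
  shows "norm (odd_part icbr m) \<le> 2 * sqrt m" "norm (even_part icbr m) \<le> 2 * sqrt m"
proof -
  have *: "1 / cbr n \<le> 2 * sqrt m" if "2 * real n \<le> real m" for n
  proof -
    have "sqrt (4 * real n + 1) \<le> sqrt (4 * real m)"
      using that assms by (intro real_sqrt_le_mono) auto
    with inverse_cbr_upper[of n] show ?thesis by (simp add: real_sqrt_mult)
  qed
  show "norm (odd_part icbr m) \<le> 2 * sqrt m"
    using *[of "m div 2"] cbr_pos[of "m div 2"] by (auto simp: odd_part_def norm_divide elim!: oddE)
  show "norm (even_part icbr m) \<le> 2 * sqrt m"
    using *[of "m div 2"] cbr_pos[of "m div 2"] by (auto simp: even_part_def norm_divide elim!: evenE)
qed

lemma lin_boundedI: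
  assumes "b 0 = 0" "\<And>m. m \<ge> 1 \<Longrightarrow> norm (b m) \<le> C * sqrt (real m)" "C \<ge> 0"
  shows "lin_bounded b"
proof -
  have "norm (b m) \<le> C * (real m + 1)" for m
  proof (cases "m = 0")
    case False
    have "sqrt m \<le> real m + 1"
      by (rule real_le_lsqrt) (auto simp: power2_eq_square algebra_simps)
    with assms have "C * sqrt m \<le> C * (real m + 1)" by (intro mult_left_mono)
    with assms(2)[of m] False show ?thesis by linarith
  qed (use assms in auto)
  then show ?thesis by (auto simp: lin_bounded_def)
qed

lemma lin_bounded_parts: "lin_bounded (odd_part cbr)" "lin_bounded (even_part cbr)"
  "lin_bounded (odd_part icbr)" "lin_bounded (even_part icbr)"
proof -
  have *: "1 / sqrt (real m) \<le> 1 * sqrt m" if "m \<ge> 1" for m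
    using that by (simp add: divide_le_eq)
  show "lin_bounded (odd_part cbr)"
    by (rule lin_boundedI[where C = 1]) (simp_all only: parts_0 order_trans[OF norm_parts_cbr(1) *] zero_le_one)
  show "lin_bounded (even_part cbr)"
    by (rule lin_boundedI[where C = 1]) (simp_all only: parts_0 order_trans[OF norm_parts_cbr(2) *] zero_le_one)
  show "lin_bounded (odd_part icbr)"
    by (rule lin_boundedI[where C = 2, OF _ norm_parts_icbr(1)]) auto
  show "lin_bounded (even_part icbr)"
    by (rule lin_boundedI[where C = 2, OF _ norm_parts_icbr(2)]) auto
qed

lemma summable_div_power:
  assumes b: "\<And>m. m \<ge> 1 \<Longrightarrow> norm (b m :: complex) \<le> C * sqrt m * real m ^ k" and s: "s \<ge> k + 2"
  shows "summable (\<lambda>m. norm (b m / of_nat m ^ s))"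
proof (rule summable_comparison_test'[where N = 1])
  show "summable (\<lambda>m. C * (sqrt (real m) / real m ^ 2))"
    by (intro summable_mult summable_sqrt_div)
  fix m :: nat assume m: "m \<ge> 1"
  have "norm (b m / of_nat m ^ s) = norm (b m) / real m ^ s"
    by (simp add: norm_divide norm_power)
  also have "\<dots> \<le> norm (b m) / real m ^ (k + 2)"
    using m s by (intro divide_left_mono power_increasing) auto
  also have "\<dots> \<le> (C * sqrt m * real m ^ k) / real m ^ (k + 2)"
    by (rule divide_right_mono[OF b[OF m]]) simp
  also have "\<dots> = C * (sqrt (real m) / real m ^ 2)" using m by (simp add: power_add power2_eq_square)
  finally show "norm (norm (b m / of_nat m ^ s)) \<le> C * (sqrt (real m) / real m ^ 2)" by simp
qed

lemma summable_parts_icbr: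
  assumes "s \<ge> 2"
  shows "summable (\<lambda>m. norm (odd_part icbr m / of_nat m ^ s))" "summable (\<lambda>m. norm (even_part icbr m / of_nat m ^ s))"
  by (rule summable_div_power[where C = 2 and k = 0]; use norm_parts_icbr assms in simp)+

lemma summable_parts_cbr:
  assumes "s \<ge> 1"
  shows "summable (\<lambda>m. norm (odd_part cbr m / of_nat m ^ s))" "summable (\<lambda>m. norm (even_part cbr m / of_nat m ^ s))"
proof -
  have *: "summable (\<lambda>m. norm (b m / of_nat m ^ s))" if b: "\<And>m. m \<ge> 1 \<Longrightarrow> norm (b m :: complex) \<le> 1 / sqrt m" for b
  proof -
    \<comment> \<open>Trading a factor \<open>m\<close> for one more exponent lets the same
      comparison cover coefficients that decay.\<close>
    have "summable (\<lambda>m. norm ((of_nat m * b m) / of_nat m ^ Suc s))"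
    proof (rule summable_div_power[where C = 1 and k = 0])
      fix m :: nat assume m: "m \<ge> 1"
      have "real m * norm (b m) \<le> real m * (1 / sqrt m)" using b[OF m] by (intro mult_left_mono) auto
      also have "\<dots> = sqrt m" using m by (simp add: real_div_sqrt)
      finally show "norm (of_nat m * b m) \<le> 1 * sqrt m * real m ^ 0" by (simp add: norm_mult)
    qed (use assms in auto)
    moreover have "norm (of_nat m * b m / of_nat m ^ Suc s) = norm (b m / of_nat m ^ s)" for m
      using assms by (cases "m = 0") auto
    ultimately show ?thesis by simp
  qed
  show "summable (\<lambda>m. norm (odd_part cbr m / of_nat m ^ s))" "summable (\<lambda>m. norm (even_part cbr m / of_nat m ^ s))"
    by (rule *; rule norm_parts_cbr; assumption)+
qed

text \<open>Taylor coefficients of \<open>(1 - u\<^sup>2) powr (-1/2)\<close>; unlike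
  \<open>even_part cbr\<close> they keep the constant term.\<close>

definition sec_coeff :: "nat \<Rightarrow> complex" where
  "sec_coeff m = (if even m then of_real (cbr (m div 2)) else 0)"

definition angle_sec_coeff :: "nat \<Rightarrow> complex" where
  "angle_sec_coeff m = odd_part icbr m / of_nat m"

lemma angle_sec_coeff_0: "angle_sec_coeff 0 = 0"
  by (simp add: angle_sec_coeff_def)

lemma cbr_le_1: "cbr n \<le> 1"
  by (rule order_trans[OF cbr_upper]) simp

lemma sec_coeff_1: "sec_coeff (Suc 0) = 0"
  by (simp add: sec_coeff_def)

lemma lin_bounded_sec: "lin_bounded sec_coeff"
  unfolding lin_bounded_def sec_coeff_def
  by (intro exI[of _ 1] allI) (use cbr_le_1 cbr_pos in \<open>auto simp: less_imp_le intro!: add_increasing\<close>)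

lemma lin_bounded_angle_sec: "lin_bounded angle_sec_coeff"
  using lin_bounded_div[OF lin_bounded_parts(3), of 1] by (simp add: angle_sec_coeff_def[abs_def])

lemma sec_rec: "of_nat (m + 2) * sec_coeff (m + 2) = of_nat (m + 1) * sec_coeff m"
proof (cases "even m")
  case True
  then obtain n where m: "m = 2 * n" by auto
  have "real (2 * n + 2) * cbr (Suc n) = real (2 * n + 1) * cbr n"
    by (simp add: cbr_Suc field_simps)
  from arg_cong[OF this, of complex_of_real] show ?thesis by (simp add: sec_coeff_def m)
qed (simp add: sec_coeff_def)

lemma angle_sec_rec: "of_nat (m + 2) * angle_sec_coeff (m + 2) = of_nat (m + 1) * angle_sec_coeff m"
proof (cases "odd m")
  case True
  then obtain n where m: "m = 2 * n + 1" by (elim oddE)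
  have "1 / cbr (Suc n) = real (2 * n + 2) * (1 / cbr n / real (2 * n + 1))"
    by (simp add: cbr_Suc field_simps)
  moreover have "(2 * n + 1 + 2) div 2 = Suc n" "(2 * n + 1) div 2 = n" by auto
  ultimately show ?thesis
    by (simp add: angle_sec_coeff_def odd_part_def m del: of_nat_Suc of_nat_add)
qed (simp add: angle_sec_coeff_def odd_part_def)

lemma cos2_sec:
  assumes "0 \<le> t" "t < 1"
  shows "of_real (cos2 t) * ps sec_coeff (sin2 t) = 1"
proof -
  let ?h = "\<lambda>t. of_real (cos2 t) * ps sec_coeff (sin2 t)"
  obtain c where c: "\<And>t. t \<in> {0..<1} \<Longrightarrow> ?h t = c"
  proof (rule has_vector_derivative_zero_constant)
    fix t :: real assume "t \<in> {0..<1}"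
    then show "(?h has_vector_derivative 0) (at t within {0..<1})"
      using cos2_ps_deriv[OF lin_bounded_sec sec_rec, of t]
      by (auto simp: sec_coeff_1 intro: has_vector_derivative_at_within)
  qed auto
  from c[of 0] have "c = 1" by (simp add: ps_0 sec_coeff_def)
  with c[of t] assms show ?thesis by simp
qed

context subfield_with_i
begin

text \<open>The product is the angle theta itself: its theta-derivative is
  \<open>angle_sec_coeff 1\<close>, which is 1.\<close>

lemma polylog_angle: "polylog_fun (\<lambda>t. of_real (cos2 t) * ps angle_sec_coeff (sin2 t))"
proof (rule polylog_funI[OF primitive_arctan])
  show "continuous_on {0..<1} (\<lambda>t. of_real (cos2 t) * ps angle_sec_coeff (sin2 t))"
    by (intro continuous_intros ps_sin2_continuous lin_bounded_angle_sec)
  show "of_real (cos2 0) * ps angle_sec_coeff (sin2 0) = 0"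
    by (simp add: ps_0 angle_sec_coeff_def)
  fix t :: real assume "0 < t" "t < 1"
  moreover have "angle_sec_coeff 1 = 1" by (simp add: angle_sec_coeff_def odd_part_def)
  ultimately show "((\<lambda>t. of_real (cos2 t) * ps angle_sec_coeff (sin2 t)) has_vector_derivative
      2 / (1 + (of_real t)\<^sup>2)) (at t)"
    using cos2_ps_deriv[OF lin_bounded_angle_sec angle_sec_rec, of t] by (simp add: dang_def)
qed

lemma polylog_ps_divI:
  assumes b: "lin_bounded b" "b 0 = 0"
    and p: "has_polylog_primitive f"
    and f: "\<And>t. 0 < t \<Longrightarrow> t < 1 \<Longrightarrow> f t = ps b (sin2 t) * of_real (cos2 t / t)"
  shows "polylog_fun (\<lambda>t. ps (\<lambda>m. b m / of_nat m) (sin2 t))"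
proof (rule polylog_funI[OF p])
  show "continuous_on {0..<1} (\<lambda>t. ps (\<lambda>m. b m / of_nat m) (sin2 t))"
    using lin_bounded_div[OF b(1), of 1] by (intro ps_sin2_continuous) simp
qed (use f ps_div_deriv[OF b] in \<open>auto simp: ps_0\<close>)

lemma polylog_ps_Suc:
  assumes b: "lin_bounded b" "b 0 = 0" and p: "polylog_fun (\<lambda>t. ps b (sin2 t))"
  shows "polylog_fun (\<lambda>t. ps (\<lambda>m. b m / of_nat m) (sin2 t))"
proof (rule polylog_ps_divI[OF b])
  have k: "polylog_kernel (\<lambda>t. 1 / of_real t + (- 1) * (2 * of_real t / (1 + (of_real t)\<^sup>2)))"
    by (intro polylog_kernel_add polylog_kernel_0 polylog_kernel_scale polylog_kernel_log K_minus K_simps)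
  show "has_polylog_primitive (\<lambda>t. ps b (sin2 t) * of_real (cos2 t / t))"
  proof (rule primitive_cong)
    show "has_polylog_primitive (\<lambda>t. ps b (sin2 t) * (1 / of_real t + (- 1) * (2 * of_real t / (1 + (of_real t)\<^sup>2))))"
      by (rule k[unfolded polylog_kernel_def, rule_format, OF p])
    fix t :: real assume "0 < t"
    then have "(D - 2 * t\<^sup>2) / D / t = 1 / t + (-1) * (2 * t / D)" if "D > 0" for D
      using that by (simp add: diff_divide_distrib power2_eq_square)
    from this[OF one_plus_sq_pos[of t]] have "cos2 t / t = 1 / t + (-1) * (2 * t / (1 + t\<^sup>2))"
      by (simp add: cos2_def)
    then have "complex_of_real (cos2 t / t) = of_real (1 / t + (-1) * (2 * t / (1 + t\<^sup>2)))" by (rule arg_cong)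
    then show "ps b (sin2 t) * of_real (cos2 t / t) =
        ps b (sin2 t) * (1 / of_real t + (- 1) * (2 * of_real t / (1 + (of_real t)\<^sup>2)))"
      by simp
  qed
qed auto

lemma polylog_ps_power:
  assumes b: "lin_bounded b" "b 0 = 0" and p: "polylog_fun (\<lambda>t. ps (\<lambda>m. b m / of_nat m ^ s) (sin2 t))" and r: "s \<le> r"
  shows "polylog_fun (\<lambda>t. ps (\<lambda>m. b m / of_nat m ^ r) (sin2 t))"
  using r
proof (induction r rule: dec_induct)
  case (step r)
  have "polylog_fun (\<lambda>t. ps (\<lambda>m. b m / of_nat m ^ r / of_nat m) (sin2 t))"
    by (rule polylog_ps_Suc) (use step b in \<open>auto intro: lin_bounded_div\<close>)
  then show ?case by (simp only: divide_divide_eq_left power_Suc2)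
qed (rule p)

lemma ps_odd_cbr: "\<bar>x\<bar> < 1 \<Longrightarrow> ps (odd_part cbr) x = of_real x * ps sec_coeff x"
proof -
  have "odd_part cbr = (\<lambda>m. if m = 0 then 0 else sec_coeff (m - 1))"
    by (intro ext) (auto simp: odd_part_def sec_coeff_def elim!: oddE)
  then show "\<bar>x\<bar> < 1 \<Longrightarrow> ?thesis" using ps_shift[OF lin_bounded_sec] by simp
qed

text \<open>By \<open>(2 * n + 2) * cbr (n + 1) = (2 * n + 1) * cbr n\<close>, the even series is
  the odd one shifted by one index, so no new generating function is needed.\<close>

lemma ps_even_icbr: "\<bar>x\<bar> < 1 \<Longrightarrow> ps (\<lambda>m. even_part icbr m / of_nat m) x = of_real x * ps angle_sec_coeff x"
proof -
  have "(\<lambda>m. even_part icbr m / of_nat m) = (\<lambda>m. if m = 0 then 0 else angle_sec_coeff (m - 1))"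
  proof
    fix m :: nat
    show "even_part icbr m / of_nat m = (if m = 0 then 0 else angle_sec_coeff (m - 1))"
    proof (cases "even m \<and> m > 0")
      case True
      then obtain n where m: "m = 2 * Suc n" by (metis evenE gr0_implies_Suc nat_0_less_mult_iff)
      have "cbr (Suc n) * real (2 * Suc n) = cbr n * real (2 * n + 1)"
        by (simp add: cbr_Suc field_simps)
      then have "1 / cbr (Suc n) / real (2 * Suc n) = 1 / cbr n / real (2 * n + 1)"
        by (simp only: divide_divide_eq_left)
      from arg_cong[OF this, of complex_of_real] show ?thesis
        by (simp add: m even_part_def angle_sec_coeff_def odd_part_def)
    qed (auto simp: even_part_def angle_sec_coeff_def odd_part_def)
  qed
  then show "\<bar>x\<bar> < 1 \<Longrightarrow> ?thesis" using ps_shift[OF lin_bounded_angle_sec] by simp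
qed

lemma ps_even_cbr: "\<bar>x\<bar> < 1 \<Longrightarrow> ps (even_part cbr) x = ps sec_coeff x - 1"
proof -
  assume x: "\<bar>x\<bar> < 1"
  have "(\<lambda>m. sec_coeff m * of_real x ^ m - (if m = 0 then 1 else 0)) sums (ps sec_coeff x - 1)"
    by (intro sums_diff ps_sums lin_bounded_sec x sums_single[of 0 "\<lambda>_. 1"])
  moreover have "sec_coeff m * of_real x ^ m - (if m = 0 then 1 else 0) = even_part cbr m * of_real x ^ m" for m
    by (auto simp: sec_coeff_def even_part_def)
  ultimately show ?thesis by (simp add: ps_def sums_iff)
qed

text \<open>At exponent 0 the series is tan theta, unbounded at t = 1, so the induction starts at
  exponent 1. There the cosine of \<open>cos2 t / t\<close> cancels the secant, and sin theta / t is
  the arctangent kernel.\<close>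

lemma polylog_odd_cbr: "s \<ge> 1 \<Longrightarrow> polylog_fun (\<lambda>t. ps (\<lambda>m. odd_part cbr m / of_nat m ^ s) (sin2 t))"
proof (rule polylog_ps_power[where s = 1])
  have "polylog_fun (\<lambda>t. ps (\<lambda>m. odd_part cbr m / of_nat m) (sin2 t))"
  proof (rule polylog_ps_divI[OF _ _ primitive_arctan])
    fix t :: real assume t: "0 < t" "t < 1"
    have x: "\<bar>sin2 t\<bar> < 1" using t by (intro abs_sin2_lt1) auto
    have "ps (odd_part cbr) (sin2 t) * of_real (cos2 t / t) =
        of_real (sin2 t / t) * (of_real (cos2 t) * ps sec_coeff (sin2 t))"
      unfolding ps_odd_cbr[OF x] by simp
    also have "\<dots> = 2 / (1 + (of_real t)\<^sup>2)" using t cos2_sec[of t] by (simp add: sin2_def)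
    finally show "2 / (1 + (of_real t)\<^sup>2) = ps (odd_part cbr) (sin2 t) * of_real (cos2 t / t)" by simp
  qed (auto simp: lin_bounded_parts)
  then show "polylog_fun (\<lambda>t. ps (\<lambda>m. odd_part cbr m / of_nat m ^ 1) (sin2 t))" by simp
qed (auto simp: lin_bounded_parts)

text \<open>Now (1/cos theta - 1) meets \<open>cos2 t / t\<close>, and
  \<open>(1 - cos2 t) / t\<close> is the logarithmic kernel.\<close>

lemma polylog_even_cbr: "s \<ge> 1 \<Longrightarrow> polylog_fun (\<lambda>t. ps (\<lambda>m. even_part cbr m / of_nat m ^ s) (sin2 t))"
proof (rule polylog_ps_power[where s = 1])
  have "polylog_fun (\<lambda>t. ps (\<lambda>m. even_part cbr m / of_nat m) (sin2 t))"
  proof (rule polylog_ps_divI[OF _ _ primitive_log])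
    fix t :: real assume t: "0 < t" "t < 1"
    have x: "\<bar>sin2 t\<bar> < 1" using t by (intro abs_sin2_lt1) auto
    have "ps (even_part cbr) (sin2 t) * of_real (cos2 t / t) =
        (of_real (cos2 t) * ps sec_coeff (sin2 t) - of_real (cos2 t)) / of_real t"
      unfolding ps_even_cbr[OF x] by (simp add: left_diff_distrib diff_divide_distrib)
    also have "\<dots> = of_real ((1 - cos2 t) / t)" using t cos2_sec[of t] by simp
    also have "(1 - cos2 t) / t = 2 * t / (1 + t\<^sup>2)"
      using t one_plus_sq_pos[of t] by (simp add: cos2_def divide_simps power2_eq_square)
    finally show "2 * of_real t / (1 + (of_real t)\<^sup>2) = ps (even_part cbr) (sin2 t) * of_real (cos2 t / t)" by simp
  qed (auto simp: lin_bounded_parts)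
  then show "polylog_fun (\<lambda>t. ps (\<lambda>m. even_part cbr m / of_nat m ^ 1) (sin2 t))" by simp
qed (auto simp: lin_bounded_parts)

text \<open>The exponent starts at 2 because exponent 1 gives theta / cos theta, which blows up at t
  = 1. One more integration cancels the cosine and leaves theta dt/t.\<close>

lemma polylog_odd_icbr: "s \<ge> 2 \<Longrightarrow> polylog_fun (\<lambda>t. ps (\<lambda>m. odd_part icbr m / of_nat m ^ s) (sin2 t))"
proof (rule polylog_ps_power[where s = 2])
  have "polylog_fun (\<lambda>t. ps (\<lambda>m. angle_sec_coeff m / of_nat m) (sin2 t))"
  proof (rule polylog_ps_divI)
    show "has_polylog_primitive (\<lambda>t. of_real (cos2 t) * ps angle_sec_coeff (sin2 t) * (1 / of_real t))"
      by (rule polylog_kernel_0[unfolded polylog_kernel_def, rule_format, OF polylog_angle])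
  qed (simp_all only: lin_bounded_angle_sec angle_sec_coeff_0 of_real_divide, simp)
  then show "polylog_fun (\<lambda>t. ps (\<lambda>m. odd_part icbr m / of_nat m ^ 2) (sin2 t))"
    by (simp add: angle_sec_coeff_def power2_eq_square)
qed (auto simp: lin_bounded_parts)

text \<open>The additional sine changes theta dt/t into theta times the arctangent form, as sin
  theta / t is \<open>2 / (1 + t\<^sup>2)\<close>.\<close>

lemma polylog_even_icbr: "s \<ge> 2 \<Longrightarrow> polylog_fun (\<lambda>t. ps (\<lambda>m. even_part icbr m / of_nat m ^ s) (sin2 t))"
proof (rule polylog_ps_power[where s = 2])
  have "polylog_fun (\<lambda>t. ps (\<lambda>m. even_part icbr m / of_nat m / of_nat m) (sin2 t))"
  proof (rule polylog_ps_divI)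
    show "has_polylog_primitive (\<lambda>t. of_real (cos2 t) * ps angle_sec_coeff (sin2 t) * (2 / (1 + (of_real t)\<^sup>2)))"
      by (rule polylog_kernel_arctan[unfolded polylog_kernel_def, rule_format, OF polylog_angle])
    fix t :: real assume t: "0 < t" "t < 1"
    have h: "complex_of_real (sin2 t / t) = 2 / (1 + (of_real t)\<^sup>2)"
      using t by (simp add: sin2_def)
    have x: "\<bar>sin2 t\<bar> < 1" using t by (intro abs_sin2_lt1) auto
    show "of_real (cos2 t) * ps angle_sec_coeff (sin2 t) * (2 / (1 + (of_real t)\<^sup>2)) =
        ps (\<lambda>m. even_part icbr m / of_nat m) (sin2 t) * of_real (cos2 t / t)"
      unfolding h[symmetric] ps_even_icbr[OF x] by simp
  next
    show "lin_bounded (\<lambda>m. even_part icbr m / of_nat m)"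
      using lin_bounded_div[OF lin_bounded_parts(4), of 1] by simp
  qed auto
  then show "polylog_fun (\<lambda>t. ps (\<lambda>m. even_part icbr m / of_nat m ^ 2) (sin2 t))"
    by (simp add: power2_eq_square)
qed (auto simp: lin_bounded_parts)

end

section \<open>Wallis integrals\<close>

text \<open>The integral of the m-th power of sin theta over [0, pi/2], written in the half-angle
  variable.\<close>

definition wallis :: "nat \<Rightarrow> real" where
  "wallis m = integral {0..1} (\<lambda>t. sin2 t ^ m * dang t)"

lemma wallis_integrable: "(\<lambda>t. sin2 t ^ m * dang t) integrable_on {0..1}"
  by (intro integrable_continuous_interval continuous_intros)

lemma has_integral_wallis: "((\<lambda>t. sin2 t ^ m * dang t) has_integral wallis m) {0..1}"
  unfolding wallis_def using wallis_integrable by (rule integrable_integral)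

text \<open>Integration by parts: \<open>cos2 t * sin2 t ^ (m + 1)\<close> vanishes at both end
  points.\<close>

lemma wallis_rec: "real (m + 2) * wallis (m + 2) = real (m + 1) * wallis m"
proof -
  let ?F = "\<lambda>t. cos2 t * sin2 t ^ (m + 1)"
  let ?f = "\<lambda>t. real (m + 1) * (sin2 t ^ m * dang t) - real (m + 2) * (sin2 t ^ (m + 2) * dang t)"
  have "(?F has_real_derivative ?f t) (at t within {0..1})" for t
  proof -
    define x y d where "x = sin2 t" and "y = cos2 t" and "d = dang t"
    have y: "y * y = 1 - x * x"
      using cos2_sq[of t] by (simp add: x_def y_def power2_eq_square)
    have "(?F has_real_derivative y * (real (m + 1) * (y * d * x ^ m)) + - x * d * x ^ (m + 1)) (at t)"
      using DERIV_mult'[OF cos2_deriv[of t] DERIV_power[OF sin2_deriv[of t], of "m + 1"]]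
      unfolding x_def y_def d_def by simp
    moreover have "y * (real (m + 1) * (y * d * x ^ m)) + - x * d * x ^ (m + 1) =
        real (m + 1) * (x ^ m * d) * (y * y) - x ^ (m + 2) * d"
      by (simp add: algebra_simps)
    moreover have "\<dots> = ?f t"
      unfolding y x_def[symmetric] d_def[symmetric] by (simp add: algebra_simps)
    ultimately have "(?F has_real_derivative ?f t) (at t)" by (simp only:)
    then show ?thesis by (rule has_field_derivative_at_within)
  qed
  then have "(?f has_integral (?F 1 - ?F 0)) {0..1}"
    by (intro fundamental_theorem_of_calculus)
       (auto simp: has_real_derivative_iff_has_vector_derivative[symmetric])
  moreover have "(?f has_integral (real (m + 1) * wallis m - real (m + 2) * wallis (m + 2))) {0..1}"
    by (intro has_integral_diff has_integral_mult_right has_integral_wallis)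
  ultimately have "?F 1 - ?F 0 = real (m + 1) * wallis m - real (m + 2) * wallis (m + 2)"
    by (rule has_integral_unique)
  then show ?thesis by simp
qed

lemma arctan_deriv_dang: "((\<lambda>t. 2 * arctan t) has_real_derivative dang t) (at t)"
  unfolding dang_def using one_plus_sq_pos[of t]
  by (auto intro!: derivative_eq_intros simp: divide_simps)

lemma wallis_0: "wallis 0 = pi / 2"
proof -
  have "(dang has_integral (2 * arctan 1 - 2 * arctan 0)) {0..1}"
    by (intro fundamental_theorem_of_calculus)
       (auto simp: has_real_derivative_iff_has_vector_derivative[symmetric]
             intro: has_field_derivative_at_within arctan_deriv_dang)
  then have "(dang has_integral (pi / 2)) {0..1}" by (simp add: arctan_one)
  then show ?thesis using has_integral_unique[OF has_integral_wallis[of 0]] by simp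
qed

lemma wallis_1: "wallis 1 = 1"
proof -
  have "((\<lambda>t. sin2 t * dang t) has_integral ((- cos2 1) - (- cos2 0))) {0..1}"
  proof (intro fundamental_theorem_of_calculus)
    fix t :: real
    show "((\<lambda>t. - cos2 t) has_vector_derivative sin2 t * dang t) (at t within {0..1})"
      using DERIV_minus[OF cos2_deriv[of t]]
      by (auto simp: has_real_derivative_iff_has_vector_derivative[symmetric] intro: has_field_derivative_at_within)
  qed auto
  then show ?thesis using has_integral_unique[OF has_integral_wallis[of 1]] by simp
qed

lemma wallis_even: "wallis (2 * n) = pi / 2 * cbr n"
proof (induction n)
  case (Suc n)
  have "real (2 * n + 2) * wallis (2 * n + 2) = real (2 * n + 1) * (pi / 2 * cbr n)"
    using wallis_rec[of "2 * n"] Suc by simp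
  also have "\<dots> = real (2 * n + 2) * (pi / 2 * cbr (Suc n))"
    by (simp add: cbr_Suc field_simps)
  finally show ?case by (simp add: mult_left_cancel)
qed (simp add: wallis_0)

lemma wallis_odd: "wallis (2 * n + 1) = 1 / (real (2 * n + 1) * cbr n)"
proof (induction n)
  case 0
  then show ?case using wallis_1 by simp
next
  case (Suc n)
  have c: "real (2 * n + 2) * cbr (Suc n) = real (2 * n + 1) * cbr n"
    by (simp add: cbr_Suc field_simps)
  have "real (2 * n + 3) * wallis (2 * n + 3) = real (2 * n + 2) * (1 / (real (2 * n + 1) * cbr n))"
    using wallis_rec[of "2 * n + 1"] unfolding Suc by (simp add: eval_nat_numeral)
  also have "\<dots> = 1 / cbr (Suc n)"
    unfolding c[symmetric] by simp
  finally have "wallis (2 * n + 3) = 1 / cbr (Suc n) / real (2 * n + 3)"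
    by (simp add: eq_divide_eq mult_ac)
  then show ?case by (simp add: eval_nat_numeral mult.commute)
qed

lemma wallis_Suc_le: "wallis (Suc m) \<le> wallis m"
proof (rule has_integral_le[OF has_integral_wallis has_integral_wallis])
  fix t :: real assume t: "t \<in> {0..1}"
  have "sin2 t ^ Suc m \<le> sin2 t ^ m"
    using t by (intro power_decreasing) (auto simp: sin2_le1 sin2_ge0)
  then show "sin2 t ^ Suc m * dang t \<le> sin2 t ^ m * dang t"
    using one_plus_sq_pos[of t] by (intro mult_right_mono) (auto simp: dang_def)
qed

text \<open>Wallis' product: the integral at an even index lies between those at its odd neighbours.
  The limit serves as boundary value of telescoping sums, inverted for exponent -2 and as it stands
  for exponent 2.\<close>

lemma n_cbr_sq_tendsto: "(\<lambda>n. real n * (cbr n)\<^sup>2) \<longlonglongrightarrow> 1 / pi"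
proof (rule tendsto_sandwich)
  have "2 * real n / (pi * (2 * real n + 1)) \<le> real n * (cbr n)\<^sup>2" for n
  proof -
    have "1 / (real (2 * n + 1) * cbr n) \<le> pi / 2 * cbr n"
      using wallis_Suc_le[of "2 * n"] wallis_odd[of n] by (simp add: wallis_even)
    then have "2 \<le> pi * (2 * real n + 1) * (cbr n)\<^sup>2"
      using cbr_pos[of n] by (simp add: divide_le_eq power2_eq_square mult_ac add.commute)
    then have "2 / (pi * (2 * real n + 1)) \<le> (cbr n)\<^sup>2"
      by (simp add: divide_le_eq mult_ac)
    from mult_left_mono[OF this, of "real n"] show ?thesis by (simp add: mult.commute)
  qed
  then show "\<forall>\<^sub>F n in sequentially. 2 * real n / (pi * (2 * real n + 1)) \<le> real n * (cbr n)\<^sup>2" by simp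
  have "real n * (cbr n)\<^sup>2 \<le> 1 / pi" if n: "n \<ge> 1" for n
  proof -
    obtain k where k: "n = Suc k" using n by (cases n) auto
    have c: "real (2 * k + 2) * cbr (Suc k) = real (2 * k + 1) * cbr k"
      by (simp add: cbr_Suc field_simps)
    have "pi / 2 * cbr (Suc k) \<le> 1 / (real (2 * k + 2) * cbr (Suc k))"
      using wallis_Suc_le[of "2 * k + 1"] wallis_odd[of k] wallis_even[of "Suc k"] unfolding c by simp
    then have "pi / 2 * cbr (Suc k) * (real (2 * k + 2) * cbr (Suc k)) \<le> 1"
      using cbr_pos[of "Suc k"] by (subst (asm) le_divide_eq) auto
    moreover have "pi / 2 * cbr (Suc k) * (real (2 * k + 2) * cbr (Suc k)) = real n * (cbr n)\<^sup>2 * pi"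
      by (simp add: k power2_eq_square field_simps)
    ultimately show ?thesis by (simp only: le_divide_eq pi_gt_zero if_True)
  qed
  then show "\<forall>\<^sub>F n in sequentially. real n * (cbr n)\<^sup>2 \<le> 1 / pi"
    by (intro eventually_sequentiallyI[of 1])
  have "(\<lambda>n. 1 / pi * (2 * real n / (2 * real n + 1))) \<longlonglongrightarrow> 1 / pi * 1"
    by (intro tendsto_mult tendsto_const) real_asymp
  then show "(\<lambda>n. 2 * real n / (pi * (2 * real n + 1))) \<longlonglongrightarrow> 1 / pi" by simp
qed auto

lemma summable_norm_imp_lin_bounded:
  assumes "summable (\<lambda>m. norm (b m))"
  shows "lin_bounded b"
proof -
  have "Bseq b"
    using summable_LIMSEQ_zero[OF summable_norm_cancel[OF assms]] convergentI convergent_imp_Bseq by blast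
  then obtain C where C: "C > 0" "\<And>m. norm (b m) \<le> C" by (auto simp: Bseq_def)
  have "norm (b m) \<le> C * (real m + 1)" for m
  proof -
    have "C * 1 \<le> C * (real m + 1)" using C(1) by (intro mult_left_mono) auto
    with C(2)[of m] show ?thesis by linarith
  qed
  then show ?thesis by (auto simp: lin_bounded_def)
qed

lemma filterlim_sin2: "filterlim sin2 (at_left 1) (at_left 1)"
  unfolding filterlim_at
proof
  show "(sin2 \<longlongrightarrow> 1) (at_left 1)"
    using Lim_at_imp_Lim_at_within[of sin2 "sin2 1" 1] DERIV_isCont[OF sin2_deriv[of 1]] by (simp add: isCont_def)
  show "\<forall>\<^sub>F t in at_left 1. sin2 t \<in> {..<1} \<and> sin2 t \<noteq> 1"
    by (rule eventually_at_leftI[of 0]) (auto dest: sin2_lt1 simp: less_imp_neq)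
qed

section \<open>Series whose sums lie in the span\<close>

context subfield_with_i
begin

definition span_sums :: "(nat \<Rightarrow> complex) \<Rightarrow> bool" where
  "span_sums f \<longleftrightarrow> (\<exists>L\<in>mzv_span. f sums L)"

lemma span_sums_add: "span_sums f \<Longrightarrow> span_sums g \<Longrightarrow> span_sums (\<lambda>n. f n + g n)"
  unfolding span_sums_def by (blast intro: sums_add)

lemma span_sums_scale: "k \<in> K \<Longrightarrow> span_sums f \<Longrightarrow> span_sums (\<lambda>n. k * f n)"
  unfolding span_sums_def by (blast intro: sums_mult)

lemma span_sums_reindex:
  assumes "span_sums f" "strict_mono g" "\<And>m. m \<notin> range g \<Longrightarrow> f m = 0"
  shows "span_sums (\<lambda>n. f (g n))"
proof -
  have "(\<lambda>n. f (g n)) sums L \<longleftrightarrow> f sums L" for L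
    by (rule sums_mono_reindex[OF assms(2)]) (rule assms(3))
  with assms(1) show ?thesis by (simp add: span_sums_def)
qed

lemma span_sums_odd:
  assumes "span_sums f" "\<And>m. even m \<Longrightarrow> f m = 0"
  shows "span_sums (\<lambda>n. f (2 * n + 1))"
proof (rule span_sums_reindex[OF assms(1)])
  show "f m = 0" if "m \<notin> range (\<lambda>n. 2 * n + 1)" for m
    using that by (intro assms(2)) (metis oddE rangeI)
qed (auto simp: strict_mono_def)

lemma span_sums_even:
  assumes "span_sums f" "\<And>m. odd m \<Longrightarrow> f m = 0"
  shows "span_sums (\<lambda>n. f (2 * n))"
proof (rule span_sums_reindex[OF assms(1)])
  show "f m = 0" if "m \<notin> range (\<lambda>n. 2 * n)" for m
    using that by (intro assms(2)) (metis evenE rangeI)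
qed (auto simp: strict_mono_def)

lemma span_sums_Suc:
  assumes "span_sums f" "f 0 \<in> mzv_span"
  shows "span_sums (\<lambda>n. f (Suc n))"
proof -
  obtain L where L: "L \<in> mzv_span" "f sums L" using assms(1) by (auto simp: span_sums_def)
  then have "(\<lambda>n. f (Suc n)) sums (L - f 0)" by (subst sums_Suc_iff) simp
  with L assms(2) show ?thesis unfolding span_sums_def by blast
qed

lemma series_in_span:
  assumes "summable b" "polylog_fun (\<lambda>t. ps b (sin2 t))"
  shows "span_sums b"
proof -
  have "((\<lambda>t. ps b (sin2 t)) \<longlongrightarrow> suminf b) (at_left 1)"
    using filterlim_compose[OF Abel_limit[OF assms(1)] filterlim_sin2] by (simp add: ps_def)
  with assms show ?thesis unfolding span_sums_def
    by (intro bexI[of _ "suminf b"] polylog_fun_limit_in_span[OF assms(2)]) auto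
qed

text \<open>Absolute convergence at u = 1 licenses termwise integration up to t = 1 by the M-test.
  The full integral is then the limit at 1 of an indefinite one, which belongs to the class.\<close>

lemma integrated_series_in_span:
  assumes b: "summable (\<lambda>m. norm (b m))"
    and p: "has_polylog_primitive (\<lambda>t. ps b (sin2 t) * of_real (dang t))"
  shows "span_sums (\<lambda>m. b m * of_real (wallis m))"
proof -
  define f where "f m t = b m * of_real (sin2 t ^ m * dang t)" for m t
  define g where "g t = ps b (sin2 t) * of_real (dang t)" for t
  have b': "summable (\<lambda>m. b m * of_real (sin2 t) ^ m)" if t: "t \<in> {0..1}" for t
  proof (rule summable_comparison_test'[OF b])
    fix m
    have "\<bar>sin2 t\<bar> ^ m \<le> 1" using t sin2_le1 sin2_ge0 by (intro power_le_one) auto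
    then show "norm (b m * of_real (sin2 t) ^ m) \<le> norm (b m)"
      by (simp add: norm_mult norm_power mult_left_le)
  qed
  have g: "suminf (\<lambda>m. f m t) = g t" if t: "t \<in> {0..1}" for t
    using suminf_mult2[OF b'[OF t], of "of_real (dang t)"] by (simp add: f_def g_def ps_def mult.assoc)
  have "uniform_limit {0..1} (\<lambda>n t. \<Sum>m<n. f m t) (\<lambda>t. suminf (\<lambda>m. f m t)) sequentially"
  proof (rule Weierstrass_m_test)
    fix m and t :: real assume t: "t \<in> {0..1}"
    have d: "dang t \<le> 2" "dang t \<ge> 0" using one_plus_sq_pos[of t] by (auto simp: dang_def divide_le_eq)
    have "\<bar>sin2 t ^ m\<bar> * dang t \<le> 1 * 2"
      using t d sin2_le1 sin2_ge0 by (intro mult_mono) (auto intro!: power_le_one)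
    with d show "norm (f m t) \<le> norm (b m) * 2"
      unfolding f_def norm_mult norm_of_real abs_mult by (intro mult_left_mono) auto
  qed (intro summable_mult2 b)
  moreover have "uniform_limit {0..1} (\<lambda>n t. \<Sum>m<n. f m t) (\<lambda>t. suminf (\<lambda>m. f m t)) sequentially \<longleftrightarrow>
      uniform_limit {0..1} (\<lambda>n t. \<Sum>m<n. f m t) g sequentially"
    by (rule uniform_limit_cong') (auto simp: g)
  ultimately have ul: "uniform_limit {0..1} (\<lambda>n t. \<Sum>m<n. f m t) g sequentially" by simp
  have cf: "continuous_on {0..1} (\<lambda>t. \<Sum>m<n. f m t)" for n
    unfolding f_def by (intro continuous_intros)
  have cg: "continuous_on {0..1} g"
    by (rule uniform_limit_theorem[OF _ ul]) (intro always_eventually allI cf, simp)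
  obtain I J where I: "\<And>n. ((\<lambda>t. \<Sum>m<n. f m t) has_integral I n) {0..1}"
    and J: "(g has_integral J) {0..1}" and IJ: "I \<longlonglongrightarrow> J"
    using uniform_limit_integral[OF ul cf] by auto
  have "((\<lambda>t. \<Sum>m<n. f m t) has_integral (\<Sum>m<n. b m * of_real (wallis m))) {0..1}" for n
    unfolding f_def by (intro has_integral_sum has_integral_mult_right has_integral_of_real has_integral_wallis) auto
  from has_integral_unique[OF I this] have "I = (\<lambda>n. \<Sum>m<n. b m * of_real (wallis m))"
    by (rule ext)
  with IJ have sums: "(\<lambda>m. b m * of_real (wallis m)) sums J" by (simp add: sums_def)
  define G where "G t = integral {0..t} g" for t
  have int: "g integrable_on {0..1}" by (rule integrable_continuous_interval[OF cg])
  have cG: "continuous_on {0..1} G"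
    unfolding G_def by (rule indefinite_integral_continuous_1[OF int])
  have "polylog_fun G"
  proof (rule polylog_funI[OF p])
    show "continuous_on {0..<1} G" by (rule continuous_on_subset[OF cG]) auto
    show "G 0 = 0" by (simp add: G_def)
    fix t :: real assume t: "0 < t" "t < 1"
    have "(G has_vector_derivative g t) (at t within {0..1})"
      unfolding G_def by (rule integral_has_vector_derivative[OF cg]) (use t in auto)
    then show "(G has_vector_derivative ps b (sin2 t) * of_real (dang t)) (at t)"
      using t by (simp add: g_def at_within_Icc_at)
  qed
  moreover have "(G \<longlongrightarrow> J) (at_left 1)"
  proof -
    have "(G \<longlongrightarrow> G 1) (at 1 within {0..1})" using cG by (auto simp: continuous_on_def)
    then have "(G \<longlongrightarrow> G 1) (at_left 1)" by (simp add: at_within_Icc_at_left)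
    moreover have "G 1 = J" using J by (simp add: G_def integral_unique)
    ultimately show ?thesis by simp
  qed
  ultimately show ?thesis unfolding span_sums_def using sums polylog_fun_limit_in_span by blast
qed

lemma wallis_series_in_span:
  assumes b: "summable (\<lambda>m. norm (b m))" and p: "polylog_fun (\<lambda>t. ps b (sin2 t))"
  shows "span_sums (\<lambda>m. b m * of_real (wallis m))"
proof (rule integrated_series_in_span[OF b])
  show "has_polylog_primitive (\<lambda>t. ps b (sin2 t) * of_real (dang t))"
    unfolding of_real_dang by (rule polylog_kernel_arctan[unfolded polylog_kernel_def, rule_format, OF p])
qed

text \<open>Serves to pair coefficients with Wallis integrals of the opposite parity, for instance
  odd ones with \<open>wallis (2 * n)\<close>. Lowering the power of the sine divides the integrand
  by sin theta, and \<open>dang t / sin2 t\<close> is the kernel 1/t.\<close>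

lemma wallis_series_shifted_in_span:
  assumes b: "summable (\<lambda>m. norm (b m))" "b 0 = 0" and p: "polylog_fun (\<lambda>t. ps b (sin2 t))"
  shows "span_sums (\<lambda>m. b (Suc m) * of_real (wallis m))"
proof (rule integrated_series_in_span)
  show s: "summable (\<lambda>m. norm (b (Suc m)))" using b(1) by (subst summable_Suc_iff)
  show "has_polylog_primitive (\<lambda>t. ps (\<lambda>m. b (Suc m)) (sin2 t) * of_real (dang t))"
  proof (rule primitive_cong)
    show "has_polylog_primitive (\<lambda>t. ps b (sin2 t) * (1 / of_real t))"
      by (rule polylog_kernel_0[unfolded polylog_kernel_def, rule_format, OF p])
    fix t :: real assume t: "0 < t" "t < 1"
    have "b = (\<lambda>m. if m = 0 then 0 else b (Suc (m - 1)))" using b(2) by auto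
    then have "ps b (sin2 t) = of_real (sin2 t) * ps (\<lambda>m. b (Suc m)) (sin2 t)"
      using ps_shift[OF summable_norm_imp_lin_bounded[OF s], of "sin2 t"] t abs_sin2_lt1[of t] by simp
    moreover have "complex_of_real (dang t) = of_real (sin2 t) * of_real (1 / t)"
      using dang_over_sin2[of t] sin2_pos[of t] t by (simp only: of_real_mult[symmetric]) (simp add: field_simps)
    ultimately show "ps (\<lambda>m. b (Suc m)) (sin2 t) * of_real (dang t) = ps b (sin2 t) * (1 / of_real t)"
      by (simp add: mult_ac)
  qed
qed

lemma pi_in_span: "of_real pi \<in> mzv_span"
proof -
  have "polylog_fun (\<lambda>t. of_real (2 * arctan t))"
  proof (rule polylog_funI[OF primitive_arctan])
    show "continuous_on {0..<1} (\<lambda>t. complex_of_real (2 * arctan t))" by (intro continuous_intros)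
    show "((\<lambda>t. complex_of_real (2 * arctan t)) has_vector_derivative 2 / (1 + (of_real t)\<^sup>2)) (at t)" for t
      unfolding of_real_dang[symmetric]
      by (intro has_vector_derivative_of_real) (simp add: arctan_deriv_dang has_real_derivative_iff_has_vector_derivative[symmetric])
  qed simp
  moreover have "((\<lambda>t. complex_of_real (2 * arctan t)) \<longlongrightarrow> of_real (2 * arctan 1)) (at_left 1)"
    by (intro tendsto_intros)
  ultimately have "complex_of_real (2 * arctan 1) \<in> mzv_span" by (rule polylog_fun_limit_in_span)
  then have "2 * complex_of_real (2 * arctan 1) \<in> mzv_span" by (intro mzv_span_scale) auto
  then show ?thesis by (simp add: arctan_one)
qed

section \<open>The basic sums\<close>

lemma span_sums_eq: "span_sums f \<Longrightarrow> (\<And>n. f n = g n) \<Longrightarrow> span_sums g"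
  using ext[of f g] by simp

lemma mzv_span_01 [simp]: "0 \<in> mzv_span" "1 \<in> mzv_span" "-1 \<in> mzv_span"
  using K_in_span[OF K_simps(1)] K_in_span[OF K_simps(2)] mzv_span_minus[OF K_in_span[OF K_simps(2)]]
  by auto

lemma sums_cbr:
  assumes "s \<ge> 1"
  shows "span_sums (\<lambda>n. of_real (cbr n) / of_nat (2 * n + 1) ^ s)"
    and "span_sums (\<lambda>n. of_real (cbr (Suc n)) / of_nat (2 * Suc n) ^ s)"
proof -
  have "span_sums (\<lambda>m. odd_part cbr m / of_nat m ^ s)"
    by (rule series_in_span[OF summable_norm_cancel[OF summable_parts_cbr(1)[OF assms]] polylog_odd_cbr[OF assms]])
  from span_sums_odd[OF this] show "span_sums (\<lambda>n. of_real (cbr n) / of_nat (2 * n + 1) ^ s)"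
    by (simp add: odd_part_def)
  have "span_sums (\<lambda>m. even_part cbr m / of_nat m ^ s)"
    by (rule series_in_span[OF summable_norm_cancel[OF summable_parts_cbr(2)[OF assms]] polylog_even_cbr[OF assms]])
  from span_sums_Suc[OF span_sums_even[OF this]]
  show "span_sums (\<lambda>n. of_real (cbr (Suc n)) / of_nat (2 * Suc n) ^ s)"
    by (auto simp: even_part_def simp del: mult_Suc_right elim!: span_sums_eq)
qed

lemma sums_icbr:
  assumes "s \<ge> 2"
  shows "span_sums (\<lambda>n. of_real (1 / cbr n) / of_nat (2 * n + 1) ^ s)"
    and "span_sums (\<lambda>n. of_real (1 / cbr (Suc n)) / of_nat (2 * Suc n) ^ s)"
proof -
  have "span_sums (\<lambda>m. odd_part icbr m / of_nat m ^ s)"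
    by (rule series_in_span[OF summable_norm_cancel[OF summable_parts_icbr(1)[OF assms]] polylog_odd_icbr[OF assms]])
  from span_sums_odd[OF this] show "span_sums (\<lambda>n. of_real (1 / cbr n) / of_nat (2 * n + 1) ^ s)"
    by (simp add: odd_part_def)
  have "span_sums (\<lambda>m. even_part icbr m / of_nat m ^ s)"
    by (rule series_in_span[OF summable_norm_cancel[OF summable_parts_icbr(2)[OF assms]] polylog_even_icbr[OF assms]])
  from span_sums_Suc[OF span_sums_even[OF this]]
  show "span_sums (\<lambda>n. of_real (1 / cbr (Suc n)) / of_nat (2 * Suc n) ^ s)"
    by (auto simp: even_part_def simp del: mult_Suc_right elim!: span_sums_eq)
qed

lemma sums_cbr_sq:
  assumes "s \<ge> 1"
  shows "span_sums (\<lambda>n. of_real (pi * (cbr n)\<^sup>2) / of_nat (2 * n + 1) ^ s)"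
    and "span_sums (\<lambda>n. of_real (pi * (cbr (Suc n))\<^sup>2) / of_nat (2 * Suc n) ^ s)"
proof -
  let ?b = "\<lambda>m. odd_part cbr m / of_nat m ^ s"
  have "span_sums (\<lambda>m. ?b (Suc m) * of_real (wallis m))"
    by (rule wallis_series_shifted_in_span[OF summable_parts_cbr(1)[OF assms] _ polylog_odd_cbr[OF assms]]) simp
  from span_sums_even[OF this]
  have "span_sums (\<lambda>n. ?b (Suc (2 * n)) * of_real (wallis (2 * n)))" by (simp add: odd_part_def)
  from span_sums_scale[OF K_numeral[of "num.Bit0 num.One"] this]
  show "span_sums (\<lambda>n. of_real (pi * (cbr n)\<^sup>2) / of_nat (2 * n + 1) ^ s)"
    by (rule span_sums_eq) (simp add: odd_part_def wallis_even power2_eq_square)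
  let ?b = "\<lambda>m. even_part cbr m / of_nat m ^ s"
  have "span_sums (\<lambda>m. ?b m * of_real (wallis m))"
    by (rule wallis_series_in_span[OF summable_parts_cbr(2)[OF assms] polylog_even_cbr[OF assms]])
  from span_sums_Suc[OF span_sums_even[OF this]]
  have "span_sums (\<lambda>n. ?b (2 * Suc n) * of_real (wallis (2 * Suc n)))" by (auto simp: even_part_def)
  from span_sums_scale[OF K_numeral[of "num.Bit0 num.One"] this]
  show "span_sums (\<lambda>n. of_real (pi * (cbr (Suc n))\<^sup>2) / of_nat (2 * Suc n) ^ s)"
    by (rule span_sums_eq) (simp add: even_part_def wallis_even power2_eq_square del: mult_Suc_right)
qed

text \<open>The odd Wallis integral is \<open>1 / ((2 * n + 1) * cbr n)\<close>: it supplies one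
  power of the index besides the second factor. So the series that is integrated has exponent
  \<open>s - 1\<close>, which must be at least 2.\<close>

lemma sums_icbr_sq:
  assumes "s \<ge> 3"
  shows "span_sums (\<lambda>n. of_real (1 / (cbr n)\<^sup>2) / of_nat (2 * n + 1) ^ s)"
    and "span_sums (\<lambda>n. of_real (1 / (cbr (Suc n))\<^sup>2) / of_nat (2 * Suc n) ^ s)"
proof -
  obtain r where s: "s = Suc r" and r: "r \<ge> 2" using assms by (cases s) auto
  let ?b = "\<lambda>m. odd_part icbr m / of_nat m ^ r"
  have "span_sums (\<lambda>m. ?b m * of_real (wallis m))"
    by (rule wallis_series_in_span[OF summable_parts_icbr(1)[OF r] polylog_odd_icbr[OF r]])
  from span_sums_odd[OF this]
  have *: "span_sums (\<lambda>n. ?b (2 * n + 1) * of_real (wallis (2 * n + 1)))" by (simp add: odd_part_def)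
  show "span_sums (\<lambda>n. of_real (1 / (cbr n)\<^sup>2) / of_nat (2 * n + 1) ^ s)"
    by (rule span_sums_eq[OF *], unfold wallis_odd) (simp add: odd_part_def s power2_eq_square)
  let ?b = "\<lambda>m. even_part icbr m / of_nat m ^ r"
  have "span_sums (\<lambda>m. ?b (Suc m) * of_real (wallis m))"
    by (rule wallis_series_shifted_in_span[OF summable_parts_icbr(2)[OF r] _ polylog_even_icbr[OF r]]) simp
  from span_sums_odd[OF this]
  have *: "span_sums (\<lambda>n. ?b (2 * Suc n) * of_real (wallis (2 * n + 1)))" by (simp add: even_part_def)
  have c: "real (2 * n + 1) * cbr n = real (2 * Suc n) * cbr (Suc n)" for n
    by (simp add: cbr_Suc field_simps)
  show "span_sums (\<lambda>n. of_real (1 / (cbr (Suc n))\<^sup>2) / of_nat (2 * Suc n) ^ s)"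
    by (rule span_sums_eq[OF *], unfold wallis_odd c) (simp add: even_part_def s power2_eq_square del: mult_Suc_right)
qed

lemma zeta_in_span: "s \<ge> 2 \<Longrightarrow> span_sums (\<lambda>m. 1 / of_nat m ^ s)"
  and alternating_zeta_in_span: "s \<ge> 1 \<Longrightarrow> span_sums (\<lambda>m. (-1) ^ m / of_nat m ^ s)"
proof -
  have l: "liq [s] [e] = (\<lambda>m. e ^ m / of_nat m ^ s)" if "s \<ge> 1" for e
  proof
    fix m
    have "(\<Sum>k<m. liq [] [] k) = (if m = 0 then 0 else 1)" by (induction m) auto
    then show "liq [s] [e] m = e ^ m / of_nat m ^ s" using that by (auto simp: zero_power)
  qed
  have w: "span_sums (liq [s] [e])" if "e ^ 4 = 1" "(s, e) \<noteq> (1, 1)" "s \<ge> 1" for e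
  proof -
    have "li_word [s] [e]" using that by simp
    with that show ?thesis unfolding span_sums_def
      by (intro bexI[OF _ suminf_liq_in_span[of s "[]" e "[]"]] summable_sums summable_liq)
  qed
  show "s \<ge> 2 \<Longrightarrow> span_sums (\<lambda>m. 1 / of_nat m ^ s)"
    using w[of 1] by (simp add: l)
  show "s \<ge> 1 \<Longrightarrow> span_sums (\<lambda>m. (-1) ^ m / of_nat m ^ s)"
    using w[of "-1"] by (simp add: l)
qed

lemma odd_zeta_in_span:
  assumes "s \<ge> 2"
  shows "span_sums (\<lambda>n. 1 / of_nat (2 * n + 1) ^ s)"
proof -
  have s1: "s \<ge> 1" using assms by simp
  have "span_sums (\<lambda>m. 1 / 2 * (1 / of_nat m ^ s + (-1) * ((-1) ^ m / of_nat m ^ s)))"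
    by (intro span_sums_scale span_sums_add zeta_in_span[OF assms] alternating_zeta_in_span[OF s1]) auto
  from span_sums_odd[OF this] show ?thesis by simp
qed

text \<open>Replaces the missing exponent 1 for weight 1: the sums over even and over odd indices
  diverge separately, but their difference converges.\<close>

lemma log2_in_span: "span_sums (\<lambda>n. 1 / of_nat (2 * Suc n) - 1 / of_nat (2 * Suc n + 1))"
proof -
  let ?f = "\<lambda>m. (-1) ^ m / of_nat m ^ 1 :: complex"
  obtain L where L: "L \<in> mzv_span" "?f sums L"
    using alternating_zeta_in_span[of 1] by (auto simp: span_sums_def)
  have "(\<lambda>n. sum ?f {n * 2..<n * 2 + 2}) sums L" by (rule sums_group[OF L(2)]) simp
  then have "span_sums (\<lambda>n. sum ?f {n * 2..<n * 2 + 2})" using L(1) by (auto simp: span_sums_def)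
  \<comment> \<open>The dropped block consists of the indices 0 and 1; the term at 0 is 0 because
    division by zero gives 0, and the term at 1 is -1.\<close>
  then have *: "span_sums (\<lambda>n. sum ?f {Suc n * 2..<Suc n * 2 + 2})"
    by (rule span_sums_Suc) (simp add: numeral_2_eq_2)
  have "{Suc n * 2..<Suc n * 2 + 2} = {2 * Suc n, 2 * Suc n + 1}" for n by auto
  then have "sum ?f {Suc n * 2..<Suc n * 2 + 2} = 1 / of_nat (2 * Suc n) - 1 / of_nat (2 * Suc n + 1)" for n
    by (simp del: mult_Suc_right of_nat_Suc)
  then show ?thesis by (rule span_sums_eq[OF *])
qed

end

section \<open>Partial fractions and telescoping\<close>

lemma linear_over_power: "(y::complex) \<noteq> 0 \<Longrightarrow> (y - a) * (1 / y ^ Suc s) = 1 / y ^ s + - a * (1 / y ^ Suc s)"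
  by (simp add: left_diff_distrib diff_divide_distrib)

lemma power_Suc_over_linear: "(y::complex) \<noteq> 0 \<Longrightarrow> 1 / y * (x * (y - a)) = x + - a * (1 / y * x)"
  by (simp add: field_simps)

text \<open>Meant for \<open>x = n + a\<close> and \<open>y = n + b\<close>, whose difference is the
  constant \<open>a - b\<close>; each application lowers one exponent of the mixed product.\<close>

lemma product_of_poles:
  assumes "(x::complex) \<noteq> 0" "y \<noteq> 0" "x \<noteq> y"
  shows "1 / x * (1 / y ^ Suc s) = 1 / (x - y) * (1 / y ^ Suc s) + - (1 / (x - y)) * (1 / x * (1 / y ^ s))"
proof -
  define c u v w where "c = 1 / y ^ s" and "u = 1 / x" and "v = 1 / y" and "w = 1 / (x - y)"
  have "u * v = w * v - w * u"
    using assms by (simp add: u_def v_def w_def divide_simps)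
  then have "u * (v * c) = w * (v * c) + - w * (u * c)" by algebra
  moreover have "1 / y ^ Suc s = v * c" by (simp add: c_def v_def)
  ultimately show ?thesis by (simp only: c_def u_def w_def)
qed

context subfield_with_i
begin

definition pole_ok :: "complex \<Rightarrow> bool" where
  "pole_ok a \<longleftrightarrow> a \<in> K \<and> (\<forall>n\<ge>1. of_nat n + a \<noteq> 0)"

inductive partial_fraction :: "complex set \<Rightarrow> (nat \<Rightarrow> complex) \<Rightarrow> bool" for D where
  power: "partial_fraction D (\<lambda>n. of_nat n ^ j)"
| pole: "a \<in> D \<Longrightarrow> partial_fraction D (\<lambda>n. 1 / (of_nat n + a) ^ Suc s)"
| add: "partial_fraction D f \<Longrightarrow> partial_fraction D g \<Longrightarrow> partial_fraction D (\<lambda>n. f n + g n)"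
| scale: "k \<in> K \<Longrightarrow> partial_fraction D f \<Longrightarrow> partial_fraction D (\<lambda>n. k * f n)"
| eq_on: "partial_fraction D f \<Longrightarrow> (\<And>n. n \<ge> 1 \<Longrightarrow> g n = f n) \<Longrightarrow> partial_fraction D g"

lemma partial_fraction_const: "k \<in> K \<Longrightarrow> partial_fraction D (\<lambda>n. k)"
  using partial_fraction.scale[of k D "\<lambda>n. of_nat n ^ 0"] partial_fraction.power[of D 0] by simp

lemma partial_fraction_linear: "k \<in> K \<Longrightarrow> partial_fraction D (\<lambda>n. of_nat n + k)"
  using partial_fraction.add[OF partial_fraction.power[of D 1] partial_fraction_const[of k]] by simp

lemma partial_fraction_pole: "a \<in> D \<Longrightarrow> s \<ge> 1 \<Longrightarrow> partial_fraction D (\<lambda>n. 1 / (of_nat n + a) ^ s)"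
  using partial_fraction.pole[of a D "s - 1"] by simp

lemma partial_fraction_times_n:
  assumes "partial_fraction D f" and D: "\<forall>a\<in>D. pole_ok a"
  shows "partial_fraction D (\<lambda>n. of_nat n * f n)"
  using assms(1)
proof induction
  case (power j)
  show ?case using partial_fraction.power[of D "Suc j"] by simp
next
  case (pole a s)
  have p: "partial_fraction D (\<lambda>n. 1 / (of_nat n + a) ^ s)"
    using partial_fraction_pole[OF pole, of s] partial_fraction_const[of 1 D] by (cases s) auto
  have "- a \<in> K" using pole D by (auto simp: pole_ok_def)
  from partial_fraction.add[OF p partial_fraction.scale[OF this partial_fraction.pole[OF pole, of s]]]
  show ?case
  proof (rule partial_fraction.eq_on)
    fix n :: nat assume "n \<ge> 1"
    then have nz: "of_nat n + a \<noteq> 0" using D pole by (auto simp: pole_ok_def)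
    show "of_nat n * (1 / (of_nat n + a) ^ Suc s) = 1 / (of_nat n + a) ^ s + - a * (1 / (of_nat n + a) ^ Suc s)"
      using linear_over_power[OF nz, of a s] by (simp only: add_diff_cancel_right')
  qed
next
  case (add f g)
  from partial_fraction.add[OF add.IH] show ?case by (simp add: distrib_left)
next
  case (scale k f)
  from partial_fraction.scale[OF scale.hyps(1) scale.IH] show ?case by (simp add: mult.left_commute)
next
  case (eq_on f g)
  from eq_on(3) show ?case by (rule partial_fraction.eq_on) (simp add: eq_on(2))
qed

lemma partial_fraction_times_pole:
  assumes "partial_fraction D f" and D: "\<forall>a\<in>D. pole_ok a" and a: "a \<in> D"
  shows "partial_fraction D (\<lambda>n. 1 / (of_nat n + a) * f n)"
  using assms(1)
proof induction
  case (power j)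
  have aK: "- a \<in> K" using a D by (auto simp: pole_ok_def)
  show ?case
  proof (induction j)
    case 0
    then show ?case using partial_fraction_pole[OF a, of 1] by simp
  next
    case (Suc j)
    from partial_fraction.add[OF partial_fraction.power[of D j] partial_fraction.scale[OF aK Suc]]
    show ?case
    proof (rule partial_fraction.eq_on)
      fix n :: nat assume "n \<ge> 1"
      then have nz: "of_nat n + a \<noteq> 0" using D a by (auto simp: pole_ok_def)
      show "1 / (of_nat n + a) * of_nat n ^ Suc j = of_nat n ^ j + - a * (1 / (of_nat n + a) * of_nat n ^ j)"
        using power_Suc_over_linear[OF nz, of "of_nat n ^ j" a] by (simp only: add_diff_cancel_right' power_Suc2)
    qed
  qed
next
  case (pole b s)
  show ?case
  proof (cases "a = b")
    case True
    then show ?thesis using partial_fraction.pole[OF a, of "Suc s"] by simp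
  next
    case False
    have c: "1 / (a - b) \<in> K" "- (1 / (a - b)) \<in> K" using a pole D by (auto simp: pole_ok_def intro!: K_minus K_divide K_diff)
    have step: "1 / (of_nat n + a) * (1 / (of_nat n + b) ^ Suc s) =
        1 / (a - b) * (1 / (of_nat n + b) ^ Suc s) + - (1 / (a - b)) * (1 / (of_nat n + a) * (1 / (of_nat n + b) ^ s))"
      if "n \<ge> 1" for n s
    proof -
      have "of_nat n + a \<noteq> 0" "of_nat n + b \<noteq> 0" "of_nat n + a \<noteq> of_nat n + b"
        using that D a pole False by (auto simp: pole_ok_def)
      from product_of_poles[OF this, of s] show ?thesis by (simp only: add_diff_cancel_left)
    qed
    show ?thesis
    proof (induction s)
      case 0
      have "partial_fraction D (\<lambda>n. 1 / (a - b) * (1 / (of_nat n + b) ^ Suc 0) + - (1 / (a - b)) * (1 / (of_nat n + a) ^ Suc 0))"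
        by (intro partial_fraction.add partial_fraction.scale partial_fraction.pole c a pole)
      then show ?case by (rule partial_fraction.eq_on) (subst step; simp)
    next
      case (Suc s)
      have "partial_fraction D (\<lambda>n. 1 / (a - b) * (1 / (of_nat n + b) ^ Suc (Suc s)) +
          - (1 / (a - b)) * (1 / (of_nat n + a) * (1 / (of_nat n + b) ^ Suc s)))"
        by (intro partial_fraction.add partial_fraction.scale partial_fraction.pole c pole Suc)
      then show ?case by (rule partial_fraction.eq_on) (rule step)
    qed
  qed
next
  case (add f g)
  from partial_fraction.add[OF add.IH] show ?case by (simp add: distrib_left)
next
  case (scale k f)
  from partial_fraction.scale[OF scale.hyps(1) scale.IH] show ?case by (simp add: mult.left_commute)
next
  case (eq_on f g)
  from eq_on(3) show ?case by (rule partial_fraction.eq_on) (simp add: eq_on(2))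
qed

lemma partial_fraction_mult:
  assumes "partial_fraction D f" "partial_fraction D g" and D: "\<forall>a\<in>D. pole_ok a"
  shows "partial_fraction D (\<lambda>n. f n * g n)"
  using assms(1)
proof induction
  case (power j)
  show ?case
  proof (induction j)
    case (Suc j)
    from partial_fraction_times_n[OF Suc D] show ?case by (simp add: mult.assoc)
  qed (simp add: assms)
next
  case (pole a s)
  show ?case
  proof (induction s)
    case 0
    from partial_fraction_times_pole[OF assms(2) D pole] show ?case by simp
  next
    case (Suc s)
    from partial_fraction_times_pole[OF Suc D pole] show ?case by simp
  qed
next
  case (add f h)
  from partial_fraction.add[OF add.IH] show ?case by (simp add: distrib_right)
next
  case (scale k f)
  from partial_fraction.scale[OF scale.hyps(1) scale.IH] show ?case by (simp add: mult.assoc)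
next
  case (eq_on f h)
  from eq_on(3) show ?case by (rule partial_fraction.eq_on) (simp add: eq_on(2))
qed

lemma partial_fraction_power:
  assumes "partial_fraction D f" "\<forall>a\<in>D. pole_ok a"
  shows "partial_fraction D (\<lambda>n. f n ^ j)"
proof (induction j)
  case (Suc j)
  from partial_fraction_mult[OF assms(1) Suc assms(2)] show ?case by simp
qed (simp add: partial_fraction_const)

lemma coeff_in_K: "set (coeffs p) \<subseteq> K \<Longrightarrow> coeff p i \<in> K"
  by (metis K_simps(1) coeff_in_coeffs coeff_eq_0 linorder_not_less coeff_0 subsetD)

lemma partial_fraction_poly:
  assumes "set (coeffs p) \<subseteq> K"
  shows "partial_fraction D (\<lambda>n. poly p (of_nat n))"
proof -
  note c = coeff_in_K[OF assms]
  have "partial_fraction D (\<lambda>n. \<Sum>i<m. coeff p i * of_nat n ^ i)" for m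
    by (induction m) (auto intro!: partial_fraction_const partial_fraction.add partial_fraction.scale partial_fraction.power c)
  from this[of "Suc (degree p)"] show ?thesis
    by (simp add: poly_altdef lessThan_Suc_atMost)
qed

end

section \<open>Telescoping against powers of the central binomial ratio\<close>

locale cbr_power = subfield_with_i +
  fixes k :: int
  assumes k_range: "k \<in> {-2, -1, 0, 1, 2}"
begin

lemma k_cases [case_names m2 m1 z p1 p2]:
  "(k = -2 \<Longrightarrow> P) \<Longrightarrow> (k = -1 \<Longrightarrow> P) \<Longrightarrow> (k = 0 \<Longrightarrow> P) \<Longrightarrow> (k = 1 \<Longrightarrow> P) \<Longrightarrow> (k = 2 \<Longrightarrow> P) \<Longrightarrow> P"
  using k_range by auto

definition wt :: "nat \<Rightarrow> real" where "wt n = cbr n powi k"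

definition phi :: real where "phi = (if k = 2 then pi else 1)"

text \<open>Among the partial fractions modulo telescoping terms, \<open>(n + 1/2)\<^sup>-\<^sup>j\<close> with \<open>j \<le> mdeg\<close> are those
  that decay too slowly to be summed against \<open>wt\<close>.\<close>

definition mdeg :: nat where "mdeg = (if k > 0 then 0 else if k \<ge> -1 then 1 else 2)"

definition good :: "(nat \<Rightarrow> complex) \<Rightarrow> bool" where
  "good g \<longleftrightarrow> span_sums (\<lambda>n. of_real phi * (g (Suc n) * of_real (wt (Suc n))))"

text \<open>Nothing is asked of the coefficients of \<open>p\<close>, since convergence will force
  \<open>p = 0\<close>. The power \<open>mdeg\<close> is a common denominator for all terms that
  cannot be summed.\<close>

definition reducible :: "(nat \<Rightarrow> complex) \<Rightarrow> bool" where
  "reducible f \<longleftrightarrow> (\<exists>p g. good g \<and> (\<forall>n\<ge>1. f n = poly p (of_nat n) / (of_nat n + 1 / 2) ^ mdeg + g n))"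

lemma phi_in_span: "of_real phi \<in> mzv_span"
  using pi_in_span by (auto simp: phi_def)

lemma good_add: "good f \<Longrightarrow> good g \<Longrightarrow> good (\<lambda>n. f n + g n)"
  unfolding good_def by (drule (1) span_sums_add) (simp add: algebra_simps)

lemma good_scale: "c \<in> K \<Longrightarrow> good f \<Longrightarrow> good (\<lambda>n. c * f n)"
  unfolding good_def by (drule (1) span_sums_scale) (simp add: mult_ac)

lemma good_0: "good (\<lambda>n. 0)"
  unfolding good_def span_sums_def by (intro bexI[of _ 0]) (auto simp: sums_0)

lemma reducible_add: "reducible f \<Longrightarrow> reducible g \<Longrightarrow> reducible (\<lambda>n. f n + g n)"
proof -
  assume "reducible f" "reducible g"
  then obtain p g1 q g2 where "good g1" "\<forall>n\<ge>1. f n = poly p (of_nat n) / (of_nat n + 1 / 2) ^ mdeg + g1 n"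
    "good g2" "\<forall>n\<ge>1. g n = poly q (of_nat n) / (of_nat n + 1 / 2) ^ mdeg + g2 n"
    unfolding reducible_def by blast
  then show ?thesis unfolding reducible_def
    by (intro exI[of _ "p + q"] exI[of _ "\<lambda>n. g1 n + g2 n"]) (simp add: good_add add_divide_distrib)
qed

lemma reducible_scale: "c \<in> K \<Longrightarrow> reducible f \<Longrightarrow> reducible (\<lambda>n. c * f n)"
proof -
  assume c: "c \<in> K" and "reducible f"
  then obtain p g where "good g" "\<forall>n\<ge>1. f n = poly p (of_nat n) / (of_nat n + 1 / 2) ^ mdeg + g n"
    unfolding reducible_def by blast
  then show ?thesis unfolding reducible_def
    by (intro exI[of _ "smult c p"] exI[of _ "\<lambda>n. c * g n"]) (simp add: c good_scale distrib_left)
qed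

lemma reducible_eq: "reducible f \<Longrightarrow> (\<And>n. n \<ge> 1 \<Longrightarrow> g n = f n) \<Longrightarrow> reducible g"
  unfolding reducible_def by simp

lemma good_imp_reducible: "good g \<Longrightarrow> reducible g"
  unfolding reducible_def by (intro exI[of _ 0] exI[of _ g]) simp

lemma half_shift_nz: "of_nat n + 1 / 2 \<noteq> (0 :: complex)"
proof -
  have "Re (of_nat n + 1 / 2) > 0" by simp
  then show ?thesis by (metis less_irrefl zero_complex.sel(1))
qed

lemma reducible_poly_div: "j \<le> mdeg \<Longrightarrow> reducible (\<lambda>n. poly p (of_nat n) / (of_nat n + 1 / 2) ^ j)"
  unfolding reducible_def
proof (intro exI[of _ "p * [:1/2, 1:] ^ (mdeg - j)"] exI[of _ "\<lambda>n. 0"] conjI good_0 allI impI)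
  fix n :: nat assume j: "j \<le> mdeg"
  let ?x = "of_nat n + 1 / 2 :: complex"
  have "?x ^ mdeg = ?x ^ (mdeg - j) * ?x ^ j" using j by (simp flip: power_add)
  then show "poly p (of_nat n) / ?x ^ j = poly (p * [:1/2, 1:] ^ (mdeg - j)) (of_nat n) / ?x ^ mdeg + 0"
    using half_shift_nz[of n] by (simp add: add.commute)
qed

lemma partial_fraction_imp_reducible:
  assumes "partial_fraction D f" "\<And>a s. a \<in> D \<Longrightarrow> s \<ge> 1 \<Longrightarrow> reducible (\<lambda>n. 1 / (of_nat n + a) ^ s)"
  shows "reducible f"
  using assms(1)
proof induction
  case (power j)
  from reducible_poly_div[of 0 "monom 1 j"] show ?case by (simp add: poly_monom)
next
  case (pole a s)
  then show ?case by (rule assms(2)) simp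
qed (blast intro: reducible_add reducible_scale reducible_eq)+

lemma wt_Suc: "wt (Suc n) = wt n * ((2 * real n + 1) / (2 * real n + 2)) powi k"
  by (simp add: wt_def cbr_Suc power_int_mult_distrib power_int_divide_distrib)

lemma wt_pos: "wt n > 0"
  by (simp add: wt_def cbr_pos)

lemma wt_0: "wt 0 = 1" by (simp add: wt_def)

text \<open>Times \<open>wt n\<close>, the term is the increment of \<open>q n * wt n\<close>. After
  multiplication by \<open>phi\<close>, both boundary values must lie in the span: the one at index
  1 is \<open>phi\<close> times an element of \<open>K\<close>, the one at infinity is a
  hypothesis.\<close>

lemma good_telescope:
  assumes "q 1 \<in> K" "(\<lambda>n. q n * of_real (wt n)) \<longlonglongrightarrow> l" "of_real phi * l \<in> mzv_span"
  shows "good (\<lambda>n. q (Suc n) * of_real ((2 * real n + 1) / (2 * real n + 2)) powi k - q n)"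
proof -
  define f where "f n = of_real phi * (q (Suc n) * of_real (wt (Suc n)))" for n
  have "f \<longlonglongrightarrow> of_real phi * l"
    unfolding f_def by (intro tendsto_intros LIMSEQ_Suc[OF assms(2)])
  from telescope_sums[OF this]
  have "(\<lambda>n. f (Suc n) - f n) sums (of_real phi * l - f 0)" .
  moreover have "f (Suc n) - f n = of_real phi * ((q (Suc (Suc n)) * of_real ((2 * real (Suc n) + 1) / (2 * real (Suc n) + 2)) powi k - q (Suc n)) * of_real (wt (Suc n)))" for n
    unfolding f_def wt_Suc[of "Suc n"] by (simp add: algebra_simps of_real_power_int del: of_nat_Suc)
  moreover have "f 0 \<in> mzv_span"
  proof -
    have "complex_of_real (wt 1) \<in> K"
    proof -
      have "wt 1 = (1 / 2) powi k" using wt_Suc[of 0] by (simp add: wt_0)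
      then show ?thesis by (simp add: of_real_power_int K_powi K_divide del: power_int_divide_distrib)
    qed
    then have "q 1 * of_real (wt 1) \<in> K" using assms(1) by auto
    from mzv_span_scale'[OF this phi_in_span] show ?thesis by (simp add: f_def)
  qed
  ultimately show ?thesis
    unfolding good_def span_sums_def using assms(3) by (intro bexI[of _ "of_real phi * l - f 0"]) auto
qed

lemma wt_le: "k \<noteq> -2 \<Longrightarrow> wt n \<le> sqrt (4 * real n + 1)"
proof -
  assume k: "k \<noteq> -2"
  have 1: "1 \<le> sqrt (4 * real n + 1)" by simp
  have c: "cbr n \<le> 1" "cbr n \<ge> 0" using cbr_le_1 cbr_pos less_imp_le by auto
  have "wt n \<le> 1 \<or> wt n \<le> sqrt (4 * real n + 1)"
    unfolding wt_def using k c inverse_cbr_upper[of n]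
    by (cases rule: k_cases) (auto simp: power_int_minus inverse_eq_divide power_le_one)
  with 1 show ?thesis by linarith
qed

lemma wt_over_n_tendsto: "(\<lambda>n. wt n / real n) \<longlonglongrightarrow> (if k = -2 then pi else 0)"
proof (cases "k = -2")
  case True
  have "(\<lambda>n. inverse (real n * (cbr n)\<^sup>2)) \<longlonglongrightarrow> inverse (1 / pi)"
    by (intro tendsto_inverse n_cbr_sq_tendsto) simp
  then show ?thesis unfolding wt_def using True by (simp add: power_int_minus divide_inverse mult.commute)
next
  case False
  have "(\<lambda>n. wt n / real n) \<longlonglongrightarrow> 0"
  proof (rule tendsto_sandwich[OF _ _ tendsto_const])
    show "(\<lambda>n. sqrt (4 * real n + 1) / real n) \<longlonglongrightarrow> 0" by real_asymp
    show "\<forall>\<^sub>F n in sequentially. wt n / real n \<le> sqrt (4 * real n + 1) / real n"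
      using wt_le[OF False] by (intro always_eventually allI divide_right_mono) auto
    show "\<forall>\<^sub>F n in sequentially. 0 \<le> wt n / real n"
      using wt_pos by (intro always_eventually allI divide_nonneg_nonneg) (auto simp: less_imp_le)
  qed
  with False show ?thesis by simp
qed

text \<open>For \<open>q\<close> of order 1/n a boundary value at infinity survives only if
  \<open>k = -2\<close>, where the weight grows linearly; it is then \<open>L * pi\<close>.\<close>

lemma good_telescope_decay:
  assumes "q 1 \<in> K" "(\<lambda>n. of_nat n * q n) \<longlonglongrightarrow> L" "L \<in> K"
  shows "good (\<lambda>n. q (Suc n) * of_real ((2 * real n + 1) / (2 * real n + 2)) powi k - q n)"
proof (rule good_telescope[where q = q, OF assms(1)])
  have "(\<lambda>n. (of_nat n * q n) * of_real (wt n / real n)) \<longlonglongrightarrow> L * of_real (if k = -2 then pi else 0)"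
    by (intro tendsto_mult assms tendsto_of_real wt_over_n_tendsto)
  moreover have "\<forall>\<^sub>F n in sequentially. (of_nat n * q n) * of_real (wt n / real n) = q n * of_real (wt n)"
    by (intro eventually_sequentiallyI[of 1]) simp
  ultimately show "(\<lambda>n. q n * of_real (wt n)) \<longlonglongrightarrow> L * of_real (if k = -2 then pi else 0)"
    by (rule Lim_transform_eventually)
  show "of_real phi * (L * of_real (if k = -2 then pi else 0)) \<in> mzv_span"
    using mzv_span_scale[OF assms(3) pi_in_span] by (auto simp: phi_def)
qed

end

lemma half_integer_nz: "of_nat n + (of_int j + 1 / 2 :: complex) \<noteq> 0"
proof
  assume "of_nat n + (of_int j + 1 / 2 :: complex) = 0"
  moreover have "of_int (2 * (int n + j) + 1) = 2 * (of_nat n + (of_int j + 1 / 2 :: complex))"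
    by (simp add: distrib_left)
  ultimately have "of_int (2 * (int n + j) + 1) = (0 :: complex)" by (simp only: mult_zero_right)
  then have "2 * (int n + j) + 1 = 0" by (simp only: of_int_eq_0_iff)
  then show False by presburger
qed

lemma tendsto_inverse_shift: "(\<lambda>n. 1 / (of_nat n + a :: complex)) \<longlonglongrightarrow> 0"
proof -
  have "filterlim (\<lambda>n. a + of_nat n :: complex) at_infinity sequentially"
    by (intro tendsto_add_filterlim_at_infinity[OF tendsto_const tendsto_of_nat])
  then show ?thesis
    by (intro tendsto_divide_0[OF tendsto_const]) (simp add: add.commute)
qed

lemma tendsto_n_over_shift:
  assumes "\<forall>n\<ge>1. of_nat n + a \<noteq> (0 :: complex)"
  shows "(\<lambda>n. of_nat n / (of_nat n + a)) \<longlonglongrightarrow> 1"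
proof -
  have "(\<lambda>n. 1 - a * (1 / (of_nat n + a))) \<longlonglongrightarrow> 1 - a * 0"
    by (intro tendsto_intros tendsto_inverse_shift)
  moreover have "\<forall>\<^sub>F n in sequentially. 1 - a * (1 / (of_nat n + a)) = of_nat n / (of_nat n + a)"
  proof (rule eventually_sequentiallyI[of 1])
    fix n :: nat assume "n \<ge> 1"
    with assms have "of_nat n + a \<noteq> 0" by blast
    from linear_over_power[OF this, of a 0]
    show "1 - a * (1 / (of_nat n + a)) = of_nat n / (of_nat n + a)" by simp
  qed
  ultimately show ?thesis by (simp add: tendsto_cong)
qed

lemma tendsto_n_over_shift_power:
  assumes "\<forall>n\<ge>1. of_nat n + a \<noteq> (0 :: complex)" "s \<ge> 1"
  shows "(\<lambda>n. of_nat n * (1 / (of_nat n + a) ^ s)) \<longlonglongrightarrow> (if s = 1 then 1 else 0)"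
proof -
  have "(\<lambda>n. of_nat n / (of_nat n + a) * (1 / (of_nat n + a)) ^ (s - 1)) \<longlonglongrightarrow> 1 * 0 ^ (s - 1)"
    by (intro tendsto_intros tendsto_inverse_shift tendsto_n_over_shift assms)
  moreover have "of_nat n / (of_nat n + a) * (1 / (of_nat n + a)) ^ (s - 1) = of_nat n * (1 / (of_nat n + a) ^ s)" for n
    using assms(2) by (cases s) (simp_all add: power_divide)
  moreover have "1 * 0 ^ (s - 1) = (if s = 1 then 1 else 0 :: complex)" using assms(2) by (cases s) auto
  ultimately show ?thesis by simp
qed

context subfield_with_i
begin

lemma pole_ok_half: "pole_ok (of_int j + 1 / 2)"
proof -
  have "of_int j \<in> K" for j by (cases j) (auto intro!: K_diff K_minus)
  then show ?thesis unfolding pole_ok_def using half_integer_nz by (auto intro!: K_add K_divide)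
qed

lemma pole_ok_nat: "pole_ok (of_nat m)"
  by (auto simp: pole_ok_def simp flip: of_nat_add)

end

context cbr_power
begin
definition all_reducible :: "complex \<Rightarrow> bool" where
  "all_reducible a \<longleftrightarrow> (\<forall>s\<ge>1. reducible (\<lambda>n. 1 / (of_nat n + a) ^ s))"

lemma partial_fraction_all_reducible:
  "partial_fraction D f \<Longrightarrow> \<forall>a\<in>D. all_reducible a \<Longrightarrow> reducible f"
  by (rule partial_fraction_imp_reducible) (auto simp: all_reducible_def)

lemma good_shift_down:
  assumes a: "pole_ok a" and s: "s \<ge> 1"
  shows "good (\<lambda>n. of_real ((2 * real n + 1) / (2 * real n + 2)) powi k / (of_nat n + (a + 1)) ^ s
                    - 1 / (of_nat n + a) ^ s)"
proof -
  have "good (\<lambda>n. 1 / (of_nat (Suc n) + a) ^ s * of_real ((2 * real n + 1) / (2 * real n + 2)) powi k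
      - 1 / (of_nat n + a) ^ s)"
  proof (rule good_telescope_decay)
    show "1 / (of_nat 1 + a) ^ s \<in> K" using a by (auto simp: pole_ok_def intro!: K_divide K_power K_add)
    show "(\<lambda>n. of_nat n * (1 / (of_nat n + a) ^ s)) \<longlonglongrightarrow> (if s = 1 then 1 else 0)"
      using a s by (intro tendsto_n_over_shift_power) (auto simp: pole_ok_def)
  qed auto
  then show ?thesis by (simp add: add_ac)
qed

text \<open>Exchanges the pole at \<open>-a\<close> for one at \<open>-a - 1\<close>. The price is
  the k-th power of the weight ratio, with poles at -1 if \<open>k > 0\<close> and at -1/2 if
  \<open>k < 0\<close>.\<close>

lemma reducible_down:
  assumes "pole_ok a" "s \<ge> 1"
    and red: "reducible (\<lambda>n. of_real ((2 * real n + 1) / (2 * real n + 2)) powi k / (of_nat n + (a + 1)) ^ s)"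
  shows "reducible (\<lambda>n. 1 / (of_nat n + a) ^ s)"
proof -
  have "reducible (\<lambda>n. - 1 * (of_real ((2 * real n + 1) / (2 * real n + 2)) powi k / (of_nat n + (a + 1)) ^ s
                    - 1 / (of_nat n + a) ^ s))"
    by (intro reducible_scale good_imp_reducible good_shift_down assms) auto
  from reducible_add[OF this red] show ?thesis by simp
qed

lemma rho_eq: "complex_of_real ((2 * real n + 1) / (2 * real n + 2)) = (of_nat n + 1 / 2) / (of_nat n + 1)"
proof -
  have "complex_of_real ((2 * real n + 1) / (2 * real n + 2)) = (2 * (of_nat n + 1 / 2)) / (2 * (of_nat n + 1))"
    by (simp add: distrib_left)
  also have "\<dots> = (of_nat n + 1 / 2) / (of_nat n + 1)" by (rule mult_divide_mult_cancel_left) simp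
  finally show ?thesis .
qed

text \<open>For positive \<open>n\<close> this is \<open>cbr (n - 1) / cbr n\<close>; its k-th
  power, put into the telescoping sequence, cancels the weight ratio after the shift. The constant
  is written to match the other half-integral shifts.\<close>

definition sigma :: "nat \<Rightarrow> complex" where "sigma n = of_nat n / (of_nat n + (of_int (-1) + 1 / 2))"

lemma sigma_Suc: "sigma (Suc n) = inverse (of_real ((2 * real n + 1) / (2 * real n + 2)))"
  unfolding rho_eq by (simp add: sigma_def add.commute)

lemma sigma_1: "sigma 1 = 2"
  by (simp add: sigma_def)

text \<open>The opposite exchange, of the pole at \<open>-a - 1\<close> for one at
  \<open>-a\<close>. The price is now a power of \<open>sigma\<close>, with a pole at 1/2 if
  \<open>k > 0\<close> and at 0 if \<open>k < 0\<close>.\<close>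

lemma all_reducible_up:
  assumes a: "pole_ok a"
    and red: "\<And>s. s \<ge> 1 \<Longrightarrow> reducible (\<lambda>n. sigma n powi k / (of_nat n + a) ^ s)"
  shows "all_reducible (a + 1)"
  unfolding all_reducible_def
proof (intro allI impI)
  fix s :: nat assume s: "s \<ge> 1"
  let ?q = "\<lambda>n. sigma n powi k / (of_nat n + a) ^ s"
  have "good (\<lambda>n. ?q (Suc n) * of_real ((2 * real n + 1) / (2 * real n + 2)) powi k - ?q n)"
  proof (rule good_telescope_decay)
    show "?q 1 \<in> K" unfolding sigma_1 using a by (auto simp: pole_ok_def intro!: K_divide K_power K_add K_powi)
    have "sigma \<longlonglongrightarrow> 1"
      unfolding sigma_def[abs_def] by (rule tendsto_n_over_shift) (intro allI impI half_integer_nz)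
    then have "(\<lambda>n. sigma n powi k) \<longlonglongrightarrow> 1 powi k"
      by (rule tendsto_power_int) simp
    moreover have "(\<lambda>n. of_nat n * (1 / (of_nat n + a) ^ s)) \<longlonglongrightarrow> (if s = 1 then 1 else 0)"
      using a s by (intro tendsto_n_over_shift_power) (auto simp: pole_ok_def)
    ultimately have "(\<lambda>n. sigma n powi k * (of_nat n * (1 / (of_nat n + a) ^ s))) \<longlonglongrightarrow>
        1 powi k * (if s = 1 then 1 else 0)"
      by (rule tendsto_mult)
    then show "(\<lambda>n. of_nat n * ?q n) \<longlonglongrightarrow> (if s = 1 then 1 else 0)"
      by (simp add: mult_ac)
  qed auto
  moreover have "?q (Suc n) * of_real ((2 * real n + 1) / (2 * real n + 2)) powi k = 1 / (of_nat n + (a + 1)) ^ s" for n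
  proof -
    have "of_real ((2 * real n + 1) / (2 * real n + 2)) \<noteq> (0 :: complex)"
      by (simp only: of_real_eq_0_iff) (simp add: add_pos_pos)
    moreover have "inverse x powi k * x powi k = 1" if "x \<noteq> 0" for x :: complex
      using that by (simp add: power_int_inverse)
    ultimately have "sigma (Suc n) powi k * of_real ((2 * real n + 1) / (2 * real n + 2)) powi k = 1"
      unfolding sigma_Suc by blast
    moreover have "?q (Suc n) * of_real ((2 * real n + 1) / (2 * real n + 2)) powi k =
        (sigma (Suc n) powi k * of_real ((2 * real n + 1) / (2 * real n + 2)) powi k) / (of_nat (Suc n) + a) ^ s"
      by simp
    ultimately show ?thesis by (simp add: add_ac)
  qed
  ultimately have "reducible (\<lambda>n. 1 / (of_nat n + (a + 1)) ^ s - ?q n)"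
    by (intro good_imp_reducible) simp
  from reducible_add[OF this red[OF s]] show "reducible (\<lambda>n. 1 / (of_nat n + (a + 1)) ^ s)" by simp
qed

lemma partial_fraction_sigma_power:
  assumes D: "\<forall>a\<in>D. pole_ok a" and "k > 0 \<Longrightarrow> of_int (-1) + 1 / 2 \<in> D" "k < 0 \<Longrightarrow> 0 \<in> D"
  shows "partial_fraction D (\<lambda>n. sigma n powi k)"
proof (cases "k \<ge> 0")
  case True
  have "partial_fraction D (\<lambda>n. sigma n ^ nat k)"
  proof (cases "k = 0")
    case False
    have "partial_fraction D sigma"
      using partial_fraction_times_n[OF partial_fraction_pole[of "of_int (-1) + 1 / 2" D 1] D] assms(2) True False
      by (simp add: sigma_def[abs_def])
    then show ?thesis by (rule partial_fraction_power[OF _ D])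
  qed (simp add: partial_fraction_const)
  with True show ?thesis by (simp add: power_int_def)
next
  case False
  have "of_int (-1) + 1 / 2 \<in> K" using pole_ok_half[of "-1"] by (simp add: pole_ok_def)
  then have "partial_fraction D (\<lambda>n. (of_nat n + (of_int (-1) + 1 / 2)) * (1 / (of_nat n + 0) ^ 1))"
    using False assms by (intro partial_fraction_mult partial_fraction_linear partial_fraction_pole) auto
  then have "partial_fraction D (\<lambda>n. ((of_nat n + (of_int (-1) + 1 / 2)) * (1 / (of_nat n + 0) ^ 1)) ^ nat (- k))"
    by (rule partial_fraction_power[OF _ D])
  then show ?thesis
    by (rule partial_fraction.eq_on) (use False in \<open>simp add: power_int_def sigma_def\<close>)
qed

lemma partial_fraction_rho_power:
  assumes D: "\<forall>a\<in>D. pole_ok a" and "1 \<in> D" "of_int 0 + 1 / 2 \<in> D"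
  shows "partial_fraction D (\<lambda>n. of_real ((2 * real n + 1) / (2 * real n + 2)) powi k)"
proof (cases "k \<ge> 0")
  case True
  have "partial_fraction D (\<lambda>n. (of_nat n + 1 / 2) * (1 / (of_nat n + 1) ^ 1))"
    using assms by (intro partial_fraction_mult partial_fraction_linear partial_fraction_pole) (auto intro!: K_divide)
  then have "partial_fraction D (\<lambda>n. ((of_nat n + 1 / 2) * (1 / (of_nat n + 1) ^ 1)) ^ nat k)"
    by (rule partial_fraction_power[OF _ D])
  moreover have "(of_nat n + 1 / 2) * (1 / (of_nat n + 1) ^ 1) = complex_of_real ((2 * real n + 1) / (2 * real n + 2))" for n
    unfolding rho_eq by simp
  ultimately show ?thesis using True by (simp add: power_int_def)
next
  case False
  have "partial_fraction D (\<lambda>n. (of_nat n + 1) * (1 / (of_nat n + (of_int 0 + 1 / 2)) ^ 1))"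
    using assms by (intro partial_fraction_mult partial_fraction_linear partial_fraction_pole) auto
  then have "partial_fraction D (\<lambda>n. ((of_nat n + 1) * (1 / (of_nat n + (of_int 0 + 1 / 2)) ^ 1)) ^ nat (- k))"
    by (rule partial_fraction_power[OF _ D])
  moreover have "(of_nat n + 1) * (1 / (of_nat n + (of_int 0 + 1 / 2)) ^ 1) = inverse (complex_of_real ((2 * real n + 1) / (2 * real n + 2)))" for n
    unfolding rho_eq by simp
  ultimately show ?thesis using False by (simp add: power_int_def)
qed

lemma base_odd: "s > mdeg \<Longrightarrow> span_sums (\<lambda>n. of_real (phi * wt n) / of_nat (2 * n + 1) ^ s)"
  using sums_cbr(1)[of s] sums_icbr(1)[of s] sums_cbr_sq(1)[of s] sums_icbr_sq(1)[of s] odd_zeta_in_span[of s]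
  unfolding wt_def phi_def mdeg_def
  by (cases rule: k_cases) (simp_all add: power_int_minus inverse_eq_divide power2_eq_square)

lemma base_even: "s > mdeg \<Longrightarrow> span_sums (\<lambda>n. of_real (phi * wt (Suc n)) / of_nat (2 * Suc n) ^ s)"
proof -
  have z: "span_sums (\<lambda>n. 1 / of_nat (2 * Suc n) ^ s)" if "s \<ge> 2"
  proof -
    have "span_sums (\<lambda>n. 1 / of_nat (Suc n) ^ s)" using that by (intro span_sums_Suc zeta_in_span) (simp_all add: zero_power)
    moreover have "1 / 2 ^ s \<in> K" by (intro K_divide K_power) auto
    ultimately have "span_sums (\<lambda>n. 1 / 2 ^ s * (1 / of_nat (Suc n) ^ s))" by (rule span_sums_scale[rotated])
    then show ?thesis by (rule span_sums_eq) (simp only: of_nat_mult of_nat_numeral power_mult_distrib times_divide_times_eq mult_1)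
  qed
  show "s > mdeg \<Longrightarrow> ?thesis"
    using sums_cbr(2)[of s] sums_icbr(2)[of s] sums_cbr_sq(2)[of s] sums_icbr_sq(2)[of s] z
    unfolding wt_def phi_def mdeg_def
    by (cases rule: k_cases) (simp_all add: power_int_minus inverse_eq_divide power2_eq_square)
qed

lemma all_reducible_half: "all_reducible (of_int 0 + 1 / 2)"
  unfolding all_reducible_def
proof (intro allI impI)
  fix s :: nat assume "s \<ge> 1"
  show "reducible (\<lambda>n. 1 / (of_nat n + (of_int 0 + 1 / 2)) ^ s)"
  proof (cases "s \<le> mdeg")
    case True
    from reducible_poly_div[OF this, of 1] show ?thesis by simp
  next
    case False
    then have "span_sums (\<lambda>n. of_real (phi * wt (Suc n)) / of_nat (2 * Suc n + 1) ^ s)"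
      by (intro span_sums_Suc base_odd) (simp_all add: wt_0 phi_in_span)
    then have "span_sums (\<lambda>n. 2 ^ s * (of_real (phi * wt (Suc n)) / of_nat (2 * Suc n + 1) ^ s))"
      by (intro span_sums_scale K_power K_numeral)
    then have "good (\<lambda>n. 1 / (of_nat n + (of_int 0 + 1 / 2)) ^ s)"
      unfolding good_def
    proof (rule span_sums_eq)
      fix n
      have "2 * (of_nat (Suc n) + (of_int 0 + 1 / 2)) = (of_nat (2 * Suc n + 1) :: complex)" by simp
      then have "(of_nat (2 * Suc n + 1) :: complex) ^ s = 2 ^ s * (of_nat (Suc n) + (of_int 0 + 1 / 2)) ^ s"
        by (metis power_mult_distrib)
      moreover have "2 ^ s * (of_real (phi * w) / (2 ^ s * y)) = of_real phi * (1 / y * complex_of_real w)" for w y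
        by simp
      ultimately show "2 ^ s * (of_real (phi * wt (Suc n)) / of_nat (2 * Suc n + 1) ^ s) =
          of_real phi * (1 / (of_nat (Suc n) + (of_int 0 + 1 / 2)) ^ s * complex_of_real (wt (Suc n)))"
        by (simp only:)
    qed
    then show ?thesis by (rule good_imp_reducible)
  qed
qed

section \<open>Reduction to the basic sums\<close>

lemma mdeg_eq_minus_k: "k < 0 \<Longrightarrow> mdeg = nat (- k)"
  unfolding mdeg_def by (cases rule: k_cases) auto

lemma reducible_low_order_pole_0:
  assumes s: "s \<ge> 1" "s \<le> mdeg"
  shows "reducible (\<lambda>n. 1 / (of_nat n + 0) ^ s)"
proof (cases "k < 0")
  case True
  have "reducible (\<lambda>n. of_real ((2 * real n + 1) / (2 * real n + 2)) powi k / (of_nat n + (0 + 1)) ^ s)"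
  proof (rule reducible_eq[OF reducible_poly_div[of mdeg "[:1, 1:] ^ (mdeg - s)"]])
    fix n :: nat
    define x y where "x = (of_nat n + 1 / 2 :: complex)" and "y = (of_nat n + 1 :: complex)"
    have y: "y \<noteq> 0" unfolding y_def by (metis of_nat_Suc of_nat_neq_0 add.commute)
    have "y ^ mdeg / y ^ s = y ^ (mdeg - s)" using s y by (simp add: power_diff)
    moreover have "of_real ((2 * real n + 1) / (2 * real n + 2)) powi k = y ^ mdeg / x ^ mdeg"
      unfolding rho_eq x_def[symmetric] y_def[symmetric] using True
      by (simp add: power_int_def mdeg_eq_minus_k power_divide)
    moreover have "y ^ mdeg / x ^ mdeg / y ^ s = y ^ mdeg / y ^ s / x ^ mdeg" by simp
    moreover have "poly ([:1, 1:] ^ (mdeg - s)) (of_nat n) = y ^ (mdeg - s)"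
      by (simp add: y_def add.commute)
    ultimately show "complex_of_real ((2 * real n + 1) / (2 * real n + 2)) powi k / (of_nat n + (0 + 1)) ^ s =
        poly ([:1, 1:] ^ (mdeg - s)) (of_nat n) / (of_nat n + 1 / 2) ^ mdeg"
      by (simp only: x_def[symmetric] y_def[symmetric] add_0_left)
  qed simp
  moreover have "pole_ok 0" using pole_ok_nat[of 0] by simp
  ultimately show ?thesis using s by (intro reducible_down) auto
next
  case False
  with s have k: "k = 0" "s = 1" by (auto simp: mdeg_def split: if_splits)
  have "span_sums (\<lambda>n. 2 * (1 / of_nat (2 * Suc n) - 1 / of_nat (2 * Suc n + 1)))"
    by (intro span_sums_scale log2_in_span) auto
  then have "good (\<lambda>n. 1 / of_nat n - 1 / (of_nat n + 1 / 2))"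
    unfolding good_def wt_def phi_def
  proof (rule span_sums_eq)
    fix n
    have c: "2 / (2 * y) = 1 / y" for y :: complex by simp
    have "2 / of_nat (2 * Suc n) = (1 / of_nat (Suc n) :: complex)"
      by (simp only: of_nat_mult of_nat_numeral c)
    moreover have "2 / of_nat (2 * Suc n + 1) = (1 / (of_nat (Suc n) + 1 / 2) :: complex)"
    proof -
      have "of_nat (2 * Suc n + 1) = 2 * (of_nat (Suc n) + 1 / 2 :: complex)" by simp
      then show ?thesis by (simp only: c)
    qed
    ultimately show "2 * (1 / of_nat (2 * Suc n) - 1 / of_nat (2 * Suc n + 1)) =
        of_real (if k = 2 then pi else 1) * ((1 / of_nat (Suc n) - 1 / (of_nat (Suc n) + 1 / 2)) * complex_of_real (cbr (Suc n) powi k))"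
      using k by (simp add: right_diff_distrib del: of_nat_Suc of_nat_add of_nat_mult)
  qed
  moreover have "reducible (\<lambda>n. 1 / (of_nat n + (of_int 0 + 1 / 2)) ^ 1)"
    by (rule all_reducible_half[unfolded all_reducible_def, rule_format]) simp
  ultimately have "reducible (\<lambda>n. (1 / of_nat n - 1 / (of_nat n + 1 / 2)) + 1 / (of_nat n + (of_int 0 + 1 / 2)) ^ 1)"
    by (rule reducible_add[OF good_imp_reducible])
  then show ?thesis using k by simp
qed

lemma all_reducibleI:
  assumes "\<And>s. reducible (\<lambda>n. 1 / (of_nat n + a) ^ Suc s)"
  shows "all_reducible a"
  unfolding all_reducible_def
proof (intro allI impI)
  fix s :: nat assume "s \<ge> 1"
  with assms[of "s - 1"] show "reducible (\<lambda>n. 1 / (of_nat n + a) ^ s)" by simp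
qed

lemma all_reducible_0: "all_reducible 0"
  unfolding all_reducible_def
proof (intro allI impI)
  fix s :: nat assume s: "s \<ge> 1"
  show "reducible (\<lambda>n. 1 / (of_nat n + 0) ^ s)"
  proof (cases "s \<le> mdeg")
    case False
    then have "span_sums (\<lambda>n. 2 ^ s * (of_real (phi * wt (Suc n)) / of_nat (2 * Suc n) ^ s))"
      by (intro span_sums_scale K_power K_numeral base_even) simp
    then have "good (\<lambda>n. 1 / (of_nat n + 0) ^ s)"
      unfolding good_def
    proof (rule span_sums_eq)
      fix n
      have "(of_nat (2 * Suc n) :: complex) ^ s = 2 ^ s * (of_nat (Suc n) + 0) ^ s"
        by (simp only: of_nat_mult of_nat_numeral power_mult_distrib add_0_right)
      moreover have "2 ^ s * (of_real (phi * w) / (2 ^ s * y)) = of_real phi * (1 / y * complex_of_real w)" for w y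
        by simp
      ultimately show "2 ^ s * (of_real (phi * wt (Suc n)) / of_nat (2 * Suc n) ^ s) =
          of_real phi * (1 / (of_nat (Suc n) + 0) ^ s * complex_of_real (wt (Suc n)))"
        by (simp only:)
    qed
    then show ?thesis by (rule good_imp_reducible)
  qed (rule reducible_low_order_pole_0[OF s])
qed

lemma cbr_tendsto_0: "cbr \<longlonglongrightarrow> 0"
proof (rule tendsto_sandwich[OF _ _ tendsto_const])
  show "(\<lambda>n. 1 / sqrt (2 * real n + 1)) \<longlonglongrightarrow> 0" by real_asymp
  show "\<forall>\<^sub>F n in sequentially. cbr n \<le> 1 / sqrt (2 * real n + 1)"
    using cbr_upper by simp
  show "\<forall>\<^sub>F n in sequentially. 0 \<le> cbr n" using cbr_pos by (simp add: less_imp_le)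
qed

lemma of_nat_plus_1_nz: "of_nat n + 1 \<noteq> (0 :: complex)"
  by (metis of_nat_Suc of_nat_neq_0 add.commute)

lemma reducible_via_good:
  assumes "good d" "c \<in> K" "reducible f" "\<And>n. n \<ge> 1 \<Longrightarrow> g n = c * d n + f n"
  shows "reducible g"
  by (rule reducible_eq[OF reducible_add[OF reducible_scale[OF assms(2) good_imp_reducible[OF assms(1)]] assms(3)]])
     (rule assms(4))

lemma reducible_0: "reducible (\<lambda>n. 0)"
  by (rule good_imp_reducible[OF good_0])

text \<open>For positive exponents the weight itself tends to 0, so even the constant sequence
  telescopes to a finite value.\<close>

lemma good_telescope_const:
  assumes "k > 0"
  shows "good (\<lambda>n. of_real ((2 * real n + 1) / (2 * real n + 2)) powi k - 1)"
proof -
  have "wt = (\<lambda>n. cbr n ^ nat k)" using assms by (simp add: wt_def power_int_def fun_eq_iff)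
  moreover have "(0 :: real) ^ nat k = 0" using assms by simp
  ultimately have "wt \<longlonglongrightarrow> 0"
    using tendsto_power[OF cbr_tendsto_0, of "nat k"] by (simp only:)
  then have "good (\<lambda>n. 1 * of_real ((2 * real n + 1) / (2 * real n + 2)) powi k - 1)"
    using tendsto_of_real[of wt 0 sequentially, where ?'a = complex]
    by (intro good_telescope[where q = "\<lambda>_. 1" and l = 0]) auto
  then show ?thesis by simp
qed

text \<open>For \<open>k \<le> 0\<close> the upward exchange creates poles at 0 only. For
  \<open>k > 0\<close> it creates one at 1/2, whose reduction needs the present lemma. Instead the
  weight ratio is expanded as a power of \<open>1 - v / 2\<close> with
  \<open>v = 1 / (n + 1)\<close>, and the telescoping relations are solved for the highest power of
  \<open>v\<close>.\<close>

lemma all_reducible_1: "all_reducible 1"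
proof (cases "k > 0")
  case False
  have p0: "pole_ok 0" using pole_ok_nat[of 0] by simp
  have "all_reducible (0 + 1)"
  proof (rule all_reducible_up[OF p0])
    fix s :: nat assume "s \<ge> 1"
    then have "partial_fraction {0} (\<lambda>n. sigma n powi k * (1 / (of_nat n + 0) ^ s))"
      using False p0 by (intro partial_fraction_mult partial_fraction_sigma_power partial_fraction_pole) auto
    then have "reducible (\<lambda>n. sigma n powi k * (1 / (of_nat n + 0) ^ s))"
      by (rule partial_fraction_all_reducible) (simp add: all_reducible_0)
    then show "reducible (\<lambda>n. sigma n powi k / (of_nat n + 0) ^ s)" by simp
  qed
  then show ?thesis by simp
next
  case True
  have p0: "pole_ok 0" using pole_ok_nat[of 0] by simp
  have red0: "reducible (\<lambda>n. 1 / of_nat n ^ s)" if "s \<ge> 1" for s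
    using all_reducible_0 that by (simp add: all_reducible_def)
  note shift = good_shift_down[OF p0]
  define v where "v n = 1 / (of_nat n + 1 :: complex)" for n
  have v: "1 / (of_nat n + 1) ^ Suc s = v n * (1 / (of_nat n + 1) ^ s)" for n s
    by (simp add: v_def)
  have rho: "of_real ((2 * real n + 1) / (2 * real n + 2)) = 1 - 1 / 2 * v n" for n
  proof -
    define y where "y = (of_nat n + 1 :: complex)"
    have y: "y \<noteq> 0" "of_nat n + 1 / 2 = y - 1 / 2" using of_nat_plus_1_nz[of n] by (simp_all add: y_def)
    show ?thesis unfolding rho_eq v_def y_def[symmetric] y(2) using y(1) by (simp add: diff_divide_distrib)
  qed
  from True k_range have "k = 1 \<or> k = 2" by auto
  then show ?thesis
  proof
    assume k: "k = 1"
    have r: "of_real ((2 * real n + 1) / (2 * real n + 2)) powi k = 1 - 1 / 2 * v n" for n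
      unfolding k using rho by simp
    have "reducible (\<lambda>n. 1 / (of_nat n + 1) ^ Suc s)" for s
    proof (induction s)
      case 0
      show ?case
      proof (rule reducible_via_good[OF good_telescope_const[OF True] _ reducible_0])
        show "-2 \<in> K" by auto
        fix n :: nat
        show "1 / (of_nat n + 1 :: complex) ^ Suc 0 = - 2 * (of_real ((2 * real n + 1) / (2 * real n + 2)) powi k - 1) + 0"
          unfolding r v by simp
      qed
    next
      case (Suc s)
      have s: "Suc s \<ge> 1" by simp
      have f: "reducible (\<lambda>n. 2 * (1 / (of_nat n + 1) ^ Suc s) + - 2 * (1 / of_nat n ^ Suc s))"
        by (intro reducible_add reducible_scale Suc red0) auto
      \<comment> \<open>Telescoping a power of 1/n gives \<open>(1 - w / 2) * c - z\<close>; solving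
        for \<open>w * c\<close> expresses the next power of \<open>v\<close> through the previous
        one and a pole at 0.\<close>
      have e: "w * c = - 2 * ((1 - 1 / 2 * w) * c - z) + (2 * c + - 2 * z)" for w c z :: complex
        by (simp add: algebra_simps)
      show ?case
      proof (rule reducible_via_good[OF shift[OF s] _ f])
        show "-2 \<in> K" by auto
        fix n :: nat
        from e[of "v n" "1 / (of_nat n + 1) ^ Suc s" "1 / of_nat n ^ Suc s"]
        show "1 / (of_nat n + 1 :: complex) ^ Suc (Suc s) =
            - 2 * (of_real ((2 * real n + 1) / (2 * real n + 2)) powi k / (of_nat n + (0 + 1)) ^ Suc s - 1 / (of_nat n + 0) ^ Suc s) +
            (2 * (1 / (of_nat n + 1) ^ Suc s) + - 2 * (1 / of_nat n ^ Suc s))"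
          unfolding r v[of n "Suc s"] by (simp only: times_divide_eq_right mult_1_right add_0_left add_0_right)
      qed
    qed
    then show ?thesis by (rule all_reducibleI)
  next
    assume k: "k = 2"
    have sq: "(1 - 1 / 2 * w)\<^sup>2 = 1 - w + 1 / 4 * (w * w)" for w :: complex
      by (simp add: power2_eq_square algebra_simps)
    have r: "of_real ((2 * real n + 1) / (2 * real n + 2)) powi k = 1 - v n + 1 / 4 * (v n * v n)" for n
      unfolding k rho sq[symmetric] by simp
    have order1: "reducible (\<lambda>n. 1 / (of_nat n + 1))"
    proof -
      \<comment> \<open>For the square even the growing sequence n telescopes:
        \<open>(n + 1) * (1 - v / 2)\<^sup>2 - n\<close> is exactly \<open>v / 4\<close>. Its
        boundary value \<open>1 / pi\<close> becomes 1 after multiplication by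
        \<open>phi = pi\<close>.\<close>
      have "(\<lambda>n. complex_of_real (real n * (cbr n)\<^sup>2)) \<longlonglongrightarrow> of_real (1 / pi)"
        by (intro tendsto_of_real n_cbr_sq_tendsto)
      then have "(\<lambda>n. of_nat n * complex_of_real (wt n)) \<longlonglongrightarrow> of_real (1 / pi)"
        unfolding wt_def unfolding k by simp
      moreover have "of_real phi * complex_of_real (1 / pi) \<in> mzv_span"
        unfolding phi_def unfolding k by simp
      ultimately have "good (\<lambda>n. of_nat (Suc n) * of_real ((2 * real n + 1) / (2 * real n + 2)) powi k - of_nat n)"
        by (intro good_telescope[where q = of_nat]) auto
      then show ?thesis
      proof (rule reducible_via_good[OF _ _ reducible_0])
        show "4 \<in> K" by simp
        fix n :: nat
        define y where "y = (of_nat n + 1 :: complex)"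
        have yv: "y * v n = 1" using of_nat_plus_1_nz[of n] by (simp add: v_def y_def)
        have e: "y * (1 - w + 1 / 4 * (w * w)) = y - y * w + 1 / 4 * (y * w * w)" for w
          by (simp add: algebra_simps)
        have "v n = 4 * (y * (1 - v n + 1 / 4 * (v n * v n)) - (y - 1)) + 0"
          unfolding e yv by simp
        moreover have "of_nat (Suc n) = y" "of_nat n = y - 1" by (simp_all add: y_def)
        ultimately show "1 / (of_nat n + 1 :: complex) = 4 * (of_nat (Suc n) * of_real ((2 * real n + 1) / (2 * real n + 2)) powi k - of_nat n) + 0"
          unfolding r v_def[symmetric] by (simp only:)
      qed
    qed
    have order2: "reducible (\<lambda>n. 1 / (of_nat n + 1) ^ 2)"
    proof (rule reducible_via_good[OF good_telescope_const[OF True] _ reducible_scale[OF _ order1]])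
      show "4 \<in> K" "4 \<in> K" by simp_all
      have e: "w * w = 4 * ((1 - w + 1 / 4 * (w * w)) - 1) + 4 * w" for w :: complex
        by (simp add: algebra_simps)
      fix n :: nat
      have "1 / (of_nat n + 1 :: complex) ^ 2 = v n * v n" by (simp add: v_def power2_eq_square)
      then show "1 / (of_nat n + 1 :: complex) ^ 2 = 4 * (of_real ((2 * real n + 1) / (2 * real n + 2)) powi k - 1) + 4 * (1 / (of_nat n + 1))"
        unfolding r v_def[symmetric] using e[of "v n"] by (simp only:)
    qed
    \<comment> \<open>The expanded square has three terms, so each step of the recursion draws on
      two consecutive powers.\<close>
    have "reducible (\<lambda>n. 1 / (of_nat n + 1) ^ Suc s) \<and> reducible (\<lambda>n. 1 / (of_nat n + 1) ^ Suc (Suc s))" for s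
    proof (induction s)
      case 0
      then show ?case using order1 order2 by (simp add: power2_eq_square)
    next
      case (Suc s)
      have s: "Suc s \<ge> 1" by simp
      have f: "reducible (\<lambda>n. 4 * (1 / (of_nat n + 1) ^ Suc (Suc s)) + - 4 * (1 / (of_nat n + 1) ^ Suc s) + 4 * (1 / of_nat n ^ Suc s))"
        using Suc by (intro reducible_add reducible_scale red0) auto
      have e: "w * (w * c) = 4 * ((1 - w + 1 / 4 * (w * w)) * c - z) + (4 * (w * c) + - 4 * c + 4 * z)" for w c z :: complex
        by (simp add: algebra_simps)
      have "reducible (\<lambda>n. 1 / (of_nat n + 1) ^ Suc (Suc (Suc s)))"
      proof (rule reducible_via_good[OF shift[OF s] _ f])
        show "4 \<in> K" by simp
        fix n :: nat
        from e[of "v n" "1 / (of_nat n + 1) ^ Suc s" "1 / of_nat n ^ Suc s"]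
        show "1 / (of_nat n + 1 :: complex) ^ Suc (Suc (Suc s)) =
            4 * (of_real ((2 * real n + 1) / (2 * real n + 2)) powi k / (of_nat n + (0 + 1)) ^ Suc s - 1 / (of_nat n + 0) ^ Suc s) +
            (4 * (1 / (of_nat n + 1) ^ Suc (Suc s)) + - 4 * (1 / (of_nat n + 1) ^ Suc s) + 4 * (1 / of_nat n ^ Suc s))"
          unfolding r v[of n "Suc (Suc s)"] v[of n "Suc s"] by (simp only: times_divide_eq_right mult_1_right add_0_left add_0_right)
      qed
      with Suc show ?case by blast
    qed
    then show ?thesis by (intro all_reducibleI) blast
  qed
qed

text \<open>The downward exchange introduces only poles at -1 and -1/2, both settled; partial
  fractions separate them from the pole at hand.\<close>

lemma all_reducible_neg_half: "j \<le> 0 \<Longrightarrow> all_reducible (of_int j + 1 / 2)"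
proof (induction j rule: int_le_induct)
  case (step j)
  show ?case unfolding all_reducible_def
  proof (intro allI impI reducible_down pole_ok_half)
    fix s :: nat assume s: "s \<ge> 1"
    let ?D = "{of_int j + 1 / 2, 1, of_int 0 + 1 / 2}"
    have D: "\<forall>a\<in>?D. pole_ok a" using pole_ok_half[of j] pole_ok_half[of 0] pole_ok_nat[of 1] by auto
    have "partial_fraction ?D (\<lambda>n. of_real ((2 * real n + 1) / (2 * real n + 2)) powi k * (1 / (of_nat n + (of_int j + 1 / 2)) ^ s))"
      using s D by (intro partial_fraction_mult partial_fraction_rho_power partial_fraction_pole) auto
    then have "reducible (\<lambda>n. of_real ((2 * real n + 1) / (2 * real n + 2)) powi k * (1 / (of_nat n + (of_int j + 1 / 2)) ^ s))"
      by (rule partial_fraction_all_reducible) (use step all_reducible_1 all_reducible_half in auto)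
    then show "reducible (\<lambda>n. of_real ((2 * real n + 1) / (2 * real n + 2)) powi k / (of_nat n + (of_int (j - 1) + 1 / 2 + 1)) ^ s)"
      by (simp add: add_ac)
  qed auto
qed (rule all_reducible_half)

text \<open>General upward moves come last: \<open>sigma\<close> may bring in a pole at 1/2, which
  is available only once the downward moves are done.\<close>

lemma all_reducible_Suc:
  assumes a: "pole_ok a" "all_reducible a"
  shows "all_reducible (a + 1)"
proof (rule all_reducible_up[OF a(1)])
  fix s :: nat assume s: "s \<ge> 1"
  let ?D = "{a, 0, of_int (-1) + 1 / 2}"
  have D: "\<forall>a\<in>?D. pole_ok a" using a pole_ok_half[of "-1"] pole_ok_nat[of 0] by auto
  have "partial_fraction ?D (\<lambda>n. sigma n powi k * (1 / (of_nat n + a) ^ s))"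
    using s D by (intro partial_fraction_mult partial_fraction_sigma_power partial_fraction_pole) auto
  then have "reducible (\<lambda>n. sigma n powi k * (1 / (of_nat n + a) ^ s))"
    by (rule partial_fraction_all_reducible) (use a all_reducible_0 all_reducible_neg_half[of "-1"] in auto)
  then show "reducible (\<lambda>n. sigma n powi k / (of_nat n + a) ^ s)" by simp
qed

lemma all_reducible_nat: "all_reducible (of_nat m)"
proof (induction m)
  case (Suc m)
  from all_reducible_Suc[OF pole_ok_nat this] show ?case by (simp add: add.commute)
qed (simp add: all_reducible_0)

lemma all_reducible_half_integer: "all_reducible (of_int j + 1 / 2)"
proof (cases "j \<le> 0")
  case False
  have "all_reducible (of_nat m + (of_int 0 + 1 / 2))" for m
  proof (induction m)
    case (Suc m)
    have "pole_ok (of_nat m + (of_int 0 + 1 / 2))" using pole_ok_half[of "int m"] by simp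
    from all_reducible_Suc[OF this Suc] show ?case by (simp add: add_ac)
  qed (use all_reducible_half in simp)
  from this[of "nat j"] False show ?thesis by simp
qed (rule all_reducible_neg_half)

text \<open>\<open>mdeg\<close> is the largest exponent for which \<open>wt n / n ^ mdeg\<close> is
  not summable, so a harmonic lower bound holds for every \<open>k\<close>. The 5 comes from
  \<open>4 * n + 1 \<le> 5 * n\<close>.\<close>

lemma wt_lower: "n \<ge> 1 \<Longrightarrow> 1 / 5 / real n \<le> wt n / real n ^ mdeg"
proof -
  assume n: "n \<ge> 1"
  have c: "0 < cbr n" "cbr n \<le> 1" by (rule cbr_pos, rule cbr_le_1)
  have l: "1 / 5 / real n \<le> (cbr n)\<^sup>2"
  proof -
    have "1 \<le> (4 * real n + 1) * (cbr n)\<^sup>2" by (rule cbr_sq_lower)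
    also have "\<dots> \<le> (5 * real n) * (cbr n)\<^sup>2" using n by (intro mult_right_mono) auto
    finally show ?thesis using n by (simp add: field_simps)
  qed
  have s: "(cbr n)\<^sup>2 \<le> cbr n" using c by (simp add: power2_eq_square mult_left_le)
  have i: "1 \<le> 1 / cbr n" using c by simp
  have i2: "1 / (5 * real n) \<le> 1 / ((cbr n)\<^sup>2 * (real n)\<^sup>2)"
  proof -
    have "(cbr n)\<^sup>2 * (real n)\<^sup>2 \<le> 5 * real n"
    proof -
      have "(cbr n)\<^sup>2 * real n \<le> (2 * real n + 1) * (cbr n)\<^sup>2" using n by (subst mult.commute, intro mult_right_mono) auto
      also have "\<dots> \<le> 1" by (rule cbr_sq_upper)
      finally have "(cbr n)\<^sup>2 * real n * real n \<le> 1 * real n" by (intro mult_right_mono) auto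
      then show ?thesis by (simp add: power2_eq_square mult.assoc)
    qed
    moreover have "0 < (cbr n)\<^sup>2 * (real n)\<^sup>2" using n c by simp
    ultimately show ?thesis by (intro divide_left_mono) auto
  qed
  have i1: "1 / (5 * real n) \<le> 1 / (cbr n * real n)"
    using n c by (intro divide_left_mono mult_right_mono) auto
  have i0: "1 / (5 * real n) \<le> 1 / real n"
    using n by (intro divide_left_mono) auto
  show ?thesis
    unfolding wt_def mdeg_def
    by (cases rule: k_cases)
       (use n l s i0 i1 i2 in \<open>auto simp: power_int_minus inverse_eq_divide intro: divide_right_mono\<close>)
qed

lemma poly_over_power_tendsto:
  "(\<lambda>n. poly p (of_nat n) / of_nat n ^ degree p) \<longlonglongrightarrow> (lead_coeff p :: complex)"
proof -
  have "(\<lambda>n. \<Sum>i\<le>degree p. coeff p i * (1 / of_nat n) ^ (degree p - i)) \<longlonglongrightarrow>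
      (\<Sum>i\<le>degree p. coeff p i * 0 ^ (degree p - i))"
    by (intro tendsto_intros)
  also have "(\<Sum>i\<le>degree p. coeff p i * 0 ^ (degree p - i)) = (\<Sum>i\<in>{degree p}. coeff p i * 0 ^ (degree p - i))"
    by (rule sum.mono_neutral_right) auto
  finally have "(\<lambda>n. \<Sum>i\<le>degree p. coeff p i * (1 / of_nat n) ^ (degree p - i)) \<longlonglongrightarrow> lead_coeff p" by simp
  moreover have "\<forall>\<^sub>F n in sequentially. (\<Sum>i\<le>degree p. coeff p i * (1 / of_nat n) ^ (degree p - i)) =
      poly p (of_nat n) / of_nat n ^ degree p"
  proof (rule eventually_sequentiallyI[of 1])
    fix n :: nat assume n: "n \<ge> 1"
    have "(1 / of_nat n) ^ (degree p - i) = (of_nat n ^ i / of_nat n ^ degree p :: complex)" if "i \<le> degree p" for i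
    proof -
      have "(of_nat n :: complex) ^ degree p = of_nat n ^ (degree p - i) * of_nat n ^ i"
        using that by (simp flip: power_add)
      then show ?thesis using n by (simp add: power_divide)
    qed
    then show "(\<Sum>i\<le>degree p. coeff p i * (1 / of_nat n) ^ (degree p - i)) = poly p (of_nat n) / of_nat n ^ degree p"
      unfolding poly_altdef sum_divide_distrib by (intro sum.cong refl) simp
  qed
  ultimately show ?thesis by (rule Lim_transform_eventually)
qed

text \<open>Divided by the leading coefficient, the terms are a positive weight times a factor
  tending to 1. Their real parts eventually exceed \<open>1 / (10 * n)\<close>, so even conditional
  convergence is impossible.\<close>

lemma poly_part_not_summable:
  fixes p :: "complex poly"
  assumes "p \<noteq> 0"
  shows "\<not> summable (\<lambda>n. poly p (of_nat n) / (of_nat n + 1 / 2) ^ mdeg * of_real (wt n))"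
proof
  define x where "x n = poly p (of_nat n) / (of_nat n + 1 / 2) ^ mdeg * complex_of_real (wt n)" for n
  define l where "l = lead_coeff p"
  define z where "z n = poly p (of_nat n) / of_nat n ^ degree p * (of_nat n / (of_nat n + 1 / 2)) ^ mdeg" for n
  define w where "w n = real n ^ degree p * (wt n / real n ^ mdeg)" for n
  assume "summable (\<lambda>n. poly p (of_nat n) / (of_nat n + 1 / 2) ^ mdeg * of_real (wt n))"
  then have "summable (\<lambda>n. x n / l)" unfolding x_def by (rule summable_divide)
  then have sR: "summable (\<lambda>n. Re (x n / l))" by (rule summable_Re)
  have l: "l \<noteq> 0" using assms by (simp add: l_def)
  have xw: "x n = z n * of_real (w n)" if "n \<ge> 1" for n
    using that by (simp add: x_def z_def w_def power_divide)
  have "(\<lambda>n. of_nat n / (of_nat n + 1 / 2 :: complex)) \<longlonglongrightarrow> 1"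
    using half_shift_nz by (intro tendsto_n_over_shift) auto
  then have "z \<longlonglongrightarrow> l * 1 ^ mdeg"
    unfolding z_def l_def by (intro tendsto_mult poly_over_power_tendsto tendsto_power)
  then have "(\<lambda>n. Re (z n / l)) \<longlonglongrightarrow> Re (l / l)"
    by (intro tendsto_Re tendsto_divide) (auto simp: l)
  then have "\<forall>\<^sub>F n in sequentially. Re (z n / l) > 1 / 2"
    using l by (intro order_tendstoD(1)[of _ 1]) auto
  then have "\<forall>\<^sub>F n in sequentially. norm (inverse (real n)) \<le> 10 * Re (x n / l)"
    using eventually_ge_at_top[of 1]
  proof eventually_elim
    case (elim n)
    have "1 / 5 / real n \<le> 1 * (wt n / real n ^ mdeg)" using wt_lower[OF elim(2)] by simp
    also have "\<dots> \<le> w n"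
      unfolding w_def using elim wt_pos[of n] by (intro mult_right_mono) auto
    finally have "1 / 2 * (1 / 5 / real n) \<le> Re (z n / l) * w n"
      using elim by (intro mult_mono) auto
    also have "\<dots> = Re (x n / l)"
    proof -
      have "x n / l = of_real (w n) * (z n / l)" unfolding xw[OF elim(2)] by simp
      then show ?thesis by (simp only: Re_complex_of_real Im_complex_of_real times_complex.sel) simp
    qed
    finally show ?case using elim by (simp add: inverse_eq_divide)
  qed
  from summable_comparison_test_ev[OF this summable_mult[OF sR]] show False
    using not_summable_harmonic[where ?'a = real] by simp
qed

text \<open>The \<open>good\<close> part converges by definition, so convergence passes to the
  polynomial part and annihilates it. The term at n = 0, which \<open>reducible\<close> does not
  see, contributes \<open>phi * f 0\<close>.\<close>

lemma summable_partial_fraction_in_span: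
  assumes "reducible f" and f0: "f 0 \<in> K" and sum: "summable (\<lambda>n. f n * of_real (wt n))"
  shows "of_real phi * (\<Sum>n. f n * of_real (wt n)) \<in> mzv_span"
proof -
  obtain p g where g: "good g" and f: "\<And>n. n \<ge> 1 \<Longrightarrow> f n = poly p (of_nat n) / (of_nat n + 1 / 2) ^ mdeg + g n"
    using assms(1) unfolding reducible_def by blast
  from g obtain L where L: "L \<in> mzv_span" "(\<lambda>n. of_real phi * (g (Suc n) * of_real (wt (Suc n)))) sums L"
    unfolding good_def span_sums_def by blast
  have phi: "complex_of_real phi \<noteq> 0" by (simp add: phi_def)
  have "summable (\<lambda>n. of_real phi * (g (Suc n) * of_real (wt (Suc n))) / of_real phi)"
    using L(2) by (intro summable_divide) (rule sums_summable)
  then have sg: "summable (\<lambda>n. g (Suc n) * of_real (wt (Suc n)))" using phi by simp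
  have "summable (\<lambda>n. f (Suc n) * of_real (wt (Suc n)))"
    using sum by (subst summable_Suc_iff)
  from summable_diff[OF this sg]
  have "summable (\<lambda>n. poly p (of_nat (Suc n)) / (of_nat (Suc n) + 1 / 2) ^ mdeg * of_real (wt (Suc n)))"
    by (simp add: f left_diff_distrib[symmetric] del: of_nat_Suc)
  then have "summable (\<lambda>n. poly p (of_nat n) / (of_nat n + 1 / 2) ^ mdeg * complex_of_real (wt n))"
    by (subst (asm) summable_Suc_iff)
  with poly_part_not_summable have "p = 0" by blast
  then have fg: "f (Suc n) = g (Suc n)" for n using f[of "Suc n"] by simp
  have "(\<lambda>n. of_real phi * (f (Suc n) * of_real (wt (Suc n)))) sums L" using L(2) by (simp add: fg)
  then have "(\<lambda>n. of_real phi * (f n * of_real (wt n))) sums (L + of_real phi * (f 0 * of_real (wt 0)))"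
    by (subst (asm) sums_Suc_iff)
  then have "of_real phi * (\<Sum>n. f n * of_real (wt n)) = L + of_real phi * f 0"
    using suminf_mult[OF sum] by (simp add: sums_iff wt_0)
  then show ?thesis using L(1) mzv_span_scale'[OF f0 phi_in_span] by auto
qed

end

section \<open>Rational functions\<close>

lemma is_subfield_hull: "is_subfield (is_subfield hull S)"
proof (rule hull_in)
  fix F :: "complex set set"
  assume "Ball F is_subfield"
  then show "is_subfield (\<Inter>F)" unfolding is_subfield_def by (simp add: Ball_def)
qed

lemma subfield_with_i_cyclotomic: "subfield_with_i (cyclotomic_adjoin 4 S)"
proof
  show "is_subfield (cyclotomic_adjoin 4 S)"
    unfolding cyclotomic_adjoin_def by (rule is_subfield_hull)
  have "exp (2 * of_real pi * \<i> / of_nat 4) = cis (pi / 2)"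
    by (simp add: cis_conv_exp mult.commute)
  then have "exp (2 * of_real pi * \<i> / of_nat 4) = \<i>" by simp
  then show "\<i> \<in> cyclotomic_adjoin 4 S"
    unfolding cyclotomic_adjoin_def using hull_subset[of "insert \<i> S" is_subfield] by simp
qed

lemma coeffs_in_cyclotomic: "S \<subseteq> cyclotomic_adjoin N S"
  unfolding cyclotomic_adjoin_def using hull_subset[of "insert _ S" is_subfield] by blast

context subfield_with_i
begin

lemma partial_fraction_prod:
  assumes "\<And>x. x \<in> A \<Longrightarrow> partial_fraction D (f x)" and D: "\<forall>a\<in>D. pole_ok a"
  shows "partial_fraction D (\<lambda>n. \<Prod>x\<in>A. f x n)"
  using assms(1)
proof (induction A rule: infinite_finite_induct)
  case (insert x A)
  then have "partial_fraction D (\<lambda>n. f x n * (\<Prod>x\<in>A. f x n))"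
    by (intro partial_fraction_mult D) auto
  with insert show ?case by simp
qed (simp_all add: partial_fraction_const)

text \<open>The factorisation of the denominator is taken over the complex numbers, but all its
  roots lie in \<open>K\<close> because elements of \<open>D\<close> do; hence the partial fraction
  coefficients stay in \<open>K\<close> too.\<close>

lemma partial_fraction_rf_eval:
  assumes num: "set (coeffs (rf_num R)) \<subseteq> K" and den: "set (coeffs (rf_den R)) \<subseteq> K"
    and D: "\<forall>a\<in>D. pole_ok a" and poles: "uminus ` rf_poles R \<subseteq> D"
  shows "partial_fraction D (\<lambda>n. rf_eval R (of_nat n))"
proof -
  let ?d = "rf_den R"
  have d0: "?d \<noteq> 0" by (simp add: rf_den_def)
  have lc: "inverse (lead_coeff ?d) \<in> K"
    using den d0 by (intro K_inverse) (auto simp: coeffs_def)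
  have "partial_fraction D (\<lambda>n. \<Prod>z\<in>rf_poles R. (1 / (of_nat n + - z) ^ 1) ^ order z ?d)"
    using poles by (intro partial_fraction_prod partial_fraction_power partial_fraction_pole D) auto
  then have "partial_fraction D (\<lambda>n. poly (rf_num R) (of_nat n) *
      (inverse (lead_coeff ?d) * (\<Prod>z\<in>rf_poles R. (1 / (of_nat n + - z) ^ 1) ^ order z ?d)))"
    by (intro partial_fraction_mult[OF _ _ D] partial_fraction_poly num partial_fraction.scale lc)
  moreover have "inverse (lead_coeff ?d) * (\<Prod>z\<in>rf_poles R. (1 / (of_nat n + - z) ^ 1) ^ order z ?d) =
      inverse (poly ?d (of_nat n))" for n
  proof -
    have "?d = smult (lead_coeff ?d) (\<Prod>z\<in>rf_poles R. [:- z, 1:] ^ order z ?d)"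
      using complex_poly_decompose[of ?d] by (simp add: rf_poles_def)
    then have "poly ?d (of_nat n) = lead_coeff ?d * (\<Prod>z\<in>rf_poles R. (of_nat n + - z) ^ order z ?d)"
      by (metis (no_types, lifting) poly_smult poly_prod poly_power poly_pCons poly_0 add.commute mult.right_neutral mult_zero_right add_0_right prod.cong)
    then show ?thesis
      by (simp add: prod_inversef[symmetric] power_inverse inverse_eq_divide power_divide prod_dividef)
  qed
  ultimately show ?thesis by (simp add: rf_eval_def divide_inverse)
qed

end

theorem theorem1:
  fixes R :: "complex poly fract"
  assumes "rf_poles R \<subseteq> {- of_nat m / 2 | m. m \<ge> 1} \<union> {of_nat (2 * m + 1) / 2 | m. True}"
  shows "(\<forall>k \<in> {0, 1, -1, -2 :: int}.
            summable (\<lambda>n. rf_eval R (of_nat n) * central_binomial_ratio n powi k) \<longrightarrow>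
            expressible_via_MZVs 4 R
              (\<Sum>n. rf_eval R (of_nat n) * central_binomial_ratio n powi k)) \<and>
         (summable (\<lambda>n. rf_eval R (of_nat n) * central_binomial_ratio n ^ 2) \<longrightarrow>
            expressible_via_MZVs 4 R
              (of_real pi * (\<Sum>n. rf_eval R (of_nat n) * central_binomial_ratio n ^ 2)))"
proof -
  define K where "K = cyclotomic_adjoin 4 (rf_coeffs R)"
  interpret subfield_with_i K
    unfolding K_def by (rule subfield_with_i_cyclotomic)
  have expr: "expressible_via_MZVs 4 R x \<longleftrightarrow> x \<in> mzv_span" for x
    unfolding expressible_via_MZVs_def mzv_span_def K_def[symmetric] by blast
  have "rf_coeffs R \<subseteq> K"
    unfolding K_def by (rule coeffs_in_cyclotomic)
  then have coeffs: "set (coeffs (rf_num R)) \<subseteq> K" "set (coeffs (rf_den R)) \<subseteq> K"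
    by (auto simp: rf_coeffs_def)
  \<comment> \<open>Shifts a for poles at -a. Half-integers of both signs are allowed, since no
    index n meets them; integral shifts must be nonnegative.\<close>
  define D :: "complex set" where "D = range of_nat \<union> range (\<lambda>j. of_int j + 1 / 2)"
  have D: "\<forall>a\<in>D. pole_ok a"
    using pole_ok_nat pole_ok_half by (auto simp: D_def)
  have "uminus ` rf_poles R \<subseteq> D"
  proof
    fix a assume "a \<in> uminus ` rf_poles R"
    with assms consider m where "a = of_nat m / 2" | m where "a = - (of_nat (2 * m + 1) / 2)" by fastforce
    then show "a \<in> D"
    proof cases
      case (1 m)
      show ?thesis
      proof (cases "even m")
        case True
        then obtain l where "m = 2 * l" by auto
        then show ?thesis using 1 by (simp add: D_def)
      next
        case False
        then obtain l where "m = 2 * l + 1" by (elim oddE)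
        then have "a = of_int (int l) + 1 / 2" using 1 by (simp add: add_divide_distrib)
        then show ?thesis unfolding D_def by blast
      qed
    next
      case (2 m)
      then have "a = of_int (- int m - 1) + 1 / 2" by (simp add: add_divide_distrib)
      then show ?thesis unfolding D_def by blast
    qed
  qed
  from partial_fraction_rf_eval[OF coeffs D this]
  have pf: "partial_fraction D (\<lambda>n. rf_eval R (of_nat n))" .
  \<comment> \<open>The value at 0 is the quotient of the two constant coefficients.\<close>
  have f0: "rf_eval R (of_nat 0) \<in> K"
    using coeff_in_K[OF coeffs(1), of 0] coeff_in_K[OF coeffs(2), of 0] by (auto simp: rf_eval_def poly_0_coeff_0)
  have main: "of_real (if k = 2 then pi else 1) * (\<Sum>n. rf_eval R (of_nat n) * central_binomial_ratio n powi k) \<in> mzv_span"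
    if k: "k \<in> {-2, -1, 0, 1, 2}" and s: "summable (\<lambda>n. rf_eval R (of_nat n) * central_binomial_ratio n powi k)" for k :: int
  proof -
    interpret cbr_power K k by standard (rule k)
    have w: "central_binomial_ratio n powi k = of_real (wt n)" for n
      by (simp add: central_binomial_ratio_eq wt_def of_real_power_int)
    have "reducible (\<lambda>n. rf_eval R (of_nat n))"
      by (rule partial_fraction_all_reducible[OF pf])
         (auto simp: D_def intro: all_reducible_nat all_reducible_half_integer)
    from summable_partial_fraction_in_span[OF this f0 s[unfolded w]]
    show ?thesis unfolding w phi_def .
  qed
  show ?thesis
    unfolding expr
  proof (intro conjI ballI impI)
    fix k :: int
    assume "k \<in> {0, 1, -1, -2}" "summable (\<lambda>n. rf_eval R (of_nat n) * central_binomial_ratio n powi k)"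
    with main[of k] show "(\<Sum>n. rf_eval R (of_nat n) * central_binomial_ratio n powi k) \<in> mzv_span" by auto
  next
    assume "summable (\<lambda>n. rf_eval R (of_nat n) * central_binomial_ratio n ^ 2)"
    with main[of 2] show "of_real pi * (\<Sum>n. rf_eval R (of_nat n) * central_binomial_ratio n ^ 2) \<in> mzv_span" by simp
  qed
qed

end
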